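(* Fix $\alpha\in(0,1)$ and a constant $K>0$. Under the setup and regularity conditions stated in the context (with local linear regression, $p=1$), the confidence interval $$C^{1-\alpha}_{\mathrm{BSD}}=\Big(\widehat\tau\pm\operatorname{cv}_{1-\alpha}(r_{\sup})\times\widehat\sigma_{\mathrm{NN}}/\sqrt{N_h}\Big)$$ is honest with respect to $\mathcal M_{\mathrm H}(K)$, that is, $$\liminf_{N\to\infty}\ \inf_{\mu\in\mathcal M_{\mathrm H}(K)}P_\mu\big(\tau\in C^{1-\alpha}_{\mathrm{BSD}}\big)\ge1-\alpha .$$ Here $\operatorname{cv}_{1-\alpha}(r)$ is the $1-\alpha$ quantile of the distribution of $|Z|$ with $Z\sim\mathcal N(r,1)$, and $$r_{\sup}=-\frac K2\,\frac{\sum_{i:\,|X_i|\le h}w(X_i)X_i^2\operatorname{sign}(X_i)}{\widehat\sigma_{\mathrm{NN}}/\sqrt{N_h}},\qquad w(X_i)=\frac1{N_h}e_1'\widehat Q^{-1}M_i .$$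
   Context: **Model.** For each $N$, the data $\{Y_i,X_i\}_{i=1}^N$ are i.i.d. with law $P_N$ (written $P_\mu$ when emphasizing dependence on $\mu$; expectation $\mathbb E_N$). $X_i$ is discrete with support points $x_1<\dots<x_{G^-}<0\le x_{G^-+1}<\dots<x_G$, $G=G^-+G^+$. $\mu:\mathbb R\to\mathbb R$ is the conditional expectation function, $\mu(x_g)=\mathbb E_N(Y_i\mid X_i=x_g)$; $\varepsilon_i=Y_i-\mu(X_i)$; $\sigma^2(x_g)=\sigma_g^2=\mathbb V_N(\varepsilon_i\mid X_i=x_g)$. The parameter of interest is $\tau=\lim_{x\downarrow0}\mu(x)-\lim_{x\uparrow0}\mu(x)$. For each $N$ the joint distribution of $(X_i,\varepsilon_i)$ is held fixed as $\mu$ varies over the function class. $h=h_N>0$ is a non-random bandwidth sequence, $\mathcal G_h=\{g:|x_g|\le h\}$, $\pi_g=P_N(X_i=x_g)$, $\pi=P_N(|X_i|\le h)$, $N_h=\sum_{i=1}^N\mathbb 1\{|X_i|\le h\}$. With $p=1$, $m(x)=(\mathbb 1\{x\ge0\},1,x,\mathbb 1\{x\ge0\}x)'$, $M_i=\mathbb 1\{|X_i|\le h\}m(X_i)$, $\widehat Q=N_h^{-1}\sum_{i=1}^NM_iM_i'$, $Q_N=\mathbb E_N(M_iM_i')/\pi$, $H=\operatorname{diag}\{m(h)\}$ (the diagonal matrix with the entries of $m(h)$), $e_1=(1,0,0,0)'$. The estimator is $\widehat\tau=e_1'\widehat\theta$, $\widehat\theta=\widehat Q^{-1}N_h^{-1}\sum_{i=1}^NM_iY_i$.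 **Function class.** $$\mathcal M_{\mathrm H}(K)=\{\mu:|\mu'(a)-\mu'(b)|\le K|a-b|\text{ for all }a,b\in\mathbb R_-\text{ and all }a,b\in\mathbb R_+\},$$ where $\mu$ may jump at $0$; on each side of $0$ the condition refers to the restriction of $\mu$ to that side (value and one-sided derivative at $0$ taken from that side; $\mu(0)$ is the right limit). **Nearest-neighbor variance estimator.** With $n_g=\sum_{i=1}^N\mathbb 1\{X_i=x_g\}$, $\overline Y_g=n_g^{-1}\sum_{i:X_i=x_g}Y_i$, $\widehat\sigma_g^2=\sum_{i:X_i=x_g}(Y_i-\overline Y_g)^2/(n_g-1)$ (and $\widehat\sigma_g^2=0$ if $n_g\le1$), $$\widehat\sigma^2_{\mathrm{NN}}=e_1'\widehat Q^{-1}\widehat\Omega_{\mathrm{NN}}\widehat Q^{-1}e_1,\qquad\widehat\Omega_{\mathrm{NN}}=\frac1{N_h}\sum_{g\in\mathcal G_h}n_g\widehat\sigma_g^2\,m(x_g)m(x_g)'.$$ **Regularity conditions.** (1) $\sup_N\max_g\mathbb E_N(\varepsilon_i^4\mid X_i=x_g)<\infty$; $\det(H^{-1}Q_NH^{-1})>C$ for some $C>0$ not depending on $N$; $N\pi\to\infty$; $\lim_{N\to\infty}H^{-1}Q_NH^{-1}$ exists. (2) $\tilde\sigma_\tau^2=e_1'HQ_N^{-1}H\tilde\Omega HQ_N^{-1}He_1$ is bounded and bounded away from zero, where $\tilde\Omega=\mathbb E_N[\sigma^2(X_i)\lambda(X_i)]/\pi$ and $\lambda(x)=m(x/h)m(x/h)'\mathbb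 1\{|x|\le h\}$. (3) As $N\to\infty$, $P_N\big(\sum_{g\in\mathcal G_h}\mathbb 1\{n_g\le1\}>0\big)\to0$. (4) $h\to0$ as $N\to\infty$. *)

theory Defs
  imports "HOL-Probability.Probability"
begin

(* Observations are pairs (X, Y); errors enter as pairs (X, epsilon).  The running
   variable is the first component in both cases. *)

definition x_support :: "(real \<times> real) measure \<Rightarrow> real set" where
  "x_support D = {x. 0 < measure D {z. fst z = x}}"

text \<open>Conditional law given \<open>X = x\<close>, for a support point \<open>x\<close>.\<close>

definition given_x :: "(real \<times> real) measure \<Rightarrow> real \<Rightarrow> (real \<times> real) measure" where
  "given_x D x = uniform_measure D {z. fst z = x}"

text \<open>Admissible joint laws of \<open>(X, \<epsilon>)\<close>.  The last condition is what
  \<open>\<mu>(x) = E(Y | X = x)\<close> means for \<open>\<epsilon> = Y - \<mu>(X)\<close>.\<close>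

definition error_design :: "(real \<times> real) measure \<Rightarrow> bool" where
  "error_design D \<longleftrightarrow>
     prob_space D \<and> sets D = sets borel \<and>
     finite (x_support D) \<and> measure D {z. fst z \<in> x_support D} = 1 \<and>
     (\<forall>x\<in>x_support D. integrable (given_x D x) snd \<and> (\<integral>z. snd z \<partial>given_x D x) = 0)"

text \<open>Law of one observation \<open>(X, Y)\<close> with \<open>Y = \<mu>(X) + \<epsilon>\<close>; the law \<open>D\<close> of
  \<open>(X, \<epsilon>)\<close> does not change with \<open>\<mu>\<close>.\<close>

definition obs_law :: "(real \<times> real) measure \<Rightarrow> (real \<Rightarrow> real) \<Rightarrow> (real \<times> real) measure" where
  "obs_law D \<mu> = distr D borel (\<lambda>z. (fst z, \<mu> (fst z) + snd z))"

lemma obs_law_cond_mean: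
  assumes D: "error_design D" and mu [measurable]: "\<mu> \<in> borel_measurable borel"
    and x: "x \<in> x_support D"
  shows "integrable (given_x (obs_law D \<mu>) x) snd"
    and "(\<integral>z. snd z \<partial>given_x (obs_law D \<mu>) x) = \<mu> x"
proof -
  interpret prob_space D using D by (simp add: error_design_def)
  have sets_D [measurable_cong]: "sets D = sets borel" using D by (simp add: error_design_def)
  have sp: "space D = UNIV" using sets_eq_imp_space_eq[OF sets_D] by simp
  define T where "T = (\<lambda>z::real \<times> real. (fst z, \<mu> (fst z) + snd z))"
  have fst_m [measurable]: "fst \<in> borel_measurable (borel :: (real \<times> real) measure)"
    and snd_m [measurable]: "snd \<in> borel_measurable (borel :: (real \<times> real) measure)"
    by (simp_all add: borel_measurable_continuous_onI continuous_on_fst continuous_on_snd)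
  have T [measurable]: "T \<in> borel \<rightarrow>\<^sub>M borel" unfolding T_def by measurable
  have TD: "T \<in> D \<rightarrow>\<^sub>M borel" using T sets_D measurable_cong_sets by blast
  have S [measurable]: "{z :: real \<times> real. fst z = x} \<in> sets borel"
    by (intro borel_closed closed_Collect_eq) (auto intro!: continuous_intros)
  have SD: "{z :: real \<times> real. fst z = x} \<in> sets D" using S sets_D by simp
  have fst_T: "fst (T z) = fst z" for z by (simp add: T_def)
  have given_eq: "given_x (obs_law D \<mu>) x = distr (given_x D x) borel T"
  proof (rule measure_eqI)
    show "sets (given_x (obs_law D \<mu>) x) = sets (distr (given_x D x) borel T)"
      by (simp add: given_x_def obs_law_def)
    fix A assume "A \<in> sets (given_x (obs_law D \<mu>) x)"
    then have A: "A \<in> sets borel" by (simp add: given_x_def obs_law_def)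
    have TA: "T -` A \<in> sets D" using measurable_sets[OF TD A] sp by simp
    have TG: "T \<in> given_x D x \<rightarrow>\<^sub>M borel" using TD by (simp add: given_x_def)
    show "emeasure (given_x (obs_law D \<mu>) x) A = emeasure (distr (given_x D x) borel T) A"
      using A S SD TA
      by (simp add: given_x_def obs_law_def flip: T_def)
         (subst emeasure_distr, use TD TG in \<open>simp_all add: given_x_def sp fst_T emeasure_distr\<close>)
  qed
  have ig: "integrable (given_x D x) snd" and i0: "(\<integral>z. snd z \<partial>given_x D x) = 0"
    using D x by (auto simp: error_design_def)
  have pos: "emeasure D {z. fst z = x} \<noteq> 0"
    using x by (auto simp: x_support_def measure_def)
  interpret G: prob_space "given_x D x"
    unfolding given_x_def by (rule prob_space_uniform_measure) (use pos in auto)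
  have AE: "AE z in given_x D x. \<mu> x + snd z = snd (T z)"
    unfolding given_x_def by (rule AE_uniform_measureI[OF SD]) (auto simp: T_def)
  have TG: "T \<in> given_x D x \<rightarrow>\<^sub>M borel" using TD by (simp add: given_x_def)
  have m1: "(\<lambda>z. \<mu> x + snd z) \<in> borel_measurable (given_x D x)" using ig by auto
  have m2: "(\<lambda>z. snd (T z)) \<in> borel_measurable (given_x D x)"
    using measurable_compose[OF TG snd_m] .
  have "integrable (given_x D x) (\<lambda>z. \<mu> x + snd z)" using ig by simp
  then have "integrable (given_x D x) (\<lambda>z. snd (T z))"
    using integrable_cong_AE[OF m1 m2 AE] by simp
  then show "integrable (given_x (obs_law D \<mu>) x) snd"
    unfolding given_eq by (subst integrable_distr_eq[OF TG snd_m])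
  have "(\<integral>z. snd z \<partial>given_x (obs_law D \<mu>) x) = (\<integral>z. snd (T z) \<partial>given_x D x)"
    unfolding given_eq by (rule integral_distr[OF TG snd_m])
  also have "\<dots> = (\<integral>z. \<mu> x + snd z \<partial>given_x D x)"
    using integral_cong_AE[OF m1 m2 AE] by simp
  also have "\<dots> = \<mu> x" using ig i0 by (simp add: G.prob_space)
  finally show "(\<integral>z. snd z \<partial>given_x (obs_law D \<mu>) x) = \<mu> x" .
qed

definition sample_law :: "nat \<Rightarrow> (real \<times> real) measure \<Rightarrow> (nat \<Rightarrow> real \<times> real) measure" where
  "sample_law N L = PiM {1..N} (\<lambda>_. L)"

definition cond_var :: "(real \<times> real) measure \<Rightarrow> real \<Rightarrow> real" where
  "cond_var D x = (\<integral>z. (snd z - (\<integral>w. snd w \<partial>given_x D x))\<^sup>2 \<partial>given_x D x)"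

definition window_points :: "(real \<times> real) measure \<Rightarrow> real \<Rightarrow> real set" where
  "window_points D h = {x \<in> x_support D. \<bar>x\<bar> \<le> h}"

definition window_mass :: "(real \<times> real) measure \<Rightarrow> real \<Rightarrow> real" where
  "window_mass D h = measure D {z. \<bar>fst z\<bar> \<le> h}"

definition jump :: "(real \<Rightarrow> real) \<Rightarrow> real" where
  "jump \<mu> = Lim (at_right 0) \<mu> - Lim (at_left 0) \<mu>"

definition lipschitz_deriv_on :: "real \<Rightarrow> real set \<Rightarrow> (real \<Rightarrow> real) \<Rightarrow> bool" where
  "lipschitz_deriv_on K S f \<longleftrightarrow>
     (\<exists>f'. (\<forall>x\<in>S. (f has_real_derivative f' x) (at x within S)) \<and>
           (\<forall>a\<in>S. \<forall>b\<in>S. \<bar>f' a - f' b\<bar> \<le> K * \<bar>a - b\<bar>))"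

text \<open>On the left of the cutoff the value at \<open>0\<close> is the left limit.  If that limit does
  not exist, \<open>Lim\<close> is arbitrary, but then no value at \<open>0\<close> makes the function
  differentiable on \<open>{..0}\<close>, so \<open>\<mu>\<close> is excluded from the class below.\<close>

definition left_branch :: "(real \<Rightarrow> real) \<Rightarrow> real \<Rightarrow> real" where
  "left_branch \<mu> x = (if x < 0 then \<mu> x else Lim (at_left 0) \<mu>)"

definition holder_class :: "real \<Rightarrow> (real \<Rightarrow> real) set" where
  "holder_class K =
     {\<mu>. lipschitz_deriv_on K {..0} (left_branch \<mu>) \<and> lipschitz_deriv_on K {0..} \<mu>}"

definition outer :: "real ^ 'n \<Rightarrow> real ^ 'n ^ 'n" where
  "outer v = (\<chi> i j. v $ i * v $ j)"

definition regr :: "real \<Rightarrow> real ^ 4" where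
  "regr x = vector [indicator {0..} x, 1, x, indicator {0..} x * x]"

lemma regr_nth [simp]:
  "regr x $ 1 = indicator {0..} x" "regr x $ 2 = 1" "regr x $ 3 = x"
  "regr x $ 4 = indicator {0..} x * x"
  by (simp_all add: regr_def vector_def)

definition window_regr :: "real \<Rightarrow> real \<Rightarrow> real ^ 4" where
  "window_regr h x = indicator {- h..h} x *\<^sub>R regr x"

definition scale_mat :: "real \<Rightarrow> real ^ 4 ^ 4" where
  "scale_mat h = (\<chi> i j. if i = j then regr h $ i else 0)"

definition e1 :: "real ^ 4" where
  "e1 = axis 1 1"

definition Q_pop :: "(real \<times> real) measure \<Rightarrow> real \<Rightarrow> real ^ 4 ^ 4" where
  "Q_pop D h = (1 / window_mass D h) *\<^sub>R (\<integral>z. outer (window_regr h (fst z)) \<partial>D)"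

definition Q_pop_scaled :: "(real \<times> real) measure \<Rightarrow> real \<Rightarrow> real ^ 4 ^ 4" where
  "Q_pop_scaled D h = matrix_inv (scale_mat h) ** Q_pop D h ** matrix_inv (scale_mat h)"

definition lambda_mat :: "real \<Rightarrow> real \<Rightarrow> real ^ 4 ^ 4" where
  "lambda_mat h x = indicator {- h..h} x *\<^sub>R outer (regr (x / h))"

definition Omega_pop :: "(real \<times> real) measure \<Rightarrow> real \<Rightarrow> real ^ 4 ^ 4" where
  "Omega_pop D h =
     (1 / window_mass D h) *\<^sub>R (\<integral>z. cond_var D (fst z) *\<^sub>R lambda_mat h (fst z) \<partial>D)"

definition sigma2_tau :: "(real \<times> real) measure \<Rightarrow> real \<Rightarrow> real" where
  "sigma2_tau D h =
     (let H = scale_mat h; Qi = matrix_inv (Q_pop D h)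
      in e1 \<bullet> ((H ** Qi ** H ** Omega_pop D h ** H ** Qi ** H) *v e1))"

text \<open>A sample is \<open>d :: nat \<Rightarrow> real \<times> real\<close>, read at the indices \<open>{1..N}\<close>.\<close>

definition N_window :: "nat \<Rightarrow> real \<Rightarrow> (nat \<Rightarrow> real \<times> real) \<Rightarrow> nat" where
  "N_window N h d = card {i \<in> {1..N}. \<bar>fst (d i)\<bar> \<le> h}"

definition Q_hat :: "nat \<Rightarrow> real \<Rightarrow> (nat \<Rightarrow> real \<times> real) \<Rightarrow> real ^ 4 ^ 4" where
  "Q_hat N h d =
     (1 / real (N_window N h d)) *\<^sub>R (\<Sum>i\<in>{1..N}. outer (window_regr h (fst (d i))))"

definition theta_hat :: "nat \<Rightarrow> real \<Rightarrow> (nat \<Rightarrow> real \<times> real) \<Rightarrow> real ^ 4" where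
  "theta_hat N h d =
     matrix_inv (Q_hat N h d) *v
       ((1 / real (N_window N h d)) *\<^sub>R (\<Sum>i\<in>{1..N}. snd (d i) *\<^sub>R window_regr h (fst (d i))))"

definition tau_hat :: "nat \<Rightarrow> real \<Rightarrow> (nat \<Rightarrow> real \<times> real) \<Rightarrow> real" where
  "tau_hat N h d = e1 \<bullet> theta_hat N h d"

definition cell_count :: "nat \<Rightarrow> (nat \<Rightarrow> real \<times> real) \<Rightarrow> real \<Rightarrow> nat" where
  "cell_count N d x = card {i \<in> {1..N}. fst (d i) = x}"

definition cell_mean :: "nat \<Rightarrow> (nat \<Rightarrow> real \<times> real) \<Rightarrow> real \<Rightarrow> real" where
  "cell_mean N d x = (\<Sum>i | i \<in> {1..N} \<and> fst (d i) = x. snd (d i)) / real (cell_count N d x)"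

definition cell_var :: "nat \<Rightarrow> (nat \<Rightarrow> real \<times> real) \<Rightarrow> real \<Rightarrow> real" where
  "cell_var N d x =
     (if cell_count N d x \<le> 1 then 0
      else (\<Sum>i | i \<in> {1..N} \<and> fst (d i) = x. (snd (d i) - cell_mean N d x)\<^sup>2) /
             (real (cell_count N d x) - 1))"

definition Omega_NN ::
  "(real \<times> real) measure \<Rightarrow> nat \<Rightarrow> real \<Rightarrow> (nat \<Rightarrow> real \<times> real) \<Rightarrow> real ^ 4 ^ 4" where
  "Omega_NN D N h d =
     (1 / real (N_window N h d)) *\<^sub>R
       (\<Sum>x\<in>window_points D h. (real (cell_count N d x) * cell_var N d x) *\<^sub>R outer (regr x))"

definition sigma_NN ::
  "(real \<times> real) measure \<Rightarrow> nat \<Rightarrow> real \<Rightarrow> (nat \<Rightarrow> real \<times> real) \<Rightarrow> real" where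
  "sigma_NN D N h d =
     sqrt (e1 \<bullet> ((matrix_inv (Q_hat N h d) ** Omega_NN D N h d ** matrix_inv (Q_hat N h d)) *v e1))"

definition std_err ::
  "(real \<times> real) measure \<Rightarrow> nat \<Rightarrow> real \<Rightarrow> (nat \<Rightarrow> real \<times> real) \<Rightarrow> real" where
  "std_err D N h d = sigma_NN D N h d / sqrt (real (N_window N h d))"

definition quantile :: "real measure \<Rightarrow> real \<Rightarrow> real" where
  "quantile L p = Inf {t. p \<le> cdf L t}"

definition cv :: "real \<Rightarrow> real \<Rightarrow> real" where
  "cv p r = quantile (distr (density lborel (normal_density r 1)) borel abs) p"

definition weight :: "nat \<Rightarrow> real \<Rightarrow> (nat \<Rightarrow> real \<times> real) \<Rightarrow> real \<Rightarrow> real" where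
  "weight N h d x =
     (1 / real (N_window N h d)) * (e1 \<bullet> (matrix_inv (Q_hat N h d) *v window_regr h x))"

definition r_sup ::
  "(real \<times> real) measure \<Rightarrow> nat \<Rightarrow> real \<Rightarrow> real \<Rightarrow> (nat \<Rightarrow> real \<times> real) \<Rightarrow> real" where
  "r_sup D N h K d =
     - (K / 2) *
     ((\<Sum>i | i \<in> {1..N} \<and> \<bar>fst (d i)\<bar> \<le> h.
          weight N h d (fst (d i)) * (fst (d i))\<^sup>2 * sgn (fst (d i))) / std_err D N h d)"

definition ci_BSD ::
  "(real \<times> real) measure \<Rightarrow> nat \<Rightarrow> real \<Rightarrow> real \<Rightarrow> real \<Rightarrow> (nat \<Rightarrow> real \<times> real) \<Rightarrow> real set" where
  "ci_BSD D N h K \<alpha> d =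
     (let c = cv (1 - \<alpha>) (r_sup D N h K d) * std_err D N h d
      in {tau_hat N h d - c <..< tau_hat N h d + c})"

definition coverage ::
  "(real \<times> real) measure \<Rightarrow> nat \<Rightarrow> real \<Rightarrow> real \<Rightarrow> real \<Rightarrow> (real \<Rightarrow> real) \<Rightarrow> real" where
  "coverage D N h K \<alpha> \<mu> =
     measure (sample_law N (obs_law D \<mu>))
       {d \<in> space (sample_law N (obs_law D \<mu>)). jump \<mu> \<in> ci_BSD D N h K \<alpha> d}"

end

theory Submission
  imports Defs
begin

text \<open>
  Given the design, the estimation error is a bias plus a weighted sum of independent errors.
  Within the Hoelder class the bias is extremal at \<open>\<plusminus>(K/2) x\<^sup>2 sgn x\<close>: on each side of the cutoff the
  estimator is an OLS intercept, whose weights are affine in \<open>x\<close> and change sign once, so that applied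
  to a convex function it lies below the value of that function at the cutoff. The weighted sum is
  asymptotically normal uniformly over designs with a small Lyapunov ratio, and by a second moment
  bound the nearest-neighbor variance, a quadratic form in the errors, is close to its conditional
  mean even with only two observations per cell. Since \<open>|N(r,1)|\<close> is stochastically increasing in
  \<open>|r|\<close>, the worst-case bias determines the coverage. The design is good with probability tending to
  one by Chebyshev's inequality and continuity of matrix inversion at the limit of the scaled
  \<open>Q_pop\<close>. All quantities entering the coverage depend on \<open>\<mu>\<close> through the bias alone, which makes the
  bound uniform over the class.
\<close>

section \<open>The normal distribution\<close>

text \<open>The hypotheses give no rate for the bandwidth, so \<open>r_sup\<close> need not stay
  bounded, and it is random because it is divided by the estimated standard error. Hence neither
  \<open>r_sup\<close> nor \<open>cv\<close> has a limit to pass to. The comparison is made on the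
  level of distribution functions: lying below the critical value is a strict inequality for
  \<open>folded_cdf\<close>, and dividing both of its arguments by a factor q near 1 changes its
  value by at most 8 |q - 1|, however large the bias bound is, because x exp(-x^2/2) is bounded.
  Replacing the estimated standard error by the true one thus costs a little probability, not a
  shift of an unbounded critical value. The design and its support may also change with N, so that
  no fixed law is available for a central limit theorem and cells may stay small. The conditional
  part therefore consists of inequalities for one design, governed by a bound \<rho> on the ratio of
  the sum of fourth powers of the weights to the squared sampling variance. Limits in N enter only
  through the probability of a good design.\<close>

abbreviation Phi :: "real \<Rightarrow> real" where
  "Phi \<equiv> cdf std_normal_distribution"

interpretation std_normal: real_distribution std_normal_distribution
  by (rule real_dist_normal_dist)

lemma density_Icc_eq_integral:
  assumes "a \<le> b" and s: "0 < s"
  shows "measure (density lborel (normal_density m s)) {a..b} = integral {a..b} (normal_density m s)"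
proof -
  have c: "continuous_on {a..b} (normal_density m s)"
    unfolding normal_density_def by (intro continuous_intros) (use s in auto)
  have "emeasure (density lborel (normal_density m s)) {a..b} =
      (\<integral>\<^sup>+x. ennreal (normal_density m s x) * indicator {a..b} x \<partial>lborel)"
    by (subst emeasure_density) (auto)
  also have "\<dots> = ennreal (integral {a..b} (normal_density m s))"
    by (rule nn_integral_has_integral_lebesgue')
       (auto intro!: integrable_integral integrable_continuous_real c)
  finally show ?thesis
    by (simp add: measure_def integral_nonneg integrable_continuous_real c)
qed

text \<open>Near \<open>x\<close> the distribution function is a constant plus the integral of the
  continuous density from \<open>x - 1\<close>, so the fundamental theorem of calculus applies.
  Points have mass zero, which reconciles the half-open intervals of \<open>cdf\<close> with closed
  intervals of integration.\<close>

lemma Phi_has_derivative: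
  "(Phi has_real_derivative std_normal_density x) (at x)"
proof -
  let ?a = "x - 1" and ?b = "x + 1"
  have c: "continuous_on A std_normal_density" for A
    unfolding normal_density_def by (intro continuous_intros) auto
  have at0: "measure std_normal_distribution {u} = 0" for u
  proof -
    have "AE x in lborel. x \<in> {u} \<longrightarrow> ennreal (std_normal_density x) = 0"
      by (rule eventually_mono[OF AE_lborel_singleton[of u]]) simp
    then have "{u} \<in> null_sets std_normal_distribution"
      by (subst null_sets_density_iff) auto
    then show ?thesis by (rule measure_eq_0_null_sets)
  qed
  have eq: "Phi y = Phi ?a + integral {?a..y} std_normal_density" if "y \<in> {?a..?b}" for y
  proof -
    have "Phi y - Phi ?a = measure std_normal_distribution {?a<..y}"
    proof (cases "?a < y")
      case True then show ?thesis by (simp add: std_normal.cdf_diff_eq)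
    next
      case False then have "y = ?a" using that by auto
      then show ?thesis by simp
    qed
    also have "\<dots> = measure std_normal_distribution {?a..y}"
    proof -
      have "{?a..y} = {?a} \<union> {?a<..y}" using that by auto
      then show ?thesis
        using std_normal.finite_measure_Union[of "{?a}" "{?a<..y}"] at0[of ?a] by simp
    qed
    also have "\<dots> = integral {?a..y} std_normal_density"
      using that by (intro density_Icc_eq_integral) auto
    finally show ?thesis by simp
  qed
  have "((\<lambda>y. integral {?a..y} std_normal_density) has_real_derivative std_normal_density x)
      (at x within {?a..?b})"
    by (rule integral_has_real_derivative[OF c]) auto
  then have "((\<lambda>y. Phi ?a + integral {?a..y} std_normal_density) has_real_derivative std_normal_density x)
      (at x within {?a..?b})"
    by (auto intro!: derivative_eq_intros)
  then have "(Phi has_real_derivative std_normal_density x) (at x within {?a..?b})"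
    by (rule has_field_derivative_transform_within[where d = 1]) (simp_all only: eq[symmetric], auto)
  then show ?thesis
    by (simp add: at_within_Icc_at)
qed

lemma Phi_isCont: "isCont Phi x"
  using Phi_has_derivative DERIV_isCont by blast

text \<open>The density is even, so \<open>Phi x + Phi (- x)\<close> has derivative zero; its
  constant value is read off at infinity.\<close>

lemma Phi_minus: "Phi (- x) = 1 - Phi x"
proof -
  have d: "((\<lambda>x. Phi x + Phi (- x)) has_real_derivative 0) (at x)" for x
    by (rule DERIV_cong[OF DERIV_add[OF Phi_has_derivative DERIV_chain2[OF Phi_has_derivative DERIV_minus[OF DERIV_ident]]]])
       (simp add: normal_density_def)
  have const: "Phi x + Phi (- x) = Phi y + Phi (- y)" for x y
    using DERIV_isconst_all[of "\<lambda>x. Phi x + Phi (- x)"] d by blast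
  have "(\<lambda>n. Phi (real n) + Phi (- real n)) \<longlonglongrightarrow> 1 + 0"
    by (intro tendsto_add std_normal.cdf_lim_infty_prob std_normal.cdf_lim_neg_infty)
  moreover have "(\<lambda>n. Phi (real n) + Phi (- real n)) = (\<lambda>n. Phi x + Phi (- x))"
    using const by blast
  ultimately show ?thesis using LIMSEQ_unique[OF _ tendsto_const] by fastforce
qed

text \<open>Rests on |x| <= 1 + x^2/2 <= exp(x^2/2). This bound keeps the dilation estimate below
  uniform in its argument.\<close>

lemma abs_mult_std_normal_density_le: "\<bar>x\<bar> * std_normal_density x \<le> 1"
proof -
  have "\<bar>x\<bar> \<le> 1 + x\<^sup>2 / 2"
    using zero_le_power2[of "\<bar>x\<bar> - 1"] by (simp add: power2_eq_square algebra_simps)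
  also have "\<dots> \<le> exp (x\<^sup>2 / 2)" using exp_ge_add_one_self by blast
  finally have "\<bar>x\<bar> * exp (- x\<^sup>2 / 2) \<le> 1"
    by (simp add: exp_minus field_simps)
  moreover have "sqrt (2 * pi) \<ge> 1" using pi_gt3 by auto
  ultimately have "\<bar>x\<bar> * exp (- x\<^sup>2 / 2) \<le> sqrt (2 * pi)" by linarith
  then show ?thesis unfolding std_normal_density_def by (simp add: field_simps)
qed

text \<open>With c = 1/q, the mean value theorem gives |c - 1| |z| times the density at an
  intermediate point, and c in [1/2, 2] keeps that point at distance at least |z|/2 from 0. One
  factor 2 comes from there, the other from |1/q - 1| <= 2 |q - 1|.\<close>

lemma Phi_dilation:
  assumes q: "1 / 2 \<le> q" "q \<le> 2"
  shows "\<bar>Phi (z / q) - Phi z\<bar> \<le> 4 * \<bar>q - 1\<bar>"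
proof -
  \<comment> \<open>Stating the claim for an unordered pair covers \<open>z < c * z\<close> and
    \<open>c * z < z\<close> at once.\<close>
  have *: "\<bar>Phi b - Phi a\<bar> \<le> 2 * \<bar>c - 1\<bar>"
    if ab: "a < b" "{a, b} = {z, c * z}" and c: "1 / 2 \<le> c" "c \<le> 2" for a b c :: real
  proof -
    obtain \<xi> where x: "a < \<xi>" "\<xi> < b" "Phi b - Phi a = (b - a) * std_normal_density \<xi>"
      using MVT2[OF ab(1), of Phi std_normal_density] Phi_has_derivative by blast
    have ba: "b - a = \<bar>c - 1\<bar> * \<bar>z\<bar>"
      using ab by (auto simp: doubleton_eq_iff abs_if algebra_simps mult_less_0_iff zero_less_mult_iff not_less)
        (smt (verit, best) mult_less_cancel_right1 mult_less_cancel_right2 mult_le_cancel_right2)+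
    define y where "y = c * z"
    have ab': "a = z \<and> b = y \<or> a = y \<and> b = z"
      using ab(2) by (auto simp: doubleton_eq_iff y_def)
    have "\<bar>z\<bar> \<le> 2 * \<bar>\<xi>\<bar>"
    proof (cases "z \<ge> 0")
      case True
      then have "z \<le> 2 * y" using c mult_right_mono[of "1/2" c z] by (simp add: y_def)
      then show ?thesis using x(1,2) ab' True by linarith
    next
      case False
      then have "z \<ge> 2 * y" using c mult_right_mono_neg[of "1/2" c z] by (simp add: y_def)
      then show ?thesis using x(1,2) ab' False by linarith
    qed
    then have "\<bar>z\<bar> * std_normal_density \<xi> \<le> 2 * (\<bar>\<xi>\<bar> * std_normal_density \<xi>)"
      using mult_right_mono[OF _ normal_density_nonneg] by (simp add: mult.assoc flip: mult.assoc)
    also have "\<dots> \<le> 2" using abs_mult_std_normal_density_le[of \<xi>] by simp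
    finally have "\<bar>c - 1\<bar> * (\<bar>z\<bar> * std_normal_density \<xi>) \<le> \<bar>c - 1\<bar> * 2"
      by (rule mult_left_mono) simp
    then show ?thesis using x(3) ab(1) unfolding ba by (simp add: mult_ac)
  qed
  define c where "c = 1 / q"
  have c: "1 / 2 \<le> c" "c \<le> 2" using q by (auto simp: c_def field_simps)
  have cz: "z / q = c * z" by (simp add: c_def)
  have "\<bar>Phi (c * z) - Phi z\<bar> \<le> 2 * \<bar>c - 1\<bar>"
    using *[of z "c * z" c] *[of "c * z" z c] c
    by (cases "c * z" z rule: linorder_cases) (auto simp: insert_commute abs_minus_commute)
  also have "\<bar>c - 1\<bar> = \<bar>q - 1\<bar> / q"
    using q by (simp add: c_def abs_if field_simps)
  also have "2 * (\<bar>q - 1\<bar> / q) \<le> 4 * \<bar>q - 1\<bar>"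
    using q mult_right_mono[of 1 "2*q" "\<bar>q-1\<bar>"] by (simp add: field_simps)
  finally show ?thesis by (simp add: cz)
qed

section \<open>The folded normal law and its quantiles\<close>

definition folded_cdf :: "real \<Rightarrow> real \<Rightarrow> real" where
  "folded_cdf r t = Phi (t - r) - Phi (- t - r)"

lemma real_distribution_folded_normal:
  "real_distribution (distr (density lborel (normal_density r 1)) borel abs)"
proof -
  interpret prob_space "density lborel (normal_density r 1)"
    by (rule prob_space_normal_density) simp
  show ?thesis by (rule real_distribution_distr) simp
qed

text \<open>The event |Z| <= t is the interval [-t, t], over which the density integrates to a
  difference of two values of \<open>Phi\<close>. For negative \<open>t\<close> that difference
  would be negative, hence the restriction.\<close>

lemma cdf_folded_normal:
  assumes "0 \<le> t"
  shows "cdf (distr (density lborel (normal_density r 1)) borel abs) t = folded_cdf r t"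
proof -
  have "cdf (distr (density lborel (normal_density r 1)) borel abs) t =
      measure (density lborel (normal_density r 1)) {- t..t}"
    unfolding cdf_def by (subst measure_distr) (auto intro!: arg_cong2[where f = measure])
  also have "\<dots> = integral {- t..t} (normal_density r 1)"
    using assms by (intro density_Icc_eq_integral) auto
  also have "(normal_density r 1 has_integral Phi (t - r) - Phi (- t - r)) {- t..t}"
  proof (rule fundamental_theorem_of_calculus)
    fix x
    have "((\<lambda>x. Phi (x - r)) has_real_derivative std_normal_density (x - r) * 1) (at x)"
      by (rule DERIV_chain2[OF Phi_has_derivative]) (auto intro!: derivative_eq_intros)
    then have "((\<lambda>x. Phi (x - r)) has_real_derivative normal_density r 1 x) (at x within {- t..t})"
      using has_field_derivative_at_within by (simp add: normal_density_def) blast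
    then show "((\<lambda>x. Phi (x - r)) has_vector_derivative normal_density r 1 x) (at x within {- t..t})"
      by (simp add: has_real_derivative_iff_has_vector_derivative)
  qed (use assms in auto)
  then have "integral {- t..t} (normal_density r 1) = Phi (t - r) - Phi (- t - r)"
    by (rule integral_unique)
  finally show ?thesis by (simp add: folded_cdf_def)
qed

text \<open>A quantile defined as an infimum and a right-continuous distribution function form a
  Galois pair. Later arguments reach \<open>cv\<close> through this equivalence and its sign, so its
  dependence on \<open>r\<close> is studied on \<open>folded_cdf\<close>.\<close>

lemma less_cv_iff:
  assumes p: "0 < p" "p < 1" and t: "0 \<le> t"
  shows "t < cv p r \<longleftrightarrow> folded_cdf r t < p"
proof -
  interpret F: cdf_distribution "distr (density lborel (normal_density r 1)) borel abs"
    using real_distribution_folded_normal by (simp add: cdf_distribution_def)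
  show ?thesis
    using F.pseudoinverse[OF p, of t] cdf_folded_normal[OF t, of r]
    unfolding cv_def quantile_def by auto
qed

lemma cv_nonneg:
  assumes p: "0 < p" "p < 1"
  shows "0 \<le> cv p r"
proof -
  interpret F: cdf_distribution "distr (density lborel (normal_density r 1)) borel abs"
    using real_distribution_folded_normal by (simp add: cdf_distribution_def)
  have "cdf (distr (density lborel (normal_density r 1)) borel abs) t = 0" if "t < 0" for t
  proof -
    have "abs -` {..t} = {}" using that by auto
    then show ?thesis unfolding cdf_def by (subst measure_distr) auto
  qed
  then have "\<not> cv p r \<le> t" if "t < 0" for t
    using F.pseudoinverse[OF p, of t] that p(1) unfolding cv_def quantile_def by auto
  from this[of "cv p r"] show ?thesis by fastforce
qed

lemma folded_cdf_cv:
  assumes "0 < p" "p < 1"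
  shows "p \<le> folded_cdf r (cv p r)"
  using less_cv_iff[OF assms cv_nonneg[OF assms, of r], of r] by linarith

lemma folded_cdf_minus: "folded_cdf (- r) t = folded_cdf r t"
proof -
  have *: "t - - r = t + r" "- t - - r = - (t - r)" "- t - r = - (t + r)" by simp_all
  show ?thesis unfolding folded_cdf_def * Phi_minus by simp
qed

text \<open>The derivative in the mean r is the density at t + r minus the density at t - r, which
  is nonpositive for r >= 0 because |t - r| <= t + r. Evenness in the mean reduces \<open>b\<close>
  to its absolute value.\<close>

lemma folded_cdf_antimono:
  assumes "\<bar>b\<bar> \<le> R" "0 \<le> t"
  shows "folded_cdf R t \<le> folded_cdf b t"
proof -
  have d: "((\<lambda>r. folded_cdf r t) has_real_derivative
      - std_normal_density (t - r) + std_normal_density (- t - r)) (at r)" for r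
    unfolding folded_cdf_def
    by (rule DERIV_cong[OF DERIV_diff[OF DERIV_chain2[OF Phi_has_derivative] DERIV_chain2[OF Phi_has_derivative]]])
       (auto intro!: derivative_eq_intros)
  have le: "- std_normal_density (t - r) + std_normal_density (- t - r) \<le> 0" if "0 \<le> r" for r
  proof -
    have "(t - r)\<^sup>2 \<le> (- t - r)\<^sup>2"
      using that assms(2) by (simp add: power2_eq_square algebra_simps)
    then show ?thesis
      by (simp add: std_normal_density_def divide_right_mono)
  qed
  have "folded_cdf R t \<le> folded_cdf \<bar>b\<bar> t"
    by (rule DERIV_nonpos_imp_nonincreasing[OF assms(1)]) (use d le in force)
  then show ?thesis by (cases "b \<ge> 0") (auto simp: folded_cdf_minus)
qed

text \<open>\<open>R\<close> and \<open>y\<close> are divided by the same factor, so both arguments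
  of \<open>Phi\<close> are dilated and each contributes 4 |q - 1|, independently of
  \<open>R\<close>.\<close>

lemma folded_cdf_dilation:
  assumes "1 / 2 \<le> q" "q \<le> 2"
  shows "folded_cdf (R / q) (y / q) \<le> folded_cdf R y + 8 * \<bar>q - 1\<bar>"
  using Phi_dilation[OF assms, of "y - R"] Phi_dilation[OF assms, of "- y - R"]
  unfolding folded_cdf_def by (simp add: diff_divide_distrib)

section \<open>Uniform normal approximation\<close>

lemma abs_exp_minus_bound:
  fixes y :: real
  assumes "0 \<le> y"
  shows "\<bar>exp (- y) - (1 - y)\<bar> \<le> y\<^sup>2"
proof -
  have 1: "1 - y \<le> exp (- y)" using exp_ge_add_one_self[of "- y"] by simp
  have "exp (- y) * (1 + y) \<le> exp (- y) * exp y"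
    by (intro mult_left_mono) (auto simp: exp_ge_add_one_self)
  then have "exp (- y) * (1 + y) \<le> 1" by (simp flip: exp_add)
  moreover have "1 \<le> (1 - y + y\<^sup>2) * (1 + y)"
    using assms by (simp add: power2_eq_square algebra_simps)
  ultimately have "exp (- y) * (1 + y) \<le> (1 - y + y\<^sup>2) * (1 + y)" by linarith
  then have "exp (- y) \<le> 1 - y + y\<^sup>2" using assms by simp
  with 1 show ?thesis by simp
qed

lemma integrable_power_le:
  fixes f :: "'a \<Rightarrow> real"
  assumes "finite_measure M" and f [measurable]: "f \<in> borel_measurable M"
    and n: "integrable M (\<lambda>x. f x ^ n)" "even n" "k \<le> n"
  shows "integrable M (\<lambda>x. f x ^ k)"
proof -
  interpret finite_measure M by fact
  show ?thesis
  proof (rule Bochner_Integration.integrable_bound)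
    show "integrable M (\<lambda>x. 1 + f x ^ n)" using n by simp
    show "AE x in M. norm (f x ^ k) \<le> norm (1 + f x ^ n)"
    proof (rule AE_I2)
      fix x
      have "\<bar>f x\<bar> ^ k \<le> 1 + \<bar>f x\<bar> ^ n"
      proof (cases "\<bar>f x\<bar> \<le> 1")
        case True
        then have "\<bar>f x\<bar> ^ k \<le> 1" by (simp add: power_le_one)
        then show ?thesis by (smt (verit) zero_le_power abs_ge_zero)
      next
        case False
        then have "\<bar>f x\<bar> ^ k \<le> \<bar>f x\<bar> ^ n" using n by (intro power_increasing) auto
        then show ?thesis by simp
      qed
      then show "norm (f x ^ k) \<le> norm (1 + f x ^ n)"
        using n(2) by (simp add: power_abs power_even_abs)
    qed
  qed simp
qed

lemma (in prob_space) expectation_square_le_fourth: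
  assumes [measurable]: "random_variable borel X" and "integrable M (\<lambda>x. X x ^ 4 :: real)"
  shows "(expectation (\<lambda>x. X x ^ 2))\<^sup>2 \<le> expectation (\<lambda>x. X x ^ 4)"
proof -
  have i2: "integrable M (\<lambda>x. (X x)\<^sup>2)"
    by (rule integrable_power_le[OF finite_measure_axioms]) (use assms in auto)
  have i4: "integrable M (\<lambda>x. ((X x)\<^sup>2)\<^sup>2)" using assms(2) by simp
  have "variance (\<lambda>x. (X x)\<^sup>2) = expectation (\<lambda>x. ((X x)\<^sup>2)\<^sup>2) - (expectation (\<lambda>x. (X x)\<^sup>2))\<^sup>2"
    by (rule variance_eq[OF i2 i4])
  moreover have "variance (\<lambda>x. (X x)\<^sup>2) \<ge> 0" by simp
  ultimately show ?thesis by simp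
qed

text \<open>Each summand is compared with a centred normal variable of the same variance. The
  variances add up to 1, so the product of these normal characteristic functions is the standard
  normal one, and two products of factors from the unit disc differ by at most the sum of the
  differences.\<close>

lemma (in prob_space) char_sum_near_normal:
  fixes X :: "'i \<Rightarrow> 'a \<Rightarrow> real"
  assumes ind: "indep_vars (\<lambda>_. borel) X I" and fin: "finite I"
    and int4: "\<And>i. i \<in> I \<Longrightarrow> integrable M (\<lambda>x. X i x ^ 4)"
    and mean: "\<And>i. i \<in> I \<Longrightarrow> expectation (X i) = 0"
    and var: "(\<Sum>i\<in>I. expectation (\<lambda>x. X i x ^ 2)) = 1"
    and L: "(\<Sum>i\<in>I. expectation (\<lambda>x. X i x ^ 4)) \<le> L" "0 < L"
  shows "cmod (char (distr M borel (\<lambda>x. \<Sum>i\<in>I. X i x)) t - exp (- (t\<^sup>2) / 2)) \<le>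
    \<bar>t\<bar> ^ 3 * sqrt L + t ^ 4 * L"
proof -
  have rv [measurable]: "random_variable borel (X i)" if "i \<in> I" for i
    using ind that unfolding indep_vars_def2 by simp
  define s where "s i = expectation (\<lambda>x. X i x ^ 2)" for i
  define k where "k i = expectation (\<lambda>x. X i x ^ 4)" for i
  have s0: "0 \<le> s i" for i unfolding s_def by simp
  have int: "integrable M (\<lambda>x. X i x ^ m)" if "i \<in> I" "m \<le> 4" for i m
    using that by (intro integrable_power_le[OF finite_measure_axioms rv int4]) auto
  have each: "cmod (char (distr M borel (X i)) t - exp (- (t\<^sup>2 * s i) / 2)) \<le>
      \<bar>t\<bar> ^ 3 / 12 * (sqrt L * s i + k i / sqrt L) + t ^ 4 / 4 * k i" if i: "i \<in> I" for i
  proof -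
    have [measurable]: "random_variable borel (X i)" using i by simp
    have i1: "integrable M (X i)" and i2: "integrable M (\<lambda>x. (X i x)\<^sup>2)"
      using int[OF i, of 1] int[OF i, of 2] by simp_all
    have v: "variance (X i) = s i" using mean[OF i] by (simp add: s_def)
    have "cmod (char (distr M borel (X i)) t - (1 - t\<^sup>2 * s i / 2)) \<le>
        t\<^sup>2 / 6 * expectation (\<lambda>x. min (6 * (X i x)\<^sup>2) (\<bar>t\<bar> * \<bar>X i x\<bar> ^ 3))"
      by (rule char_approx3'[OF _ i1 i2 mean[OF i] v refl]) simp
    also have "\<dots> \<le> t\<^sup>2 / 6 * (\<bar>t\<bar> * ((sqrt L * s i + k i / sqrt L) / 2))"
    proof (intro mult_left_mono)
      have "expectation (\<lambda>x. min (6 * (X i x)\<^sup>2) (\<bar>t\<bar> * \<bar>X i x\<bar> ^ 3)) \<le>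
          expectation (\<lambda>x. \<bar>t\<bar> * ((sqrt L * (X i x)\<^sup>2 + X i x ^ 4 / sqrt L) / 2))"
      proof (rule integral_mono)
        show "integrable M (\<lambda>x. min (6 * (X i x)\<^sup>2) (\<bar>t\<bar> * \<bar>X i x\<bar> ^ 3))"
          by (rule Bochner_Integration.integrable_bound[where f = "\<lambda>x. 6 * (X i x)\<^sup>2"]) (use i2 in auto)
        show "integrable M (\<lambda>x. \<bar>t\<bar> * ((sqrt L * (X i x)\<^sup>2 + X i x ^ 4 / sqrt L) / 2))"
          using i2 int4[OF i] by simp
        fix x
        define u where "u = \<bar>X i x\<bar>"
        \<comment> \<open>Third absolute moments are traded for second and fourth ones by u^2 (sqrt
          L - u)^2 >= 0. The weight sqrt L balances the two parts once they are summed: both total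
          at most sqrt L.\<close>
        have "0 \<le> u\<^sup>2 * (L - 2 * (u * sqrt L) + u\<^sup>2)"
        proof -
          have "L - 2 * (u * sqrt L) + u\<^sup>2 = (sqrt L - u)\<^sup>2" using L(2) by (simp add: power2_diff)
          then show ?thesis by simp
        qed
        then have "2 * u ^ 3 * sqrt L \<le> u\<^sup>2 * L + u ^ 4"
          by (simp add: algebra_simps power2_eq_square power3_eq_cube power4_eq_xxxx)
        then have "2 * u ^ 3 \<le> (u\<^sup>2 * L + u ^ 4) / sqrt L" using L(2) by (simp add: field_simps)
        also have "\<dots> = sqrt L * u\<^sup>2 + u ^ 4 / sqrt L"
          using L(2) by (simp add: field_simps)
        finally have "u ^ 3 \<le> (sqrt L * u\<^sup>2 + u ^ 4 / sqrt L) / 2" by simp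
        then have "\<bar>X i x\<bar> ^ 3 \<le> (sqrt L * (X i x)\<^sup>2 + X i x ^ 4 / sqrt L) / 2"
          by (simp add: u_def power_even_abs)
        then have "\<bar>t\<bar> * \<bar>X i x\<bar> ^ 3 \<le> \<bar>t\<bar> * ((sqrt L * (X i x)\<^sup>2 + X i x ^ 4 / sqrt L) / 2)"
          by (rule mult_left_mono) simp
        then show "min (6 * (X i x)\<^sup>2) (\<bar>t\<bar> * \<bar>X i x\<bar> ^ 3) \<le>
            \<bar>t\<bar> * ((sqrt L * (X i x)\<^sup>2 + X i x ^ 4 / sqrt L) / 2)" by linarith
      qed
      also have "\<dots> = \<bar>t\<bar> * ((sqrt L * s i + k i / sqrt L) / 2)"
        using i2 int4[OF i] by (simp add: s_def k_def)
      finally show "expectation (\<lambda>x. min (6 * (X i x)\<^sup>2) (\<bar>t\<bar> * \<bar>X i x\<bar> ^ 3)) \<le>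
        \<bar>t\<bar> * ((sqrt L * s i + k i / sqrt L) / 2)" .
    qed simp
    also have "\<dots> = \<bar>t\<bar> ^ 3 / 12 * (sqrt L * s i + k i / sqrt L)"
      by (simp add: power3_eq_cube power2_eq_square flip: abs_mult)
    finally have 1: "cmod (char (distr M borel (X i)) t - (1 - t\<^sup>2 * s i / 2)) \<le>
      \<bar>t\<bar> ^ 3 / 12 * (sqrt L * s i + k i / sqrt L)" .
    \<comment> \<open>Passing from the quadratic Taylor polynomial to the exponential costs the
      square of the second-order term, and the squared variance is at most the fourth
      moment.\<close>
    have "cmod (complex_of_real (1 - t\<^sup>2 * s i / 2) - complex_of_real (exp (- (t\<^sup>2 * s i) / 2))) =
        \<bar>exp (- (t\<^sup>2 * s i / 2)) - (1 - t\<^sup>2 * s i / 2)\<bar>"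
      by (subst of_real_diff[symmetric], subst norm_of_real) (simp add: abs_minus_commute)
    also have "\<dots> \<le> (t\<^sup>2 * s i / 2)\<^sup>2"
      by (rule abs_exp_minus_bound) (simp add: s0)
    also have "\<dots> = t ^ 4 / 4 * (s i)\<^sup>2" by (simp add: power2_eq_square power4_eq_xxxx)
    also have "\<dots> \<le> t ^ 4 / 4 * k i"
      unfolding s_def k_def using int4[OF i] by (intro mult_left_mono expectation_square_le_fourth) auto
    finally have 2: "cmod (complex_of_real (1 - t\<^sup>2 * s i / 2) - complex_of_real (exp (- (t\<^sup>2 * s i) / 2)))
      \<le> t ^ 4 / 4 * k i" .
    have "char (distr M borel (X i)) t - exp (- (t\<^sup>2 * s i) / 2) =
      (char (distr M borel (X i)) t - (1 - t\<^sup>2 * s i / 2)) +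
      (complex_of_real (1 - t\<^sup>2 * s i / 2) - complex_of_real (exp (- (t\<^sup>2 * s i) / 2)))" by simp
    then show ?thesis using 1 2 norm_triangle_mono by metis
  qed
  have "exp (- (t\<^sup>2) / 2) = (\<Prod>i\<in>I. exp (- (t\<^sup>2 * s i) / 2))"
  proof -
    have "(\<Sum>i\<in>I. - (t\<^sup>2 * s i) / 2) = - (t\<^sup>2 * (\<Sum>i\<in>I. s i)) / 2"
      by (simp add: sum_distrib_left sum_divide_distrib sum_negf)
    then show ?thesis using var by (simp add: s_def flip: exp_sum[OF fin])
  qed
  then have "cmod (char (distr M borel (\<lambda>x. \<Sum>i\<in>I. X i x)) t - exp (- (t\<^sup>2) / 2)) =
      cmod ((\<Prod>i\<in>I. char (distr M borel (X i)) t) - (\<Prod>i\<in>I. complex_of_real (exp (- (t\<^sup>2 * s i) / 2))))"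
    by (simp add: char_distr_sum[OF ind])
  also have "\<dots> \<le> (\<Sum>i\<in>I. cmod (char (distr M borel (X i)) t - exp (- (t\<^sup>2 * s i) / 2)))"
  proof (rule norm_prod_diff)
    fix i assume i: "i \<in> I"
    interpret d: real_distribution "distr M borel (X i)"
      by (rule real_distribution_distr) (use i in simp)
    show "cmod (char (distr M borel (X i)) t) \<le> 1" by (rule d.cmod_char_le_1)
    show "cmod (complex_of_real (exp (- (t\<^sup>2 * s i) / 2))) \<le> 1" using s0 by simp
  qed
  also have "\<dots> \<le> (\<Sum>i\<in>I. \<bar>t\<bar> ^ 3 / 12 * (sqrt L * s i + k i / sqrt L) + t ^ 4 / 4 * k i)"
    by (intro sum_mono each)
  also have "\<dots> = \<bar>t\<bar> ^ 3 / 12 * (sqrt L * (\<Sum>i\<in>I. s i) + (\<Sum>i\<in>I. k i) / sqrt L) + t ^ 4 / 4 * (\<Sum>i\<in>I. k i)"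
    by (simp only: sum.distrib flip: sum_distrib_left sum_divide_distrib)
  also have "\<dots> \<le> \<bar>t\<bar> ^ 3 / 12 * (sqrt L * 1 + L / sqrt L) + t ^ 4 / 4 * L"
    using var L by (intro add_mono mult_left_mono divide_right_mono) (auto simp: s_def k_def)
  also have "\<dots> \<le> \<bar>t\<bar> ^ 3 * sqrt L + t ^ 4 * L"
  proof -
    have "\<bar>t\<bar> ^ 3 / 12 * (sqrt L * 1 + L / sqrt L) = \<bar>t\<bar> ^ 3 * sqrt L / 6"
      using L(2) by (simp add: real_div_sqrt)
    moreover have "0 \<le> \<bar>t\<bar> ^ 3 * sqrt L" "0 \<le> t ^ 4 * L" using L(2) by auto
    ultimately show ?thesis by linarith
  qed
  finally show ?thesis .
qed

lemma Phi_attains: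
  assumes "0 < p" "p < 1"
  shows "\<exists>x. Phi x = p"
proof -
  have "eventually (\<lambda>n. Phi (- real n) < p) sequentially"
    using std_normal.cdf_lim_neg_infty assms(1) by (rule order_tendstoD)
  moreover have "eventually (\<lambda>n. p < Phi (real n)) sequentially"
    using std_normal.cdf_lim_infty_prob assms(2) by (rule order_tendstoD)
  ultimately obtain n where "Phi (- real n) < p" "p < Phi (real n)"
    using eventually_conj eventually_sequentially by (metis (mono_tags, lifting) le_refl)
  then show ?thesis
    using IVT'[of Phi "- real n" p "real n"] Phi_isCont
    by (auto intro!: continuous_at_imp_continuous_on)
qed

text \<open>Polya's theorem: the limit is continuous, so finitely many quantiles control the supremum.\<close>

lemma weak_conv_std_normal_uniform:
  assumes \<nu>: "\<And>n. real_distribution (\<nu> n)" and w: "weak_conv_m \<nu> std_normal_distribution" and e: "0 < e"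
  shows "eventually (\<lambda>n. \<forall>x. \<bar>cdf (\<nu> n) x - Phi x\<bar> \<le> e) sequentially"
proof -
  obtain m :: nat where m: "0 < m" "4 / e < real m" 
    using reals_Archimedean2[of "4 / e"] e by (metis divide_pos_pos less_trans of_nat_0_less_iff zero_less_numeral)
  have "\<exists>y. \<forall>j\<in>{1..<m}. Phi (y j) = real j / real m"
    using Phi_attains by (intro bchoice) auto
  then obtain y where y: "\<And>j. j \<in> {1..<m} \<Longrightarrow> Phi (y j) = real j / real m" by blast
  have "eventually (\<lambda>n. \<forall>j\<in>{1..<m}. dist (cdf (\<nu> n) (y j)) (Phi (y j)) < e / 2) sequentially"
  proof (intro eventually_ball_finite ballI)
    fix j
    have "(\<lambda>n. cdf (\<nu> n) (y j)) \<longlonglongrightarrow> Phi (y j)"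
      using w Phi_isCont unfolding weak_conv_m_def weak_conv_def by blast
    then show "eventually (\<lambda>n. dist (cdf (\<nu> n) (y j)) (Phi (y j)) < e / 2) sequentially"
      by (rule tendstoD) (use e in simp)
  qed simp
  then show ?thesis
  proof (eventually_elim, intro allI)
    fix n x
    assume close: "\<forall>j\<in>{1..<m}. dist (cdf (\<nu> n) (y j)) (Phi (y j)) < e / 2"
    interpret \<nu>: real_distribution "\<nu> n" by fact
    have em: "2 / real m < e / 2" using m e by (simp add: field_simps)
    then have em1: "1 / real m < e / 2" using m(1) by (simp add: field_simps)
    \<comment> \<open>\<open>Phi x\<close> lies between j/m and (j + 1)/m. The lower neighbour is
      \<open>j - 1\<close> and not \<open>j\<close> because monotonicity orders the points only
      after a strict inequality of the values; this loses 2/m, whence \<open>m\<close> above 4/e.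
      Near the two ends of the grid the bounds are trivial.\<close>
    define j where "j = nat \<lfloor>real m * Phi x\<rfloor>"
    have P0: "0 \<le> Phi x" "Phi x \<le> 1" by (simp_all add: std_normal.cdf_nonneg std_normal.cdf_bounded_prob)
    have j: "real j \<le> real m * Phi x" "real m * Phi x < real j + 1"
      using P0 by (auto simp: j_def)
    have jd: "real j / real m \<le> Phi x" "Phi x < (real j + 1) / real m"
      using j m(1) by (simp_all add: field_simps)
    have "cdf (\<nu> n) x \<le> Phi x + e"
    proof (cases "j + 1 < m")
      case True
      then have jm: "j + 1 \<in> {1..<m}" by simp
      have "Phi x < Phi (y (j + 1))" using jd(2) y[OF jm] by (simp add: add.commute)
      then have "x \<le> y (j + 1)" using std_normal.cdf_nondecreasing[of "y (j+1)" x] by linarith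
      then have "cdf (\<nu> n) x \<le> cdf (\<nu> n) (y (j + 1))" by (rule \<nu>.cdf_nondecreasing)
      also have "\<dots> \<le> (real j + 1) / real m + e / 2"
      proof -
        have "\<bar>cdf (\<nu> n) (y (j + 1)) - Phi (y (j + 1))\<bar> < e / 2"
          using bspec[OF close jm] unfolding dist_real_def .
        moreover have "Phi (y (j + 1)) = (real j + 1) / real m" using y[OF jm] by (simp add: add.commute)
        ultimately show ?thesis by linarith
      qed
      also have "\<dots> \<le> Phi x + 1 / real m + e / 2" using jd(1) by (simp add: add_divide_distrib)
      finally show ?thesis using em1 by linarith
    next
      case False
      then have "1 \<le> (real j + 1) / real m" using m(1) by (simp add: field_simps)
      then have "1 \<le> Phi x + 1 / real m" using jd(1) by (simp add: add_divide_distrib)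
      then show ?thesis using em1 e \<nu>.cdf_bounded_prob[of x] by linarith
    qed
    moreover have "Phi x - e \<le> cdf (\<nu> n) x"
    proof (cases "2 \<le> j")
      case True
      have "real j \<le> real m" using j(1) P0(2) mult_left_mono[of "Phi x" 1 "real m"] by simp
      then have jm: "j - 1 \<in> {1..<m}" using True by auto
      have "Phi (y (j - 1)) = (real j - 1) / real m" using y[OF jm] True by (simp add: of_nat_diff)
      also have "\<dots> < real j / real m" using m(1) by (intro divide_strict_right_mono) auto
      finally have "Phi (y (j - 1)) < Phi x" using jd(1) by linarith
      then have "y (j - 1) \<le> x" using std_normal.cdf_nondecreasing[of x "y (j-1)"] by linarith
      then have "cdf (\<nu> n) (y (j - 1)) \<le> cdf (\<nu> n) x" by (rule \<nu>.cdf_nondecreasing)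
      moreover have "(real j - 1) / real m - e / 2 \<le> cdf (\<nu> n) (y (j - 1))"
      proof -
        have "\<bar>cdf (\<nu> n) (y (j - 1)) - Phi (y (j - 1))\<bar> < e / 2"
          using bspec[OF close jm] unfolding dist_real_def .
        moreover have "Phi (y (j - 1)) = (real j - 1) / real m" using y[OF jm] True by (simp add: of_nat_diff)
        ultimately show ?thesis by linarith
      qed
      moreover have "(real j - 1) / real m = (real j + 1) / real m - 2 / real m"
        by (simp add: diff_divide_distrib add_divide_distrib)
      ultimately show ?thesis using em jd(2) by linarith
    next
      case False
      then have "(real j + 1) / real m \<le> 2 / real m" using m(1) by (intro divide_right_mono) auto
      then show ?thesis using jd(2) em e \<nu>.cdf_nonneg[of x] by linarith
    qed
    ultimately show "\<bar>cdf (\<nu> n) x - Phi x\<bar> \<le> e" by linarith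
  qed
qed

text \<open>If no L worked, the laws violating the claim for L = 1/(k + 1) would have characteristic
  functions converging pointwise to the normal one, against Levy's theorem and the uniform
  convergence just shown. The contradiction yields one L for all laws, without an explicit
  rate.\<close>

lemma cdf_near_Phi_of_char_near:
  assumes e: "0 < e"
  shows "\<exists>L>0. \<forall>\<nu>. real_distribution \<nu> \<longrightarrow>
    (\<forall>t. cmod (char \<nu> t - exp (- (t\<^sup>2) / 2)) \<le> \<bar>t\<bar> ^ 3 * sqrt L + t ^ 4 * L) \<longrightarrow>
    (\<forall>x. \<bar>cdf \<nu> x - Phi x\<bar> \<le> e)"
proof (rule ccontr)
  assume c: "\<not> ?thesis"
  define L where "L k = 1 / real (Suc k)" for k
  have "\<forall>k. \<exists>\<nu>. real_distribution \<nu> \<and>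
      (\<forall>t. cmod (char \<nu> t - exp (- (t\<^sup>2) / 2)) \<le> \<bar>t\<bar> ^ 3 * sqrt (L k) + t ^ 4 * L k) \<and>
      \<not> (\<forall>x. \<bar>cdf \<nu> x - Phi x\<bar> \<le> e)"
  proof
    fix k
    have "0 < L k" by (simp add: L_def)
    with c show "\<exists>\<nu>. real_distribution \<nu> \<and>
      (\<forall>t. cmod (char \<nu> t - exp (- (t\<^sup>2) / 2)) \<le> \<bar>t\<bar> ^ 3 * sqrt (L k) + t ^ 4 * L k) \<and>
      \<not> (\<forall>x. \<bar>cdf \<nu> x - Phi x\<bar> \<le> e)" by blast
  qed
  then obtain \<nu> where \<nu>: "\<And>k. real_distribution (\<nu> k)"
    and ch: "\<And>k t. cmod (char (\<nu> k) t - exp (- (t\<^sup>2) / 2)) \<le> \<bar>t\<bar> ^ 3 * sqrt (L k) + t ^ 4 * L k"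
    and far: "\<And>k. \<not> (\<forall>x. \<bar>cdf (\<nu> k) x - Phi x\<bar> \<le> e)"
    by metis
  have L0: "L \<longlonglongrightarrow> 0" unfolding L_def by (rule LIMSEQ_Suc[OF lim_1_over_n])
  have "weak_conv_m \<nu> std_normal_distribution"
  proof (rule levy_continuity[OF \<nu> real_dist_normal_dist])
    fix t
    have "(\<lambda>k. \<bar>t\<bar> ^ 3 * sqrt (L k) + t ^ 4 * L k) \<longlonglongrightarrow> \<bar>t\<bar> ^ 3 * sqrt 0 + t ^ 4 * 0"
      by (intro tendsto_intros L0)
    then have "(\<lambda>k. char (\<nu> k) t - exp (- (t\<^sup>2) / 2)) \<longlonglongrightarrow> 0"
      by (intro Lim_null_comparison[OF always_eventually[OF allI[OF ch]]]) simp
    then show "(\<lambda>k. char (\<nu> k) t) \<longlonglongrightarrow> char std_normal_distribution t"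
      unfolding char_std_normal_distribution by (rule LIM_zero_cancel)
  qed
  from weak_conv_std_normal_uniform[OF \<nu> this e] far show False
    by (simp add: eventually_sequentially)
qed

section \<open>Quadratic forms in independent errors\<close>

text \<open>By independence the expectation factorizes over distinct indices, and an index that
  occurs exactly once contributes a mean of zero. As i differs from j and k from l, only the two
  pairings of (k, l) with (i, j) leave no such index.\<close>

lemma (in prob_space) indep_centred_fourth_product:
  fixes X :: "'i \<Rightarrow> 'a \<Rightarrow> real"
  assumes ind: "indep_vars (\<lambda>_. borel) X I" and fin: "finite I"
    and int4: "\<And>i. i \<in> I \<Longrightarrow> integrable M (\<lambda>x. X i x ^ 4)"
    and mean: "\<And>i. i \<in> I \<Longrightarrow> expectation (X i) = 0"
    and I: "i \<in> I" "j \<in> I" "k \<in> I" "l \<in> I" and neq: "i \<noteq> j" "k \<noteq> l"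
  shows "integrable M (\<lambda>x. X i x * X j x * (X k x * X l x))"
    and "expectation (\<lambda>x. X i x * X j x * (X k x * X l x)) =
      (if k = i \<and> l = j \<or> k = j \<and> l = i
       then expectation (\<lambda>x. X i x ^ 2) * expectation (\<lambda>x. X j x ^ 2) else 0)"
proof -
  \<comment> \<open>\<open>cnt m\<close> is the multiplicity of \<open>m\<close> among the four
    indices. It turns the product into one over all of \<open>I\<close>, whose factors are powers of
    degree at most 4 of independent variables, whatever the coincidences between the
    indices.\<close>
  define cnt :: "'i \<Rightarrow> nat" where
    "cnt m = (if m = i then 1 else 0) + (if m = j then 1 else 0) +
       ((if m = k then 1 else 0) + (if m = l then 1 else 0))" for m
  define f where "f m x = X m x ^ cnt m" for m x
  have cnt4: "cnt m \<le> 4" for m unfolding cnt_def by auto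
  have rv [measurable]: "random_variable borel (X m)" if "m \<in> I" for m
    using ind that unfolding indep_vars_def2 by simp
  have prod_f: "(\<Prod>m\<in>I. f m x) = X i x * X j x * (X k x * X l x)" for x
  proof -
    have delta: "(\<Prod>m\<in>I. X m x ^ (if m = a then 1 else 0)) = X a x" if "a \<in> I" for a
    proof -
      have "(\<Prod>m\<in>I. X m x ^ (if m = a then 1 else 0)) = (\<Prod>m\<in>I. if m = a then X m x else 1)"
        by (intro prod.cong) auto
      then show ?thesis using that fin by simp
    qed
    have "(\<Prod>m\<in>I. f m x) =
        (\<Prod>m\<in>I. X m x ^ (if m = i then 1 else 0)) * (\<Prod>m\<in>I. X m x ^ (if m = j then 1 else 0)) *
        ((\<Prod>m\<in>I. X m x ^ (if m = k then 1 else 0)) * (\<Prod>m\<in>I. X m x ^ (if m = l then 1 else 0)))"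
      unfolding f_def cnt_def power_add prod.distrib ..
    then show ?thesis unfolding delta[OF I(1)] delta[OF I(2)] delta[OF I(3)] delta[OF I(4)] .
  qed
  have ind_f: "indep_vars (\<lambda>_. borel) f I"
    unfolding f_def by (rule indep_vars_compose2[OF ind]) auto
  have int_f: "integrable M (f m)" if "m \<in> I" for m
    unfolding f_def using that cnt4
    by (intro integrable_power_le[OF finite_measure_axioms rv int4]) auto
  show "integrable M (\<lambda>x. X i x * X j x * (X k x * X l x))"
    using indep_vars_integrable[OF fin ind_f int_f] by (simp add: prod_f)
  have E: "expectation (\<lambda>x. X i x * X j x * (X k x * X l x)) = (\<Prod>m\<in>I. expectation (f m))"
    using indep_vars_lebesgue_integral[OF fin ind_f int_f] by (simp add: prod_f)
  show "expectation (\<lambda>x. X i x * X j x * (X k x * X l x)) =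
      (if k = i \<and> l = j \<or> k = j \<and> l = i
       then expectation (\<lambda>x. X i x ^ 2) * expectation (\<lambda>x. X j x ^ 2) else 0)"
  proof (cases "k = i \<and> l = j \<or> k = j \<and> l = i")
    case True
    have "expectation (f m) = (if m = i then expectation (\<lambda>x. X i x ^ 2) else 1) *
        (if m = j then expectation (\<lambda>x. X j x ^ 2) else 1)" for m
      using True neq unfolding f_def cnt_def by (auto simp: numeral_2_eq_2 prob_space)
    then show ?thesis using True I fin unfolding E by (simp add: prod.distrib)
  next
    case False
    then have "k \<notin> {i, j} \<or> l \<notin> {i, j}" using neq by auto
    then obtain m where m: "m \<in> I" "cnt m = 1"
    proof
      assume "k \<notin> {i, j}" then show ?thesis using that[of k] I neq by (auto simp: cnt_def)
    next
      assume "l \<notin> {i, j}" then show ?thesis using that[of l] I neq by (auto simp: cnt_def)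
    qed
    then have "f m = X m" by (simp add: f_def fun_eq_iff)
    then have "expectation (f m) = 0" using mean m by simp
    then have "(\<Prod>m\<in>I. expectation (f m)) = 0" using m fin by (intro prod_zero) auto
    then show ?thesis using False unfolding E by auto
  qed
qed

text \<open>In the expanded square a pair (i, j) correlates only with itself and with (j, i), and
  symmetry of the coefficients makes the two contributions equal; this is the factor 2. Since the
  diagonal vanishes, no fourth moment appears in the value.\<close>

lemma (in prob_space) second_moment_offdiagonal_form:
  fixes X :: "'i \<Rightarrow> 'a \<Rightarrow> real"
  assumes ind: "indep_vars (\<lambda>_. borel) X I" and fin: "finite I"
    and int4: "\<And>i. i \<in> I \<Longrightarrow> integrable M (\<lambda>x. X i x ^ 4)"
    and mean: "\<And>i. i \<in> I \<Longrightarrow> expectation (X i) = 0"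
    and diag: "\<And>i. i \<in> I \<Longrightarrow> c i i = (0::real)"
    and sym: "\<And>i j. i \<in> I \<Longrightarrow> j \<in> I \<Longrightarrow> c i j = c j i"
  shows "integrable M (\<lambda>x. (\<Sum>i\<in>I. \<Sum>j\<in>I. c i j * (X i x * X j x))\<^sup>2)"
    and "expectation (\<lambda>x. (\<Sum>i\<in>I. \<Sum>j\<in>I. c i j * (X i x * X j x))\<^sup>2) =
      2 * (\<Sum>i\<in>I. \<Sum>j\<in>I. (c i j)\<^sup>2 * (expectation (\<lambda>x. X i x ^ 2) * expectation (\<lambda>x. X j x ^ 2)))"
proof -
  define s where "s i = expectation (\<lambda>x. X i x ^ 2)" for i
  define g where "g i j k l x = c i j * c k l * (X i x * X j x * (X k x * X l x))" for i j k l x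
  have sq: "(\<Sum>i\<in>I. \<Sum>j\<in>I. c i j * (X i x * X j x))\<^sup>2 =
      (\<Sum>i\<in>I. \<Sum>j\<in>I. \<Sum>k\<in>I. \<Sum>l\<in>I. g i j k l x)" for x
    unfolding power2_eq_square g_def
    unfolding sum_distrib_right unfolding sum_distrib_left
    by (intro sum.cong refl) (simp add: mult_ac)
  have gi: "integrable M (g i j k l)" if "i \<in> I" "j \<in> I" "k \<in> I" "l \<in> I" for i j k l
  proof (cases "i = j \<or> k = l")
    case True
    then have z: "c i j * c k l = 0" using diag that by auto
    show ?thesis unfolding g_def z by simp
  next
    case False
    then show ?thesis unfolding g_def
      by (intro integrable_mult_right indep_centred_fourth_product(1)[OF ind fin int4 mean that]) auto
  qed
  have gE: "expectation (g i j k l) = c i j * c k l *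
      (if k = i \<and> l = j \<or> k = j \<and> l = i then s i * s j else 0)"
    if "i \<in> I" "j \<in> I" "k \<in> I" "l \<in> I" for i j k l
  proof (cases "i = j \<or> k = l")
    case True
    then have z: "c i j * c k l = 0" using diag that by auto
    show ?thesis unfolding g_def z by simp
  next
    case False
    then have "expectation (\<lambda>x. X i x * X j x * (X k x * X l x)) =
      (if k = i \<and> l = j \<or> k = j \<and> l = i then s i * s j else 0)"
      unfolding s_def by (intro indep_centred_fourth_product(2)[OF ind fin int4 mean that]) auto
    then show ?thesis unfolding g_def by simp
  qed
  show "integrable M (\<lambda>x. (\<Sum>i\<in>I. \<Sum>j\<in>I. c i j * (X i x * X j x))\<^sup>2)"
    unfolding sq by (intro Bochner_Integration.integrable_sum gi)
  have "expectation (\<lambda>x. (\<Sum>i\<in>I. \<Sum>j\<in>I. c i j * (X i x * X j x))\<^sup>2) =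
      (\<Sum>i\<in>I. \<Sum>j\<in>I. \<Sum>k\<in>I. \<Sum>l\<in>I. expectation (g i j k l))"
    unfolding sq by (simp add: gi Bochner_Integration.integral_sum Bochner_Integration.integrable_sum)
  also have "\<dots> = (\<Sum>i\<in>I. \<Sum>j\<in>I. 2 * ((c i j)\<^sup>2 * (s i * s j)))"
  proof (intro sum.cong refl)
    fix i j assume ij: "i \<in> I" "j \<in> I"
    show "(\<Sum>k\<in>I. \<Sum>l\<in>I. expectation (g i j k l)) = 2 * ((c i j)\<^sup>2 * (s i * s j))"
    proof (cases "i = j")
      case True
      then show ?thesis using diag[OF ij(1)] ij by (simp add: gE)
    next
      case False
      have "(\<Sum>k\<in>I. \<Sum>l\<in>I. expectation (g i j k l)) =
          (\<Sum>k\<in>I. \<Sum>l\<in>I. (if k = i then if l = j then c i j * c i j * (s i * s j) else 0 else 0) +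
            (if k = j then if l = i then c i j * c j i * (s i * s j) else 0 else 0))"
        using False ij by (intro sum.cong refl) (auto simp: gE)
      also have "\<dots> = c i j * c i j * (s i * s j) + c i j * c j i * (s i * s j)"
      proof -
        have d: "(\<Sum>k\<in>I. \<Sum>l\<in>I. if k = a then if l = b then v else 0 else 0) = v"
          if "a \<in> I" "b \<in> I" for a b and v :: real
        proof -
          have "(\<Sum>k\<in>I. \<Sum>l\<in>I. if k = a then if l = b then v else 0 else 0) =
              (\<Sum>k\<in>I. if k = a then v else 0)"
            using that fin by (intro sum.cong refl) auto
          then show ?thesis using that fin by simp
        qed
        show ?thesis unfolding sum.distrib using ij by (simp add: d)
      qed
      finally show ?thesis using sym[OF ij] by (simp add: power2_eq_square)
    qed
  qed
  finally show "expectation (\<lambda>x. (\<Sum>i\<in>I. \<Sum>j\<in>I. c i j * (X i x * X j x))\<^sup>2) =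
      2 * (\<Sum>i\<in>I. \<Sum>j\<in>I. (c i j)\<^sup>2 * (expectation (\<lambda>x. X i x ^ 2) * expectation (\<lambda>x. X j x ^ 2)))"
    by (simp add: s_def sum_distrib_left)
qed

lemma (in prob_space) second_moment_indep_sum:
  fixes Z :: "'i \<Rightarrow> 'a \<Rightarrow> real"
  assumes ind: "indep_vars (\<lambda>_. borel) Z I" and fin: "finite I"
    and int2: "\<And>i. i \<in> I \<Longrightarrow> integrable M (\<lambda>x. Z i x ^ 2)"
    and mean: "\<And>i. i \<in> I \<Longrightarrow> expectation (Z i) = 0"
  shows "integrable M (\<lambda>x. (\<Sum>i\<in>I. Z i x)\<^sup>2)"
    and "expectation (\<lambda>x. (\<Sum>i\<in>I. Z i x)\<^sup>2) = (\<Sum>i\<in>I. expectation (\<lambda>x. Z i x ^ 2))"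
proof -
  have rv [measurable]: "random_variable borel (Z i)" if "i \<in> I" for i
    using ind that unfolding indep_vars_def2 by simp
  have int1: "integrable M (Z i)" if "i \<in> I" for i
    by (rule square_integrable_imp_integrable) (use that int2 in auto)
  have ij: "integrable M (\<lambda>x. Z i x * Z j x) \<and>
      expectation (\<lambda>x. Z i x * Z j x) = (if j = i then expectation (\<lambda>x. Z i x ^ 2) else 0)"
    if "i \<in> I" "j \<in> I" for i j
  proof (cases "j = i")
    case True
    then show ?thesis using int2[OF that(1)] by (simp add: power2_eq_square)
  next
    case False
    have sub: "indep_vars (\<lambda>_. borel) Z {i, j}"
      using that by (intro indep_vars_subset[OF ind]) auto
    show ?thesis
      using indep_vars_integrable[OF _ sub] indep_vars_lebesgue_integral[OF _ sub] int1 that mean False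
      by auto
  qed
  have sq: "(\<Sum>i\<in>I. Z i x)\<^sup>2 = (\<Sum>i\<in>I. \<Sum>j\<in>I. Z i x * Z j x)" for x
    by (simp add: power2_eq_square sum_product)
  show "integrable M (\<lambda>x. (\<Sum>i\<in>I. Z i x)\<^sup>2)"
    unfolding sq using ij by (intro Bochner_Integration.integrable_sum) auto
  have "expectation (\<lambda>x. (\<Sum>i\<in>I. Z i x)\<^sup>2) = (\<Sum>i\<in>I. \<Sum>j\<in>I. expectation (\<lambda>x. Z i x * Z j x))"
    unfolding sq using ij by (simp add: Bochner_Integration.integral_sum Bochner_Integration.integrable_sum)
  also have "\<dots> = (\<Sum>i\<in>I. \<Sum>j\<in>I. if j = i then expectation (\<lambda>x. Z i x ^ 2) else 0)"
    using ij by (intro sum.cong refl) auto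
  also have "\<dots> = (\<Sum>i\<in>I. expectation (\<lambda>x. Z i x ^ 2))" using fin by simp
  finally show "expectation (\<lambda>x. (\<Sum>i\<in>I. Z i x)\<^sup>2) = (\<Sum>i\<in>I. expectation (\<lambda>x. Z i x ^ 2))" .
qed

text \<open>The deviation is A - B, where A is the centred diagonal part and B the off-diagonal
  form. Their second moments are at most V and 2 V times the sum of fourth powers of the weights,
  and (A - B)^2 <= 2 A^2 + 2 B^2 gives 2 + 4 = 6. Markov's inequality is applied to the
  square.\<close>

lemma (in prob_space) quadratic_form_concentrates:
  fixes X :: "'i \<Rightarrow> 'a \<Rightarrow> real" and w :: "'i \<Rightarrow> real"
  assumes ind: "indep_vars (\<lambda>_. borel) X I" and fin: "finite I"
    and int4: "\<And>i. i \<in> I \<Longrightarrow> integrable M (\<lambda>x. X i x ^ 4)"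
    and mean: "\<And>i. i \<in> I \<Longrightarrow> expectation (X i) = 0"
    and V: "\<And>i. i \<in> I \<Longrightarrow> expectation (\<lambda>x. X i x ^ 4) \<le> V" "0 \<le> V"
    and diag: "\<And>i. i \<in> I \<Longrightarrow> c i i = (0::real)"
    and sym: "\<And>i j. i \<in> I \<Longrightarrow> j \<in> I \<Longrightarrow> c i j = c j i"
    and c: "(\<Sum>i\<in>I. \<Sum>j\<in>I. (c i j)\<^sup>2) \<le> (\<Sum>i\<in>I. w i ^ 4)"
    and a: "0 < a"
  shows "prob {x \<in> space M. a \<le> \<bar>(\<Sum>i\<in>I. (w i)\<^sup>2 * (X i x)\<^sup>2) -
        (\<Sum>i\<in>I. \<Sum>j\<in>I. c i j * (X i x * X j x)) -
        (\<Sum>i\<in>I. (w i)\<^sup>2 * expectation (\<lambda>x. X i x ^ 2))\<bar>} \<le> 6 * V * (\<Sum>i\<in>I. w i ^ 4) / a\<^sup>2"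
proof -
  have rv [measurable]: "random_variable borel (X i)" if "i \<in> I" for i
    using ind that unfolding indep_vars_def2 by simp
  define s where "s i = expectation (\<lambda>x. X i x ^ 2)" for i
  define Z where "Z i x = (w i)\<^sup>2 * ((X i x)\<^sup>2 - s i)" for i x
  define A where "A x = (\<Sum>i\<in>I. Z i x)" for x
  define B where "B x = (\<Sum>i\<in>I. \<Sum>j\<in>I. c i j * (X i x * X j x))" for x
  have A_eq: "A x = (\<Sum>i\<in>I. (w i)\<^sup>2 * (X i x)\<^sup>2) - (\<Sum>i\<in>I. (w i)\<^sup>2 * s i)" for x
    by (simp add: A_def Z_def right_diff_distrib sum_subtractf)
  have int2: "integrable M (\<lambda>x. (X i x)\<^sup>2)" if "i \<in> I" for i
    using that by (intro integrable_power_le[OF finite_measure_axioms rv int4]) auto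
  have Zsq: "Z i x ^ 2 = w i ^ 4 * (X i x ^ 4 - 2 * s i * (X i x)\<^sup>2 + (s i)\<^sup>2)" for i x
    unfolding Z_def by (simp add: power2_eq_square power4_eq_xxxx algebra_simps)
  have indZ: "indep_vars (\<lambda>_. borel) Z I"
    unfolding Z_def by (rule indep_vars_compose2[OF ind]) auto
  have Zint: "integrable M (\<lambda>x. Z i x ^ 2)" if "i \<in> I" for i
    unfolding Zsq using int2[OF that] int4[OF that] by simp
  have ZE: "expectation (Z i) = 0" if "i \<in> I" for i
    unfolding Z_def using int2[OF that] by (simp add: s_def prob_space)
  have Zvar: "expectation (\<lambda>x. Z i x ^ 2) \<le> w i ^ 4 * V" if "i \<in> I" for i
  proof -
    have "expectation (\<lambda>x. Z i x ^ 2) = w i ^ 4 * (expectation (\<lambda>x. X i x ^ 4) - (s i)\<^sup>2)"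
      unfolding Zsq using int2[OF that] int4[OF that]
      by (simp add: prob_space flip: s_def) (simp add: power2_eq_square)
    also have "\<dots> \<le> w i ^ 4 * V"
      using V(1)[OF that] zero_le_power2[of "s i"] by (intro mult_left_mono) (linarith, simp)
    finally show ?thesis .
  qed
  have A2: "integrable M (\<lambda>x. (A x)\<^sup>2)" "expectation (\<lambda>x. (A x)\<^sup>2) \<le> V * (\<Sum>i\<in>I. w i ^ 4)"
    using second_moment_indep_sum[OF indZ fin Zint ZE] sum_mono[OF Zvar, of I]
    by (simp_all add: A_def sum_distrib_left mult.commute)
  have ss: "s i * s j \<le> V" if "i \<in> I" "j \<in> I" for i j
  proof -
    have "(s i)\<^sup>2 \<le> V" "(s j)\<^sup>2 \<le> V"
      using expectation_square_le_fourth[OF rv int4] V(1) that order_trans unfolding s_def by blast+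
    moreover have "2 * (s i * s j) \<le> (s i)\<^sup>2 + (s j)\<^sup>2"
      using zero_le_power2[of "s i - s j"] by (simp add: power2_diff)
    ultimately show ?thesis by linarith
  qed
  note Bm = second_moment_offdiagonal_form[OF ind fin int4 mean diag sym]
  have "expectation (\<lambda>x. (B x)\<^sup>2) = 2 * (\<Sum>i\<in>I. \<Sum>j\<in>I. (c i j)\<^sup>2 * (s i * s j))"
    unfolding B_def s_def by (rule Bm(2))
  also have "\<dots> \<le> 2 * (\<Sum>i\<in>I. \<Sum>j\<in>I. (c i j)\<^sup>2 * V)"
    using ss by (intro mult_left_mono sum_mono) auto
  also have "\<dots> = 2 * V * (\<Sum>i\<in>I. \<Sum>j\<in>I. (c i j)\<^sup>2)" by (simp add: sum_distrib_left mult_ac)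
  also have "\<dots> \<le> 2 * V * (\<Sum>i\<in>I. w i ^ 4)" using c V(2) by (intro mult_left_mono) auto
  finally have B2: "integrable M (\<lambda>x. (B x)\<^sup>2)" "expectation (\<lambda>x. (B x)\<^sup>2) \<le> 2 * V * (\<Sum>i\<in>I. w i ^ 4)"
    using Bm(1) by (simp_all add: B_def)
  have meas [measurable]: "A \<in> borel_measurable M" "B \<in> borel_measurable M"
    unfolding A_def[abs_def] B_def[abs_def] Z_def by measurable
  have dom: "integrable M (\<lambda>x. 2 * (A x)\<^sup>2 + 2 * (B x)\<^sup>2)" using A2 B2 by simp
  have le: "(A x - B x)\<^sup>2 \<le> 2 * (A x)\<^sup>2 + 2 * (B x)\<^sup>2" for x
    using zero_le_power2[of "A x + B x"] by (simp add: power2_sum power2_diff)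
  have int: "integrable M (\<lambda>x. (A x - B x)\<^sup>2)"
    by (rule Bochner_Integration.integrable_bound[OF dom]) (use le in auto)
  have "expectation (\<lambda>x. (A x - B x)\<^sup>2) \<le> expectation (\<lambda>x. 2 * (A x)\<^sup>2 + 2 * (B x)\<^sup>2)"
    by (rule integral_mono[OF int dom le])
  also have "\<dots> \<le> 6 * V * (\<Sum>i\<in>I. w i ^ 4)" using A2 B2 by simp
  finally have E: "expectation (\<lambda>x. (A x - B x)\<^sup>2) \<le> 6 * V * (\<Sum>i\<in>I. w i ^ 4)" .
  have "{x \<in> space M. a \<le> \<bar>(\<Sum>i\<in>I. (w i)\<^sup>2 * (X i x)\<^sup>2) -
        (\<Sum>i\<in>I. \<Sum>j\<in>I. c i j * (X i x * X j x)) - (\<Sum>i\<in>I. (w i)\<^sup>2 * s i)\<bar>} =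
      {x \<in> space M. a\<^sup>2 \<le> (A x - B x)\<^sup>2}"
  proof -
    have "(a \<le> \<bar>A x - B x\<bar>) = (a\<^sup>2 \<le> (A x - B x)\<^sup>2)" for x
      using abs_le_square_iff[of a "A x - B x"] a by simp
    then show ?thesis unfolding A_eq B_def by (simp add: algebra_simps)
  qed
  moreover have "prob {x \<in> space M. a\<^sup>2 \<le> (A x - B x)\<^sup>2} \<le> expectation (\<lambda>x. (A x - B x)\<^sup>2) / a\<^sup>2"
    using a by (intro integral_Markov_inequality_measure[OF int, of "{}"]) auto
  moreover have "\<dots> \<le> 6 * V * (\<Sum>i\<in>I. w i ^ 4) / a\<^sup>2" by (intro divide_right_mono E) simp
  ultimately show ?thesis by (simp add: s_def)
qed

section \<open>Coverage by a studentized weighted sum\<close>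

lemma cdf_interval_lower:
  assumes \<nu>: "real_distribution \<nu>" and near: "\<And>x. \<bar>cdf \<nu> x - Phi x\<bar> \<le> e" and t: "0 \<le> t"
  shows "folded_cdf b t - 2 * e \<le> measure \<nu> {x. \<bar>b + x\<bar> < t}"
proof -
  interpret \<nu>: real_distribution \<nu> by fact
  have set: "{x. \<bar>b + x\<bar> < t} = {- t - b<..<t - b}" by auto
  \<comment> \<open>The law may have atoms, so the right end of the open interval is approached from
    the left, where half-open intervals are expressed by \<open>cdf\<close>. The limit uses the
    continuity of \<open>Phi\<close>, and the error 2 e stems from the two endpoints.\<close>
  have fin: "Phi (t - b) - Phi (- t - b) \<le> measure \<nu> {- t - b<..<t - b} + 2 * e"
  proof (rule tendsto_upperbound)
    show "((\<lambda>u. Phi u - Phi (- t - b)) \<longlongrightarrow> Phi (t - b) - Phi (- t - b)) (at_left (t - b))"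
      using Phi_isCont[of "t - b"] by (intro tendsto_intros) (auto simp: isCont_def intro: tendsto_within_subset)
    show "eventually (\<lambda>u. Phi u - Phi (- t - b) \<le> measure \<nu> {- t - b<..<t - b} + 2 * e) (at_left (t - b))"
      unfolding eventually_at_left_field
    proof (intro exI[of _ "t - b - 1"] conjI allI impI)
      fix u assume u: "t - b - 1 < u" "u < t - b"
      have e0: "0 \<le> e" using near[of 0] by linarith
      show "Phi u - Phi (- t - b) \<le> measure \<nu> {- t - b<..<t - b} + 2 * e"
      proof (cases "- t - b < u")
        case True
        have "cdf \<nu> u - cdf \<nu> (- t - b) = measure \<nu> {- t - b<..u}"
          by (rule \<nu>.cdf_diff_eq[OF True])
        also have "\<dots> \<le> measure \<nu> {- t - b<..<t - b}"
          using u by (intro \<nu>.finite_measure_mono) auto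
        finally show ?thesis using near[of u] near[of "- t - b"] by linarith
      next
        case False
        then have "Phi u \<le> Phi (- t - b)" by (intro std_normal.cdf_nondecreasing) auto
        moreover have "0 \<le> measure \<nu> {- t - b<..<t - b}" by simp
        ultimately show ?thesis using e0 by linarith
      qed
    qed simp
  qed simp
  then show ?thesis unfolding set folded_cdf_def by simp
qed

text \<open>What the argument below needs of the Lyapunov ratio \<open>\<rho>\<close>: normal approximation error at most \<open>e\<close>, and
  relative error at most \<open>\<kappa>\<close> of the variance estimator outside an event of probability \<open>e\<close>.\<close>

definition lyapunov_tolerance :: "real \<Rightarrow> real \<Rightarrow> real \<Rightarrow> real \<Rightarrow> bool" where
  "lyapunov_tolerance p d V \<rho> \<longleftrightarrow> 0 < V \<and> 0 < \<rho> \<and> (\<exists>e \<kappa> L. 0 < e \<and> e \<le> d / 8 \<and> e \<le> p / 2 \<and>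
    0 < \<kappa> \<and> \<kappa> \<le> 1 / 2 \<and> 8 * \<kappa> \<le> e \<and> 0 < L \<and> \<rho> * V \<le> L \<and> 6 * V * \<rho> / \<kappa>\<^sup>2 \<le> e \<and>
    (\<forall>\<nu>. real_distribution \<nu> \<longrightarrow>
      (\<forall>t. cmod (char \<nu> t - exp (- (t\<^sup>2) / 2)) \<le> \<bar>t\<bar> ^ 3 * sqrt L + t ^ 4 * L) \<longrightarrow>
      (\<forall>x. \<bar>cdf \<nu> x - Phi x\<bar> \<le> e)))"

lemma lyapunov_tolerance_exists:
  assumes p: "0 < p" "p < 1" and d: "0 < d" and V: "0 < V"
  shows "\<exists>\<rho>. lyapunov_tolerance p d V \<rho>"
proof -
  \<comment> \<open>The coverage argument loses 4 e in total, which \<open>d / 8\<close> leaves room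
    for; \<open>p / 2\<close> keeps the lowered level p - e positive.\<close>
  define e where "e = min (d / 8) (p / 2)"
  have e: "0 < e" "e \<le> d / 8" "e \<le> p / 2" using d p by (auto simp: e_def)
  obtain L where L: "0 < L" and near: "\<forall>\<nu>. real_distribution \<nu> \<longrightarrow>
      (\<forall>t. cmod (char \<nu> t - exp (- (t\<^sup>2) / 2)) \<le> \<bar>t\<bar> ^ 3 * sqrt L + t ^ 4 * L) \<longrightarrow>
      (\<forall>x. \<bar>cdf \<nu> x - Phi x\<bar> \<le> e)"
    using cdf_near_Phi_of_char_near[OF e(1)] by blast
  \<comment> \<open>The bound 1/2 keeps the ratio q of the standard errors in [1/2, 2], and e/8
    makes the dilation error 8 |q - 1| at most e.\<close>
  define \<kappa> where "\<kappa> = min (1 / 2) (e / 8)"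
  have \<kappa>: "0 < \<kappa>" "\<kappa> \<le> 1 / 2" "8 * \<kappa> \<le> e" using e by (auto simp: \<kappa>_def)
  \<comment> \<open>The first term puts the fourth moments of the standardized summands below
    \<open>L\<close>, the second makes the Markov bound for the variance form at most
    \<open>e\<close>.\<close>
  define \<rho> where "\<rho> = min (L / V) (e * \<kappa>\<^sup>2 / (6 * V))"
  have "0 < \<rho>" using L V e \<kappa> by (simp add: \<rho>_def)
  moreover have "\<rho> \<le> L / V" by (simp add: \<rho>_def)
  then have "\<rho> * V \<le> L" using V by (simp add: field_simps)
  moreover have "\<rho> \<le> e * \<kappa>\<^sup>2 / (6 * V)" by (simp add: \<rho>_def)
  then have "\<rho> * (6 * V) \<le> e * \<kappa>\<^sup>2" using V by (simp only: pos_le_divide_eq)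
  then have "6 * V * \<rho> / \<kappa>\<^sup>2 \<le> e" using \<kappa>(1) by (subst pos_divide_le_eq) (auto simp: mult_ac)
  ultimately show ?thesis unfolding lyapunov_tolerance_def using V e \<kappa> L near by blast
qed

text \<open>Rescaling by the true standard deviation makes the claim uniform in the bias bound \<open>R\<close>.\<close>

lemma (in prob_space) studentized_sum_coverage:
  fixes X :: "'i \<Rightarrow> 'a \<Rightarrow> real" and S :: "'a \<Rightarrow> real"
  assumes p: "0 < p" "p < 1" and tol: "lyapunov_tolerance p d V \<rho>"
    and ind: "indep_vars (\<lambda>_. borel) X I" and fin: "finite I"
    and int4: "\<And>i. i \<in> I \<Longrightarrow> integrable M (\<lambda>x. X i x ^ 4)"
    and mean: "\<And>i. i \<in> I \<Longrightarrow> expectation (X i) = 0"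
    and V4: "\<And>i. i \<in> I \<Longrightarrow> expectation (\<lambda>x. X i x ^ 4) \<le> V"
    and diag: "\<And>i. i \<in> I \<Longrightarrow> c i i = (0::real)"
    and sym: "\<And>i j. i \<in> I \<Longrightarrow> j \<in> I \<Longrightarrow> c i j = c j i"
    and c: "(\<Sum>i\<in>I. \<Sum>j\<in>I. (c i j)\<^sup>2) \<le> (\<Sum>i\<in>I. w i ^ 4)"
    and s_pos: "0 < (\<Sum>i\<in>I. (w i)\<^sup>2 * expectation (\<lambda>x. X i x ^ 2))"
    and Lyap: "(\<Sum>i\<in>I. w i ^ 4) \<le> \<rho> * (\<Sum>i\<in>I. (w i)\<^sup>2 * expectation (\<lambda>x. X i x ^ 2))\<^sup>2"
    and b: "\<bar>b\<bar> \<le> R" and meas: "E \<in> sets M"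
    and S: "AE x in M. S x = sqrt ((\<Sum>i\<in>I. (w i)\<^sup>2 * (X i x)\<^sup>2) - (\<Sum>i\<in>I. \<Sum>j\<in>I. c i j * (X i x * X j x))) \<and>
      (\<bar>b + (\<Sum>i\<in>I. w i * X i x)\<bar> < cv p (R / S x) * S x \<longrightarrow> x \<in> E)"
  shows "p - d \<le> prob E"
proof -
  obtain e \<kappa> L where V: "0 < V" and e: "0 < e" "e \<le> d / 8" "e \<le> p / 2"
    and \<kappa>: "0 < \<kappa>" "\<kappa> \<le> 1 / 2" "8 * \<kappa> \<le> e" and L: "0 < L"
    and \<rho>: "0 < \<rho>" "\<rho> * V \<le> L" "6 * V * \<rho> / \<kappa>\<^sup>2 \<le> e"
    and near: "\<And>\<nu>. real_distribution \<nu> \<Longrightarrow>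
      (\<And>t. cmod (char \<nu> t - exp (- (t\<^sup>2) / 2)) \<le> \<bar>t\<bar> ^ 3 * sqrt L + t ^ 4 * L) \<Longrightarrow>
      \<forall>x. \<bar>cdf \<nu> x - Phi x\<bar> \<le> e"
    using tol unfolding lyapunov_tolerance_def by blast
  have rv [measurable]: "random_variable borel (X i)" if "i \<in> I" for i
    using ind that unfolding indep_vars_def2 by simp
  define s2 where "s2 = (\<Sum>i\<in>I. (w i)\<^sup>2 * expectation (\<lambda>x. X i x ^ 2))"
  define s where "s = sqrt s2"
  have s2: "0 < s2" using s_pos by (simp add: s2_def)
  have s: "0 < s" "s\<^sup>2 = s2" using s_pos by (simp_all add: s_def s2_def)
  define T where "T x = (\<Sum>i\<in>I. w i / s * X i x)" for x
  have T_eq: "(\<Sum>i\<in>I. w i * X i x) = s * T x" for x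
    using s by (simp add: T_def sum_distrib_left)
  have T_rv [measurable]: "random_variable borel T" unfolding T_def[abs_def] by measurable
  define \<nu> where "\<nu> = distr M borel T"
  have \<nu>: "real_distribution \<nu>" unfolding \<nu>_def by (rule real_distribution_distr) simp
  have indT: "indep_vars (\<lambda>_. borel) (\<lambda>i x. w i / s * X i x) I"
    by (rule indep_vars_compose2[OF ind]) auto
  have "\<forall>x. \<bar>cdf \<nu> x - Phi x\<bar> \<le> e"
  proof (rule near[OF \<nu>])
    fix t
    show "cmod (char \<nu> t - exp (- (t\<^sup>2) / 2)) \<le> \<bar>t\<bar> ^ 3 * sqrt L + t ^ 4 * L"
      unfolding \<nu>_def T_def[abs_def]
    proof (rule char_sum_near_normal[OF indT fin _ _ _ _ L])
      show "integrable M (\<lambda>x. (w i / s * X i x) ^ 4)" if "i \<in> I" for i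
        using int4[OF that] by (simp add: power_mult_distrib power_divide)
      show "expectation (\<lambda>x. w i / s * X i x) = 0" if "i \<in> I" for i
        using mean[OF that] by simp
      have "(\<Sum>i\<in>I. expectation (\<lambda>x. (w i / s * X i x)\<^sup>2)) =
          (\<Sum>i\<in>I. (w i)\<^sup>2 * expectation (\<lambda>x. X i x ^ 2)) / s\<^sup>2"
        by (simp add: power_mult_distrib power_divide sum_divide_distrib)
      then show "(\<Sum>i\<in>I. expectation (\<lambda>x. (w i / s * X i x)\<^sup>2)) = 1"
        using s s_pos by (simp add: s2_def)
      have "(\<Sum>i\<in>I. expectation (\<lambda>x. (w i / s * X i x) ^ 4)) =
          (\<Sum>i\<in>I. w i ^ 4 * expectation (\<lambda>x. X i x ^ 4)) / s ^ 4"
        by (simp add: power_mult_distrib power_divide sum_divide_distrib)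
      also have "\<dots> \<le> (\<Sum>i\<in>I. w i ^ 4 * V) / s ^ 4"
        using V4 s by (intro divide_right_mono sum_mono mult_left_mono) auto
      also have "\<dots> = (\<Sum>i\<in>I. w i ^ 4) * V / s2\<^sup>2"
        by (simp add: sum_distrib_right flip: s(2) power_mult)
      also have "\<dots> \<le> \<rho> * s2\<^sup>2 * V / s2\<^sup>2"
        using Lyap V by (intro divide_right_mono mult_right_mono) (auto simp: s2_def)
      also have "\<dots> \<le> L" using \<rho>(2) s by auto
      finally show "(\<Sum>i\<in>I. expectation (\<lambda>x. (w i / s * X i x) ^ 4)) \<le> L" .
    qed
  qed
  then have nearT: "\<bar>cdf \<nu> x - Phi x\<bar> \<le> e" for x by blast
  \<comment> \<open>A nonrandom critical value, built with the true standard deviation at a level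
    lowered by \<open>e\<close>; this margin absorbs the replacement of \<open>s\<close> by
    \<open>S x\<close>.\<close>
  define t where "t = cv (p - e) (R / s)"
  have pe: "0 < p - e" "p - e < 1" using e p by auto
  have t: "0 \<le> t" unfolding t_def by (rule cv_nonneg[OF pe])
  define U where "U x = (\<Sum>i\<in>I. (w i)\<^sup>2 * (X i x)\<^sup>2) - (\<Sum>i\<in>I. \<Sum>j\<in>I. c i j * (X i x * X j x))" for x
  have U_rv [measurable]: "random_variable borel U" unfolding U_def[abs_def] by measurable
  let ?F = "{x \<in> space M. \<bar>b / s + T x\<bar> < t}"
  let ?G = "{x \<in> space M. \<kappa> * s2 \<le> \<bar>U x - s2\<bar>}"
  have "p - e - 2 * e \<le> folded_cdf (R / s) t - 2 * e"
    using folded_cdf_cv[OF pe, of "R / s"] by (simp add: t_def)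
  also have "\<dots> \<le> folded_cdf (b / s) t - 2 * e"
    using folded_cdf_antimono[of "b / s" "R / s" t] b s t by (simp add: abs_div divide_right_mono)
  also have "\<dots> \<le> measure \<nu> {x. \<bar>b / s + x\<bar> < t}" by (rule cdf_interval_lower[OF \<nu> nearT t])
  also have "\<dots> = prob ?F"
    unfolding \<nu>_def by (subst measure_distr) (auto intro!: arg_cong2[where f = measure])
  finally have F: "p - 3 * e \<le> prob ?F" by simp
  have "prob ?G \<le> 6 * V * (\<Sum>i\<in>I. w i ^ 4) / (\<kappa> * s2)\<^sup>2"
    unfolding U_def s2_def
    using quadratic_form_concentrates[OF ind fin int4 mean V4, of c w "\<kappa> * s2"] diag sym c V \<kappa> s_pos
    by (simp add: s2_def)
  also have "\<dots> \<le> 6 * V * (\<rho> * s2\<^sup>2) / (\<kappa> * s2)\<^sup>2"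
    using Lyap V by (intro divide_right_mono mult_left_mono) (auto simp: s2_def)
  also have "\<dots> = 6 * V * \<rho> / \<kappa>\<^sup>2" using s_pos by (simp add: power_mult_distrib s2_def)
  also have "\<dots> \<le> e" by (rule \<rho>(3))
  finally have G: "prob ?G \<le> e" .
  have "AE x in M. x \<in> ?F - ?G \<longrightarrow> x \<in> E"
    using S
  proof eventually_elim
    fix x assume Sx: "S x = sqrt ((\<Sum>i\<in>I. (w i)\<^sup>2 * (X i x)\<^sup>2) - (\<Sum>i\<in>I. \<Sum>j\<in>I. c i j * (X i x * X j x))) \<and>
      (\<bar>b + (\<Sum>i\<in>I. w i * X i x)\<bar> < cv p (R / S x) * S x \<longrightarrow> x \<in> E)"
    show "x \<in> ?F - ?G \<longrightarrow> x \<in> E"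
    proof
      assume "x \<in> ?F - ?G"
      then have x: "x \<in> space M" "\<bar>b / s + T x\<bar> < t" "\<bar>U x - s2\<bar> < \<kappa> * s2" by auto
      \<comment> \<open>The ratio of the estimated to the true standard error. Outside the
        exceptional event its square is within \<kappa> of 1, and so is \<open>q\<close>, because |q
        - 1| <= |q^2 - 1| for nonnegative q.\<close>
      define q where "q = S x / s"
      have "\<bar>U x / s2 - 1\<bar> < \<kappa>"
      proof -
        have "U x / s2 - 1 = (U x - s2) / s2" using s2 by (simp add: diff_divide_distrib)
        then show ?thesis using x(3) s2 by (simp add: abs_div pos_divide_less_eq)
      qed
      moreover have q2: "q\<^sup>2 = U x / s2" and q0: "0 \<le> q"
      proof -
        have "0 \<le> U x"
        proof -
          have "\<kappa> * s2 \<le> 1 / 2 * s2" using \<kappa> s2 by (intro mult_right_mono) auto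
          then show ?thesis using x(3) s(1,2) zero_le_power2[of s] by linarith
        qed
        then have "(S x)\<^sup>2 = U x" "0 \<le> S x" using Sx by (simp_all add: U_def)
        then show "q\<^sup>2 = U x / s2" "0 \<le> q" using s by (simp_all add: q_def power_divide)
      qed
      ultimately have "\<bar>q\<^sup>2 - 1\<bar> < \<kappa>" by simp
      moreover have "\<bar>q - 1\<bar> \<le> \<bar>q\<^sup>2 - 1\<bar>"
      proof -
        have "q\<^sup>2 - 1 = (q - 1) * (q + 1)" by (simp add: power2_eq_square algebra_simps)
        then have "\<bar>q\<^sup>2 - 1\<bar> = \<bar>q - 1\<bar> * (q + 1)" using q0 by (simp add: abs_mult)
        then show ?thesis using q0 mult_left_mono[of 1 "q + 1" "\<bar>q - 1\<bar>"] by simp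
      qed
      ultimately have q1: "\<bar>q - 1\<bar> < \<kappa>" by linarith
      then have qb: "1 / 2 \<le> q" "q \<le> 2" using \<kappa>(2) by linarith+
      define y where "y = \<bar>b / s + T x\<bar>"
      have A: "folded_cdf (R / s) y < p - e"
        using x(2) less_cv_iff[OF pe, of y "R / s"] by (simp add: y_def t_def)
      \<comment> \<open>Dividing both arguments by \<open>q\<close> turns \<open>R / s\<close> into
        \<open>R / S x\<close> and standardizes the error by \<open>S x\<close>; the cost fits into
        the margin between p - e and p.\<close>
      have "8 * \<bar>q - 1\<bar> \<le> e"
        by (rule order_trans[OF mult_left_mono[OF less_imp_le[OF q1]] \<kappa>(3)]) simp
      then have "folded_cdf (R / s) y + 8 * \<bar>q - 1\<bar> < (p - e) + e" by (rule add_less_le_mono[OF A])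
      then have "folded_cdf (R / s) y + 8 * \<bar>q - 1\<bar> < p" by simp
      then have "folded_cdf (R / s / q) (y / q) < p"
        by (rule le_less_trans[OF folded_cdf_dilation[OF qb]])
      moreover have Rq: "R / s / q = R / S x" using s by (simp add: q_def)
      ultimately have "folded_cdf (R / S x) (y / q) < p" by (simp only:)
      moreover have "0 \<le> y / q" using qb by (simp add: y_def)
      ultimately have "y / q < cv p (R / S x)"
        using less_cv_iff[OF p] by blast
      then have "y < cv p (R / S x) * q" using qb by (simp add: pos_divide_less_eq)
      then have "s * y < cv p (R / S x) * S x"
        using s by (simp add: q_def pos_less_divide_eq mult.commute)
      moreover have "s * y = \<bar>b + (\<Sum>i\<in>I. w i * X i x)\<bar>"
      proof -
        have "s * (b / s + T x) = b + (\<Sum>i\<in>I. w i * X i x)"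
          using s(1) by (simp add: T_eq distrib_left)
        moreover have "s * y = \<bar>s * (b / s + T x)\<bar>"
          unfolding y_def abs_mult using s(1) by simp
        ultimately show ?thesis by simp
      qed
      ultimately show "x \<in> E" using Sx by simp
    qed
  qed
  then have "prob (?F - ?G) \<le> prob E" using meas by (intro finite_measure_mono_AE) auto
  moreover have "prob ?F \<le> prob (?F - ?G) + prob ?G"
  proof -
    have "prob ?F \<le> prob ((?F - ?G) \<union> ?G)" by (intro finite_measure_mono) auto
    also have "\<dots> \<le> prob (?F - ?G) + prob ?G" by (intro measure_Un_le) auto
    finally show ?thesis .
  qed
  ultimately show "p - d \<le> prob E" using F G e by linarith
qed

section \<open>Worst-case bias\<close>

text \<open>The OLS weights for the intercept are affine in the regressor and change sign once; the chord
  through \<open>0\<close> and the sign change separates the graph of a convex function accordingly.\<close>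

lemma ols_intercept_le:
  fixes x w :: "'i \<Rightarrow> real" and f :: "real \<Rightarrow> real"
  assumes fin: "finite J" and x: "\<And>j. j \<in> J \<Longrightarrow> 0 \<le> x j"
    and w: "\<And>j. j \<in> J \<Longrightarrow> w j = a + b * x j"
    and one: "(\<Sum>j\<in>J. w j) = 1" and zero: "(\<Sum>j\<in>J. w j * x j) = 0"
    and chord: "\<And>r s u. 0 \<le> r \<Longrightarrow> r < s \<Longrightarrow> s < u \<Longrightarrow> (f s - f r) * (u - s) \<le> (f u - f s) * (s - r)"
  shows "(\<Sum>j\<in>J. w j * f (x j)) \<le> f 0"
proof -
  \<comment> \<open>Inserting the affine form for one of the two factors, the moment conditions
    identify \<open>a\<close> with the sum of squared weights. It is positive because weights that
    sum to 1 are not all zero.\<close>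
  have "(\<Sum>j\<in>J. (w j)\<^sup>2) = (\<Sum>j\<in>J. a * w j + b * (w j * x j))"
    using w by (intro sum.cong refl) (simp add: power2_eq_square algebra_simps)
  also have "\<dots> = a" using one zero by (simp add: sum.distrib flip: sum_distrib_left)
  finally have a: "(\<Sum>j\<in>J. (w j)\<^sup>2) = a" .
  have "a \<noteq> 0"
  proof
    assume "a = 0"
    then have "\<forall>j\<in>J. w j = 0" using a fin by (simp add: sum_nonneg_eq_0_iff)
    then show False using one by simp
  qed
  then have a_pos: "0 < a" using a sum_nonneg[of J "\<lambda>j. (w j)\<^sup>2"] by simp
  show ?thesis
  proof (cases "0 \<le> b")
    case True
    \<comment> \<open>A nondecreasing weight function is positive at every regressor, and the
      vanishing first moment then puts all regressors at 0.\<close>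
    have w_pos: "0 < w j" if "j \<in> J" for j
      using w[OF that] x[OF that] a_pos True by (simp add: add_pos_nonneg)
    have "\<forall>j\<in>J. w j * x j = 0"
      using zero fin w_pos x by (subst (asm) sum_nonneg_eq_0_iff) (auto simp: less_imp_le)
    then have "x j = 0" if "j \<in> J" for j using that w_pos by fastforce
    then have "(\<Sum>j\<in>J. w j * f (x j)) = (\<Sum>j\<in>J. w j) * f 0"
      by (simp add: sum_distrib_right)
    then show ?thesis using one by simp
  next
    case False
    \<comment> \<open>The root of the weight function. The chord of \<open>f\<close> over [0, t] is
      affine, so the two moment conditions evaluate its weighted sum as \<open>f 0\<close>.\<close>
    define t where "t = - a / b"
    have t: "0 < t" and wt: "\<And>j. j \<in> J \<Longrightarrow> w j = - b * (t - x j)"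
      using False a_pos w divide_pos_neg[of a b] by (simp_all add: t_def algebra_simps)
    have "w j * f (x j) \<le> w j * (f 0 + (f t - f 0) / t * x j)" if j: "j \<in> J" for j
    proof -
      have e: "(f 0 + (f t - f 0) / t * x j) * t = f 0 * t + (f t - f 0) * x j"
        using t by (simp add: distrib_right)
      show ?thesis
      proof (cases "x j" t rule: linorder_cases)
        case less
        have "f (x j) * t \<le> (f 0 + (f t - f 0) / t * x j) * t"
        proof (cases "x j = 0")
          case True then show ?thesis by simp
        next
          case False
          then have "(f (x j) - f 0) * (t - x j) \<le> (f t - f (x j)) * (x j - 0)"
            using chord[of 0 "x j" t] x[OF j] less by simp
          then show ?thesis unfolding e by (simp add: algebra_simps)
        qed
        then have "f (x j) \<le> f 0 + (f t - f 0) / t * x j" using t by simp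
        then show ?thesis using wt[OF j] less False by (intro mult_left_mono) (auto simp: mult_le_0_iff)
      next
        case equal
        then show ?thesis using wt[OF j] by simp
      next
        case greater
        have "(f t - f 0) * (x j - t) \<le> (f (x j) - f t) * (t - 0)"
          using chord[of 0 t "x j"] t greater by simp
        then have "(f 0 + (f t - f 0) / t * x j) * t \<le> f (x j) * t"
          unfolding e by (simp add: algebra_simps)
        then have "f 0 + (f t - f 0) / t * x j \<le> f (x j)" using t by simp
        moreover have "w j \<le> 0"
          unfolding wt[OF j] using greater False by (intro mult_nonneg_nonpos) auto
        ultimately show ?thesis by (intro mult_left_mono_neg)
      qed
    qed
    then have "(\<Sum>j\<in>J. w j * f (x j)) \<le> (\<Sum>j\<in>J. w j * (f 0 + (f t - f 0) / t * x j))"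
      by (rule sum_mono)
    also have "\<dots> = (\<Sum>j\<in>J. w j) * f 0 + (f t - f 0) / t * (\<Sum>j\<in>J. w j * x j)"
      by (simp add: distrib_left sum.distrib sum_distrib_left sum_distrib_right mult_ac)
    finally show ?thesis using one zero by simp
  qed
qed

text \<open>Adding K y^2/2 to f or to -f gives a nondecreasing derivative, because the Lipschitz
  bound limits how fast the derivative can fall. The conclusion is the three-point form of
  convexity, multiplied out to avoid quotients.\<close>

lemma lipschitz_deriv_chord:
  assumes f: "lipschitz_deriv_on K {0..} f" and \<sigma>: "\<bar>\<sigma>\<bar> = 1" and r: "0 \<le> r" "r < s" "s < u"
  defines "g \<equiv> \<lambda>y. \<sigma> * f y + K / 2 * y\<^sup>2"
  shows "(g s - g r) * (u - s) \<le> (g u - g s) * (s - r)"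
proof -
  obtain f' where f': "\<And>y. y \<in> {0..} \<Longrightarrow> (f has_real_derivative f' y) (at y within {0..})"
    and lip: "\<And>y z. y \<in> {0..} \<Longrightarrow> z \<in> {0..} \<Longrightarrow> \<bar>f' y - f' z\<bar> \<le> K * \<bar>y - z\<bar>"
    using f unfolding lipschitz_deriv_on_def by blast
  define g' where "g' y = \<sigma> * f' y + K * y" for y
  have g': "(g has_real_derivative g' y) (at y within {0..})" if "0 \<le> y" for y
    unfolding g_def g'_def using f'[of y] that by (auto intro!: derivative_eq_intros)
  have mvt: "\<exists>\<xi>. v < \<xi> \<and> \<xi> < z \<and> g z - g v = g' \<xi> * (z - v)" if "0 \<le> v" "v < z" for v z
  proof -
    have "\<exists>\<xi>\<in>{v<..<z}. g z - g v = (*) (g' \<xi>) (z - v)"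
    proof (rule mvt_simple[OF that(2)])
      fix y assume "v \<le> y" "y \<le> z"
      then have "(g has_real_derivative g' y) (at y within {v..z})"
        using that by (intro DERIV_subset[OF g']) auto
      then show "(g has_derivative (*) (g' y)) (at y within {v..z})"
        by (simp add: has_field_derivative_def)
    qed
    then show ?thesis by auto
  qed
  have mono: "g' y \<le> g' z" if "0 \<le> y" "y \<le> z" for y z
  proof -
    have "\<bar>\<sigma> * (f' y - f' z)\<bar> \<le> K * (z - y)"
      using lip[of y z] that \<sigma> by (simp add: abs_mult)
    then show ?thesis unfolding g'_def by (simp add: algebra_simps abs_le_iff)
  qed
  obtain \<xi> where \<xi>: "r < \<xi>" "\<xi> < s" "g s - g r = g' \<xi> * (s - r)" using mvt[of r s] r by blast
  obtain \<zeta> where \<zeta>: "s < \<zeta>" "\<zeta> < u" "g u - g s = g' \<zeta> * (u - s)" using mvt[of s u] r by auto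
  have "g' \<xi> * ((s - r) * (u - s)) \<le> g' \<zeta> * ((s - r) * (u - s))"
    using mono[of \<xi> \<zeta>] \<xi> \<zeta> r by (intro mult_right_mono) auto
  then show ?thesis using \<xi> \<zeta> by (simp add: mult_ac)
qed

text \<open>Both signs of f become convex after adding K y^2/2, so the one-sided intercept
  inequality applies twice. The right-hand side is the bias for the function -K y^2/2, which is
  therefore extremal.\<close>

lemma ols_intercept_bias:
  fixes x w :: "'i \<Rightarrow> real" and f :: "real \<Rightarrow> real"
  assumes fin: "finite J" and x: "\<And>j. j \<in> J \<Longrightarrow> 0 \<le> x j"
    and w: "\<And>j. j \<in> J \<Longrightarrow> w j = a + b * x j"
    and one: "(\<Sum>j\<in>J. w j) = 1" and zero: "(\<Sum>j\<in>J. w j * x j) = 0"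
    and f: "lipschitz_deriv_on K {0..} f"
  shows "\<bar>(\<Sum>j\<in>J. w j * f (x j)) - f 0\<bar> \<le> - (K / 2) * (\<Sum>j\<in>J. w j * (x j)\<^sup>2)"
proof -
  have *: "\<sigma> * (\<Sum>j\<in>J. w j * f (x j)) + K / 2 * (\<Sum>j\<in>J. w j * (x j)\<^sup>2) \<le> \<sigma> * f 0"
    if "\<bar>\<sigma>\<bar> = 1" for \<sigma>
  proof -
    have "(\<Sum>j\<in>J. w j * (\<sigma> * f (x j) + K / 2 * (x j)\<^sup>2)) \<le> \<sigma> * f 0 + K / 2 * 0\<^sup>2"
      by (rule ols_intercept_le[where f = "\<lambda>y. \<sigma> * f y + K / 2 * y\<^sup>2",
            OF fin x w one zero lipschitz_deriv_chord[OF f that]])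
    then show ?thesis
      by (simp add: distrib_left sum.distrib sum_distrib_left mult_ac)
  qed
  show ?thesis using *[of 1] *[of "- 1"] by simp
qed

section \<open>The function class and the bias of the jump estimator\<close>

lemma lipschitz_deriv_on_reflect:
  assumes "lipschitz_deriv_on K {..0} f"
  shows "lipschitz_deriv_on K {0..} (\<lambda>y. f (- y))"
proof -
  obtain f' where f': "\<And>y. y \<in> {..0} \<Longrightarrow> (f has_real_derivative f' y) (at y within {..0})"
    and lip: "\<And>y z. y \<in> {..0} \<Longrightarrow> z \<in> {..0} \<Longrightarrow> \<bar>f' y - f' z\<bar> \<le> K * \<bar>y - z\<bar>"
    using assms unfolding lipschitz_deriv_on_def by blast
  show ?thesis unfolding lipschitz_deriv_on_def
  proof (intro exI[of _ "\<lambda>y. - f' (- y)"] conjI ballI)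
    fix y :: real assume y: "y \<in> {0..}"
    have "uminus ` {0..} = {..0::real}" by (auto simp: image_iff intro: bexI[of _ "- x" for x])
    then have "((f \<circ> uminus) has_real_derivative f' (- y) * (- 1)) (at y within {0..})"
      using y by (intro DERIV_image_chain f'[of "- y", simplified]) (auto intro!: derivative_eq_intros f')
    then show "((\<lambda>y. f (- y)) has_real_derivative - f' (- y)) (at y within {0..})"
      by (simp add: comp_def)
  next
    fix y z :: real assume "y \<in> {0..}" "z \<in> {0..}"
    then show "\<bar>- f' (- y) - - f' (- z)\<bar> \<le> K * \<bar>y - z\<bar>" using lip[of "- y" "- z"] by (simp add: abs_minus_commute)
  qed
qed

lemma holder_class_continuous:
  assumes "\<mu> \<in> holder_class K"
  shows "continuous_on {0..} \<mu>" and "continuous_on {..0} (left_branch \<mu>)"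
  using assms unfolding holder_class_def lipschitz_deriv_on_def
  by (auto intro: DERIV_continuous_on)

lemma jump_eq:
  assumes "\<mu> \<in> holder_class K"
  shows "jump \<mu> = \<mu> 0 - left_branch \<mu> 0"
proof -
  have "(\<mu> \<longlongrightarrow> \<mu> 0) (at 0 within {0..})"
    using holder_class_continuous(1)[OF assms] by (simp add: continuous_on_def)
  then have "(\<mu> \<longlongrightarrow> \<mu> 0) (at_right 0)"
    by (rule tendsto_within_subset) auto
  then have "Lim (at_right 0) \<mu> = \<mu> 0" by (intro tendsto_Lim) auto
  then show ?thesis by (simp add: jump_def left_branch_def)
qed

text \<open>Two continuous branches are glued at the cutoff. Measurability is needed because the
  observed law is an image measure under a map that contains \<mu>.\<close>

lemma holder_class_measurable:
  assumes "\<mu> \<in> holder_class K"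
  shows "\<mu> \<in> borel_measurable borel"
proof -
  have 1: "(\<lambda>x. indicator {0..} x *\<^sub>R \<mu> x) \<in> borel_measurable borel"
    by (rule borel_measurable_continuous_on_indicator) (auto intro: holder_class_continuous[OF assms])
  have 2: "(\<lambda>x. indicator {..0} x *\<^sub>R left_branch \<mu> x) \<in> borel_measurable borel"
    by (rule borel_measurable_continuous_on_indicator) (auto intro: holder_class_continuous[OF assms])
  have "\<mu> = (\<lambda>x. indicator {0..} x *\<^sub>R \<mu> x + indicator {..<0} x *\<^sub>R (indicator {..0} x *\<^sub>R left_branch \<mu> x))"
    by (auto simp: left_branch_def indicator_def fun_eq_iff)
  also have "\<dots> \<in> borel_measurable borel" using 1 2 by measurable
  finally show ?thesis .
qed

text \<open>The four moment conditions decouple at the cutoff: the weights on the right, and the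
  negated weights on the left, each sum to 1 and annihilate the regressor. The error is then a
  difference of two intercept errors, and the sign function collects their two bounds into one
  sum.\<close>

lemma local_linear_bias:
  fixes x w :: "'i \<Rightarrow> real"
  assumes fin: "finite J" and \<mu>: "\<mu> \<in> holder_class K"
    and w: "\<And>j. j \<in> J \<Longrightarrow> w j = v1 * indicator {0..} (x j) + v2 + v3 * x j + v4 * (indicator {0..} (x j) * x j)"
    and m1: "(\<Sum>j\<in>J. w j * indicator {0..} (x j)) = 1" and m2: "(\<Sum>j\<in>J. w j) = 0"
    and m3: "(\<Sum>j\<in>J. w j * x j) = 0" and m4: "(\<Sum>j\<in>J. w j * (indicator {0..} (x j) * x j)) = 0"
  shows "\<bar>(\<Sum>j\<in>J. w j * \<mu> (x j)) - jump \<mu>\<bar> \<le> - (K / 2) * (\<Sum>j\<in>J. w j * (x j)\<^sup>2 * sgn (x j))"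
proof -
  define P where "P = {j\<in>J. 0 \<le> x j}"
  define M where "M = {j\<in>J. x j < 0}"
  have fins: "finite P" "finite M" using fin by (auto simp: P_def M_def)
  have split: "(\<Sum>j\<in>J. g j) = (\<Sum>j\<in>P. g j) + (\<Sum>j\<in>M. g j)" for g :: "'i \<Rightarrow> real"
    using fins by (subst sum.union_disjoint[symmetric]) (auto simp: P_def M_def intro!: sum.cong)
  have Pi: "(\<Sum>j\<in>J. w j * (indicator {0..} (x j) * g j)) = (\<Sum>j\<in>P. w j * g j)" for g
    unfolding split by (simp add: P_def M_def)
  have P1: "(\<Sum>j\<in>P. w j) = 1" using m1 Pi[of "\<lambda>_. 1"] by simp
  have P2: "(\<Sum>j\<in>P. w j * x j) = 0" using m4 Pi[of x] by simp
  have M1: "(\<Sum>j\<in>M. - w j) = 1" using m2 P1 by (simp add: split sum_negf)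
  have M2: "(\<Sum>j\<in>M. - w j * - x j) = 0" using m3 P2 by (simp add: split)
  have R: "\<bar>(\<Sum>j\<in>P. w j * \<mu> (x j)) - \<mu> 0\<bar> \<le> - (K / 2) * (\<Sum>j\<in>P. w j * (x j)\<^sup>2)"
  proof (rule ols_intercept_bias[OF fins(1) _ _ P1 P2, where a = "v1 + v2" and b = "v3 + v4"])
    show "lipschitz_deriv_on K {0..} \<mu>" using \<mu> by (simp add: holder_class_def)
  qed (auto simp: P_def w algebra_simps)
  \<comment> \<open>The left side is reflected to the right. In the reflected regressor y = -x the
    negated weight is -v2 + v3 y, which gives the coefficients used below.\<close>
  have L: "\<bar>(\<Sum>j\<in>M. - w j * left_branch \<mu> (- (- x j))) - left_branch \<mu> (- 0)\<bar> \<le>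
      - (K / 2) * (\<Sum>j\<in>M. - w j * (- x j)\<^sup>2)"
  proof (rule ols_intercept_bias[OF fins(2) _ _ M1 M2, where a = "- v2" and b = v3])
    show "lipschitz_deriv_on K {0..} (\<lambda>y. left_branch \<mu> (- y))"
      using \<mu> by (intro lipschitz_deriv_on_reflect) (simp add: holder_class_def)
  qed (auto simp: M_def w)
  have LM: "(\<Sum>j\<in>M. - w j * left_branch \<mu> (- (- x j))) = - (\<Sum>j\<in>M. w j * \<mu> (x j))"
    by (simp add: M_def left_branch_def flip: sum_negf)
  have Q: "(\<Sum>j\<in>J. w j * (x j)\<^sup>2 * sgn (x j)) = (\<Sum>j\<in>P. w j * (x j)\<^sup>2) + (\<Sum>j\<in>M. - w j * (- x j)\<^sup>2)"
    unfolding split by (intro arg_cong2[where f = "(+)"] sum.cong) (auto simp: P_def M_def sgn_if)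
  have "(\<Sum>j\<in>J. w j * \<mu> (x j)) - jump \<mu> =
      ((\<Sum>j\<in>P. w j * \<mu> (x j)) - \<mu> 0) - (- (\<Sum>j\<in>M. w j * \<mu> (x j)) - left_branch \<mu> 0)"
    unfolding split jump_eq[OF \<mu>] by simp
  also have "\<bar>\<dots>\<bar> \<le> \<bar>(\<Sum>j\<in>P. w j * \<mu> (x j)) - \<mu> 0\<bar> + \<bar>- (\<Sum>j\<in>M. w j * \<mu> (x j)) - left_branch \<mu> 0\<bar>"
    by (rule abs_triangle_ineq4)
  also have "\<dots> \<le> - (K / 2) * (\<Sum>j\<in>P. w j * (x j)\<^sup>2) + - (K / 2) * (\<Sum>j\<in>M. - w j * (- x j)\<^sup>2)"
    using L unfolding LM minus_zero by (intro add_mono R)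
  finally show ?thesis unfolding Q distrib_left .
qed

section \<open>Matrix inversion\<close>

lemma matrix_inv_mult:
  fixes A :: "real^'n^'n"
  assumes "det A \<noteq> 0"
  shows "A ** matrix_inv A = mat 1" "matrix_inv A ** A = mat 1"
proof -
  have "invertible A" using assms by (simp add: invertible_det_nz)
  then have "\<exists>A'. A ** A' = mat 1 \<and> A' ** A = mat 1" by (simp add: invertible_def)
  then have "A ** matrix_inv A = mat 1 \<and> matrix_inv A ** A = mat 1"
    unfolding matrix_inv_def by (rule someI_ex)
  then show "A ** matrix_inv A = mat 1" "matrix_inv A ** A = mat 1" by auto
qed

lemma matrix_inv_vector_eq_iff:
  fixes A :: "real^'n^'n"
  assumes "det A \<noteq> 0"
  shows "matrix_inv A *v b = u \<longleftrightarrow> A *v u = b"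
  using matrix_inv_mult[OF assms] by (metis matrix_vector_mul_assoc matrix_vector_mul_lid)

text \<open>Cramer's rule displays the solution as a rational function of the matrix entries, the
  form from which both measurability and continuity are derived.\<close>

lemma matrix_inv_cramer:
  fixes A :: "real^'n^'n"
  assumes "det A \<noteq> 0"
  shows "matrix_inv A *v b = (\<chi> k. det (\<chi> i j. if j = k then b $ i else A $ i $ j) / det A)"
  using cramer[OF assms, of "matrix_inv A *v b" b] matrix_inv_vector_eq_iff[OF assms, of b "matrix_inv A *v b"]
  by simp

text \<open>For a singular matrix \<open>matrix_inv\<close> is \<open>SOME\<close> of an empty predicate, hence one fixed matrix; this keeps
  it measurable without assuming invertibility.\<close>

lemma matrix_inv_singular:
  fixes A B :: "real^'n^'n"
  assumes "det A = 0" "det B = 0"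
  shows "matrix_inv A = matrix_inv B"
proof -
  have "\<not> (A ** A' = mat 1 \<and> A' ** A = mat 1)" "\<not> (B ** A' = mat 1 \<and> A' ** B = mat 1)" for A'
    using assms by (metis invertible_def invertible_det_nz)+
  then have "(\<lambda>A'. A ** A' = mat 1 \<and> A' ** A = mat 1) = (\<lambda>A'. B ** A' = mat 1 \<and> A' ** B = mat 1)"
    by blast
  then show ?thesis unfolding matrix_inv_def by (rule arg_cong)
qed

lemma measurable_det:
  fixes F :: "'a \<Rightarrow> real^'n^'n"
  assumes "\<And>i j. (\<lambda>x. F x $ i $ j) \<in> borel_measurable M"
  shows "(\<lambda>x. det (F x)) \<in> borel_measurable M"
  unfolding det_def using assms by (intro borel_measurable_sum borel_measurable_times borel_measurable_prod) auto

lemma measurable_matrix_inv: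
  fixes F :: "'a \<Rightarrow> real^'n^'n"
  assumes F: "\<And>i j. (\<lambda>x. F x $ i $ j) \<in> borel_measurable M"
  shows "(\<lambda>x. matrix_inv (F x) $ i $ k) \<in> borel_measurable M"
proof -
  have comp: "matrix_inv A $ i $ k = (if det A = 0 then matrix_inv 0 $ i $ k else
      det (\<chi> l j. if j = i then axis k 1 $ l else A $ l $ j) / det A)" for A :: "real^'n^'n"
  proof (cases "det A = 0")
    case True
    then have "matrix_inv A = matrix_inv 0" by (intro matrix_inv_singular) (auto intro!: det_zero_row(1) simp: row_def vec_eq_iff)
    then show ?thesis using True by simp
  next
    case False
    have "matrix_inv A $ i $ k = (matrix_inv A *v axis k 1) $ i"
      by (simp add: matrix_vector_mult_basis column_def)
    then show ?thesis using False by (simp add: matrix_inv_cramer)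
  qed
  have [measurable]: "(\<lambda>x. det (F x)) \<in> borel_measurable M" by (rule measurable_det[OF F])
  have [measurable]: "(\<lambda>x. det (\<chi> l j. if j = i then axis k 1 $ l else F x $ l $ j)) \<in> borel_measurable M"
    by (rule measurable_det) (use F in simp)
  show ?thesis unfolding comp[of "F _"] by measurable
qed

text \<open>Determinants are polynomials in the entries, so Cramer's formula is continuous where the
  determinant does not vanish. Closeness is measured entrywise because the sample matrices are
  controlled entry by entry.\<close>

lemma matrix_inv_vector_continuous:
  fixes A0 :: "real^'n^'n"
  assumes d0: "det A0 \<noteq> 0" and e: "0 < e"
  shows "\<exists>\<gamma>>0. \<forall>A. (\<forall>i j. \<bar>A $ i $ j - A0 $ i $ j\<bar> \<le> \<gamma>) \<longrightarrow>
    det A \<noteq> 0 \<and> (\<forall>k. \<bar>(matrix_inv A *v b) $ k - (matrix_inv A0 *v b) $ k\<bar> \<le> e)"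
proof -
  have cd: "isCont (\<lambda>A. det (G A)) A0" if "\<And>i j. isCont (\<lambda>A. G A $ i $ j) A0" for G :: "real^'n^'n \<Rightarrow> real^'n^'n"
    unfolding det_def by (intro continuous_sum continuous_mult continuous_const continuous_prod that)
  have c1: "isCont det A0" by (rule cd) (intro continuous_intros)
  have c2: "isCont (\<lambda>A. \<chi> k. det (\<chi> i j. if j = k then b $ i else A $ i $ j) / det A) A0"
  proof -
    have "isCont (\<lambda>A. det (\<chi> i j. if j = k then b $ i else A $ i $ j)) A0" for k
    proof (rule cd)
      fix i j
      show "isCont (\<lambda>A. (\<chi> i j. if j = k then b $ i else A $ i $ j) $ i $ j) A0"
        by (cases "j = k") auto
    qed
    then show ?thesis
      using c1 d0 unfolding isCont_def by (intro tendsto_vec_lambda tendsto_divide) auto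
  qed
  have "eventually (\<lambda>A. det A \<noteq> 0 \<and>
      dist (\<chi> k. det (\<chi> i j. if j = k then b $ i else A $ i $ j) / det A)
        (\<chi> k. det (\<chi> i j. if j = k then b $ i else A0 $ i $ j) / det A0) < e) (nhds A0)"
  proof (intro eventually_conj)
    show "eventually (\<lambda>A. det A \<noteq> 0) (nhds A0)"
      using c1 d0 by (intro tendsto_imp_eventually_ne) (auto simp: isCont_def tendsto_at_iff_tendsto_nhds)
    show "eventually (\<lambda>A. dist (\<chi> k. det (\<chi> i j. if j = k then b $ i else A $ i $ j) / det A)
        (\<chi> k. det (\<chi> i j. if j = k then b $ i else A0 $ i $ j) / det A0) < e) (nhds A0)"
      by (rule tendstoD[OF iffD1[OF tendsto_at_iff_tendsto_nhds c2[unfolded isCont_def]] e])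
  qed
  then obtain r where r: "0 < r" and near: "\<And>A. dist A A0 < r \<Longrightarrow> det A \<noteq> 0 \<and>
      dist (\<chi> k. det (\<chi> i j. if j = k then b $ i else A $ i $ j) / det A)
        (\<chi> k. det (\<chi> i j. if j = k then b $ i else A0 $ i $ j) / det A0) < e"
    unfolding eventually_nhds_metric by blast
  define n where "n = real CARD('n)"
  have n: "1 \<le> n" by (simp add: n_def Suc_leI)
  show ?thesis
  \<comment> \<open>The distance of two matrices is at most the sum of the n^2 entrywise distances,
    here r/2.\<close>
  proof (intro exI[of _ "r / (2 * n * n)"] conjI allI impI)
    show "0 < r / (2 * n * n)" using r n by simp
    fix A assume A: "\<forall>i j. \<bar>A $ i $ j - A0 $ i $ j\<bar> \<le> r / (2 * n * n)"
    have "dist A A0 \<le> (\<Sum>i\<in>UNIV. norm ((A - A0) $ i))"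
      unfolding dist_norm norm_vec_def[of "A - A0"] by (rule L2_set_le_sum) simp
    also have "\<dots> \<le> (\<Sum>i\<in>UNIV. \<Sum>j\<in>UNIV. \<bar>(A - A0) $ i $ j\<bar>)"
      by (intro sum_mono norm_le_l1_cart)
    also have "\<dots> \<le> (\<Sum>(i::'n)\<in>UNIV. \<Sum>(j::'n)\<in>UNIV. r / (2 * n * n))"
      using A by (intro sum_mono) simp
    also have "\<dots> = r / 2" using n by (simp add: n_def)
    also have "\<dots> < r" using r by simp
    finally have near': "det A \<noteq> 0" "dist (matrix_inv A *v b) (matrix_inv A0 *v b) < e"
      using near[of A] d0 by (auto simp: matrix_inv_cramer)
    show "det A \<noteq> 0" by (rule near'(1))
    fix k
    have "\<bar>(matrix_inv A *v b - matrix_inv A0 *v b) $ k\<bar> \<le> norm (matrix_inv A *v b - matrix_inv A0 *v b)"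
      by (rule component_le_norm_cart)
    then show "\<bar>(matrix_inv A *v b) $ k - (matrix_inv A0 *v b) $ k\<bar> \<le> e"
      using near'(2) by (simp add: dist_norm)
  qed
qed

section \<open>The estimator as a weighted sum\<close>

lemma regr_pos: "0 < h \<Longrightarrow> 0 < regr h $ k"
  using exhaust_4[of k] by auto

lemma regr_scale: "0 < h \<Longrightarrow> regr (x / h) $ k = regr x $ k / regr h $ k"
  using exhaust_4[of k] by (auto simp: indicator_def zero_le_divide_iff)

lemma regr_scale_bound: "0 < h \<Longrightarrow> \<bar>x\<bar> \<le> h \<Longrightarrow> \<bar>regr (x / h) $ k\<bar> \<le> 1"
  using exhaust_4[of k] by (auto simp: indicator_def abs_mult)

text \<open>For positive \<open>h\<close> this is \<open>A\<close> multiplied from both sides by the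
  inverse of \<open>scale_mat h\<close>; the entrywise form spares computations with an abstract
  inverse.\<close>

definition diag_scale :: "real \<Rightarrow> real ^ 4 ^ 4 \<Rightarrow> real ^ 4 ^ 4" where
  "diag_scale h A = (\<chi> i j. A $ i $ j / (regr h $ i * regr h $ j))"

lemma matrix_inv_eqI:
  fixes A B :: "real^'n^'n"
  assumes "A ** B = mat 1"
  shows "matrix_inv A = B"
proof -
  have "det A * det B = 1" using assms det_mul[of A B] by (simp add: det_I)
  then have "det A \<noteq> 0" by auto
  then show ?thesis using matrix_inv_mult assms by (metis matrix_mul_assoc matrix_mul_lid matrix_mul_rid)
qed

lemma diag_scale_eq:
  assumes "0 < h"
  shows "matrix_inv (scale_mat h) ** A ** matrix_inv (scale_mat h) = diag_scale h A"
proof -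
  define B :: "real^4^4" where "B = (\<chi> i j. if i = j then 1 / regr h $ i else 0)"
  have left: "((\<chi> i j. if i = j then r i else 0) ** C) $ i $ j = r i * C $ i $ j"
    for r :: "4 \<Rightarrow> real" and C :: "real^4^4" and i j
  proof -
    have "((\<chi> i j. if i = j then r i else 0) ** C) $ i $ j = (\<Sum>k\<in>UNIV. if k = i then r i * C $ i $ j else 0)"
      unfolding matrix_matrix_mult_def by (simp only: vec_lambda_beta) (intro sum.cong refl, simp)
    then show ?thesis by simp
  qed
  have right: "(C ** (\<chi> i j. if i = j then r i else 0)) $ i $ j = C $ i $ j * r j"
    for r :: "4 \<Rightarrow> real" and C :: "real^4^4" and i j
  proof -
    have "(C ** (\<chi> i j. if i = j then r i else 0)) $ i $ j = (\<Sum>k\<in>UNIV. if k = j then C $ i $ j * r j else 0)"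
      unfolding matrix_matrix_mult_def by (simp only: vec_lambda_beta) (intro sum.cong refl, simp)
    then show ?thesis by simp
  qed
  have "scale_mat h ** B = mat 1"
  proof -
    have "(scale_mat h ** B) $ i $ j = mat 1 $ i $ j" for i j
      using regr_pos[OF assms, of i] unfolding scale_mat_def left
      by (cases "i = j") (auto simp: B_def mat_def)
    then show ?thesis by (simp add: vec_eq_iff)
  qed
  then have inv: "matrix_inv (scale_mat h) = B" by (rule matrix_inv_eqI)
  have "(B ** A ** B) $ i $ j = diag_scale h A $ i $ j" for i j
    unfolding B_def right left by (simp add: diag_scale_def)
  then show ?thesis unfolding inv by (simp add: vec_eq_iff)
qed

lemma det_diag_scale_nonzero:
  assumes h: "0 < h" and d: "det (diag_scale h A) \<noteq> 0"
  shows "det A \<noteq> 0"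
  using d unfolding diag_scale_eq[OF h, symmetric] by (simp add: det_mul)

text \<open>If A v = e1 and H is the diagonal scaling, the scaled matrix sends H v to the inverse of
  H applied to e1. That is e1 again, because the first diagonal entry of H is the indicator of a
  nonnegative argument, hence 1.\<close>

lemma diag_scale_inv_e1:
  assumes h: "0 < h" and d: "det (diag_scale h A) \<noteq> 0"
  shows "(matrix_inv (diag_scale h A) *v e1) $ k = regr h $ k * (matrix_inv A *v e1) $ k"
proof -
  define v where "v = matrix_inv A *v e1"
  have Av: "A *v v = e1"
    unfolding v_def using matrix_inv_vector_eq_iff[OF det_diag_scale_nonzero[OF h d]] by blast
  have "(diag_scale h A *v (\<chi> k. regr h $ k * v $ k)) $ i = e1 $ i" for i
  proof -
    have "(diag_scale h A *v (\<chi> k. regr h $ k * v $ k)) $ i = (\<Sum>j\<in>UNIV. A $ i $ j * v $ j) / regr h $ i"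
      using regr_pos[OF h, THEN less_imp_neq]
      by (simp add: matrix_vector_mult_def diag_scale_def sum_divide_distrib)
    also have "\<dots> = e1 $ i / regr h $ i"
      using arg_cong[OF Av, of "\<lambda>x. x $ i"] by (simp add: matrix_vector_mult_def)
    also have "\<dots> = e1 $ i"
      using h exhaust_4[of i] by (auto simp: e1_def axis_def)
    finally show ?thesis .
  qed
  then have "diag_scale h A *v (\<chi> k. regr h $ k * v $ k) = e1" by (simp add: vec_eq_iff)
  then have "matrix_inv (diag_scale h A) *v e1 = (\<chi> k. regr h $ k * v $ k)"
    using matrix_inv_vector_eq_iff[OF d] by blast
  then show ?thesis by (simp add: v_def)
qed

text \<open>Coefficients and regressors scale inversely, so the weights can be computed in the units
  x/h. In these units the population matrices have an invertible limit, whereas the unscaled entries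
  that involve x vanish together with h.\<close>

lemma scaled_inner:
  assumes h: "0 < h" and d: "det (diag_scale h A) \<noteq> 0"
  shows "(matrix_inv A *v e1) \<bullet> regr x = (matrix_inv (diag_scale h A) *v e1) \<bullet> regr (x / h)"
  using regr_pos[OF h, THEN less_imp_neq] by (simp add: inner_vec_def diag_scale_inv_e1[OF h d] regr_scale[OF h])

section \<open>Quadratic forms, weights and the standard error\<close>

lemma transpose_matrix_inv_symmetric:
  fixes A :: "real^'n^'n"
  assumes "det A \<noteq> 0" "transpose A = A"
  shows "transpose (matrix_inv A) = matrix_inv A"
proof -
  have "transpose (matrix_inv A ** A) = mat 1"
    by (simp add: matrix_inv_mult[OF assms(1)] transpose_mat)
  then have "A ** transpose (matrix_inv A) = mat 1"
    by (simp add: matrix_transpose_mul assms(2))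
  then show ?thesis using matrix_inv_eqI by metis
qed

lemma inner_symmetric_matrix:
  fixes A :: "real^'n^'n"
  assumes "transpose A = A"
  shows "x \<bullet> (A *v y) = (A *v x) \<bullet> y"
  using dot_lmul_matrix[of x A y] vector_transpose_matrix[of x A] assms by metis

text \<open>Linearity in the matrix lets the form pass through sums and integrals of outer products,
  where it becomes a square.\<close>

lemma linear_quadratic_form: "linear (\<lambda>A :: real^'n^'n. v \<bullet> (A *v v))"
  by (rule linearI)
     (simp_all add: inner_vec_def matrix_vector_mult_def distrib_left distrib_right sum.distrib sum_distrib_left mult_ac)

lemma quadratic_form_outer: "v \<bullet> (outer m *v v) = (v \<bullet> m)\<^sup>2"
  unfolding power2_eq_square inner_vec_def matrix_vector_mult_def outer_def
  by (simp add: sum_product sum_distrib_left mult_ac)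

lemma sandwich_form:
  fixes P S :: "real^'n^'n"
  assumes "transpose P = P"
  shows "x \<bullet> ((P ** S ** P) *v x) = (P *v x) \<bullet> (S *v (P *v x))"
  by (simp add: inner_symmetric_matrix[OF assms] flip: matrix_vector_mul_assoc)

lemma transpose_Q_hat: "transpose (Q_hat N h d) = Q_hat N h d"
  by (simp add: Q_hat_def transpose_def vec_eq_iff outer_def mult.commute)

lemma Q_hat_nth:
  "Q_hat N h d $ k $ j = 1 / real (N_window N h d) *
    (\<Sum>i=1..N. indicator {- h..h} (fst (d i)) * (regr (fst (d i)) $ k * regr (fst (d i)) $ j))"
proof -
  have "outer (window_regr h x) $ k $ j = indicator {- h..h} x * (regr x $ k * regr x $ j)" for x
    by (simp add: outer_def window_regr_def indicator_def)
  then show ?thesis by (simp add: Q_hat_def)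
qed

text \<open>The first column of the inverse Gram matrix. In the nonsingular case it is also the
  first row, by symmetry, so the weights are its inner products with the regressors, divided by the
  window count.\<close>

definition ols_coef :: "nat \<Rightarrow> real \<Rightarrow> (nat \<Rightarrow> real \<times> real) \<Rightarrow> real ^ 4" where
  "ols_coef N h d = matrix_inv (Q_hat N h d) *v e1"

lemma weight_eq:
  assumes "det (Q_hat N h d) \<noteq> 0"
  shows "weight N h d x = 1 / real (N_window N h d) * (indicator {- h..h} x * (ols_coef N h d \<bullet> regr x))"
  unfolding weight_def window_regr_def ols_coef_def
  using inner_symmetric_matrix[OF transpose_matrix_inv_symmetric[OF assms transpose_Q_hat]]
  by simp

lemma tau_hat_eq: "tau_hat N h d = (\<Sum>i=1..N. weight N h d (fst (d i)) * snd (d i))"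
  by (simp add: tau_hat_def theta_hat_def weight_def matrix_vector_mult_scaleR
      linear_sum[OF matrix_vector_mul_linear] inner_sum_right sum_distrib_left mult_ac
      linear_scale[OF matrix_vector_mul_linear] del: vector_scaleR_matrix_ac)

text \<open>These are the normal equations for \<open>ols_coef\<close>, read entry by entry: the
  estimator reproduces the jump of every function that is linear on each side of the cutoff.\<close>

lemma weight_moments:
  assumes "det (Q_hat N h d) \<noteq> 0"
  shows "(\<Sum>i=1..N. weight N h d (fst (d i)) * regr (fst (d i)) $ k) = e1 $ k"
proof -
  have "Q_hat N h d *v ols_coef N h d = e1"
    using matrix_inv_vector_eq_iff[OF assms] by (auto simp: ols_coef_def)
  then have "e1 $ k = (Q_hat N h d *v ols_coef N h d) $ k" by simp
  also have "\<dots> = (\<Sum>j\<in>UNIV. 1 / real (N_window N h d) * (\<Sum>i=1..N.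
      indicator {- h..h} (fst (d i)) * (regr (fst (d i)) $ k * (regr (fst (d i)) $ j * ols_coef N h d $ j))))"
    by (simp only: matrix_vector_mult_def vec_lambda_beta Q_hat_nth mult.assoc sum_distrib_right)
  also have "\<dots> = (\<Sum>i=1..N. weight N h d (fst (d i)) * regr (fst (d i)) $ k)"
    unfolding weight_eq[OF assms] inner_vec_def sum_distrib_left sum_distrib_right
    by (subst sum.swap) (simp add: mult_ac)
  finally show ?thesis by simp
qed

text \<open>By symmetry the sandwich is a quadratic form at \<open>ols_coef\<close>, and each outer
  product contributes a squared inner product. The window counts in \<open>Omega_NN\<close> and in
  \<open>std_err\<close> supply the square of the one inside the weight.\<close>

lemma std_err_eq:
  assumes "det (Q_hat N h d) \<noteq> 0"
  shows "std_err D N h d = sqrt (\<Sum>x\<in>window_points D h.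
    real (cell_count N d x) * cell_var N d x * (weight N h d x)\<^sup>2)"
proof -
  let ?v = "ols_coef N h d" and ?n = "real (N_window N h d)"
  have "e1 \<bullet> ((matrix_inv (Q_hat N h d) ** Omega_NN D N h d ** matrix_inv (Q_hat N h d)) *v e1) =
      ?v \<bullet> (Omega_NN D N h d *v ?v)"
    unfolding ols_coef_def
    by (rule sandwich_form[OF transpose_matrix_inv_symmetric[OF assms transpose_Q_hat]])
  also have "\<dots> = 1 / ?n * (\<Sum>x\<in>window_points D h.
      real (cell_count N d x) * cell_var N d x * (?v \<bullet> regr x)\<^sup>2)"
    unfolding Omega_NN_def
    by (simp add: linear_scale[OF linear_quadratic_form] linear_sum[OF linear_quadratic_form]
        quadratic_form_outer)
  finally have "std_err D N h d = sqrt ((1 / ?n * (\<Sum>x\<in>window_points D h.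
      real (cell_count N d x) * cell_var N d x * (?v \<bullet> regr x)\<^sup>2)) / ?n)"
    unfolding std_err_def sigma_NN_def by (simp add: real_sqrt_divide)
  also have "(1 / ?n * (\<Sum>x\<in>window_points D h.
      real (cell_count N d x) * cell_var N d x * (?v \<bullet> regr x)\<^sup>2)) / ?n =
      (\<Sum>x\<in>window_points D h. real (cell_count N d x) * cell_var N d x * (weight N h d x)\<^sup>2)"
    unfolding sum_distrib_left sum_divide_distrib
  proof (intro sum.cong refl)
    fix x assume "x \<in> window_points D h"
    then have "x \<in> {- h..h}" by (auto simp: window_points_def)
    then show "1 / ?n * (real (cell_count N d x) * cell_var N d x * (?v \<bullet> regr x)\<^sup>2) / ?n =
        real (cell_count N d x) * cell_var N d x * (weight N h d x)\<^sup>2"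
      by (simp add: weight_eq[OF assms] power2_eq_square)
  qed
  finally show ?thesis .
qed

text \<open>The common mean cancels. With S the sum and Q the sum of squares of the errors, the
  centred sum of squares is Q - S^2/n, and n/(n - 1) times it equals Q - (S^2 - Q)/(n - 1), where
  S^2 - Q is the off-diagonal sum.\<close>

lemma cell_variance_identity:
  fixes e Y :: "'i \<Rightarrow> real"
  assumes fin: "finite C" and n: "n = real (card C)" "2 \<le> n" and Y: "\<And>i. i \<in> C \<Longrightarrow> Y i = m + e i"
  shows "n * ((\<Sum>i\<in>C. (Y i - (\<Sum>i\<in>C. Y i) / n)\<^sup>2) / (n - 1)) =
    (\<Sum>i\<in>C. (e i)\<^sup>2) - (\<Sum>i\<in>C. \<Sum>j\<in>C. if i \<noteq> j then e i * e j / (n - 1) else 0)"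
proof -
  define S where "S = (\<Sum>i\<in>C. e i)"
  define Q where "Q = (\<Sum>i\<in>C. (e i)\<^sup>2)"
  have "(\<Sum>i\<in>C. Y i) = n * m + S" using Y by (simp add: sum.distrib S_def n(1))
  then have "(\<Sum>i\<in>C. (Y i - (\<Sum>i\<in>C. Y i) / n)\<^sup>2) = (\<Sum>i\<in>C. (e i - S / n)\<^sup>2)"
    using n(2) Y by (intro sum.cong refl) (simp add: add_divide_distrib)
  also have "\<dots> = (\<Sum>i\<in>C. (e i)\<^sup>2 - 2 * (S / n) * e i + (S / n)\<^sup>2)"
    by (intro sum.cong refl) (simp add: power2_diff mult_ac)
  also have "\<dots> = Q - 2 * (S / n) * S + n * (S / n)\<^sup>2"
    by (simp only: sum.distrib sum_subtractf sum_distrib_left[symmetric] sum_constant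
        Q_def[symmetric] S_def[symmetric] n(1)[symmetric])
  also have "\<dots> = Q - S\<^sup>2 / n" using n(2) by (simp add: power2_eq_square)
  finally have var: "(\<Sum>i\<in>C. (Y i - (\<Sum>i\<in>C. Y i) / n)\<^sup>2) = Q - S\<^sup>2 / n" .
  have "(\<Sum>i\<in>C. \<Sum>j\<in>C. if i \<noteq> j then e i * e j / (n - 1) else 0) =
      (\<Sum>i\<in>C. \<Sum>j\<in>C. e i * e j / (n - 1) - (if j = i then e i * e i / (n - 1) else 0))"
    by (intro sum.cong refl) auto
  also have "\<dots> = S\<^sup>2 / (n - 1) - Q / (n - 1)"
    using fin unfolding sum_subtractf
    by (simp add: S_def Q_def power2_eq_square sum_product flip: sum_divide_distrib)
  finally have off: "(\<Sum>i\<in>C. \<Sum>j\<in>C. if i \<noteq> j then e i * e j / (n - 1) else 0) =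
      S\<^sup>2 / (n - 1) - Q / (n - 1)" .
  have "n * (Q - S\<^sup>2 / n) = (n - 1) * Q + Q - S\<^sup>2" using n(2) by (simp add: algebra_simps)
  then have "n * ((Q - S\<^sup>2 / n) / (n - 1)) = ((n - 1) * Q + Q - S\<^sup>2) / (n - 1)" by simp
  also have "\<dots> = Q - (S\<^sup>2 / (n - 1) - Q / (n - 1))"
    using n(2) by (simp add: add_divide_distrib diff_divide_distrib)
  finally show ?thesis unfolding var off by (simp add: Q_def)
qed

text \<open>Within a cell of \<open>n\<close> observations with weight \<open>w\<close>, the variance estimator is
  \<open>w\<^sup>2 (\<Sum> \<epsilon>\<^sub>i\<^sup>2 - \<Sum>\<^sub>i\<^sub>\<noteq>\<^sub>j \<epsilon>\<^sub>i \<epsilon>\<^sub>j / (n - 1))\<close>.\<close>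

definition nn_coef :: "nat \<Rightarrow> real \<Rightarrow> (nat \<Rightarrow> real \<times> real) \<Rightarrow> nat \<Rightarrow> nat \<Rightarrow> real" where
  "nn_coef N h d i j = (if i \<noteq> j \<and> fst (d i) = fst (d j)
    then (weight N h d (fst (d i)))\<^sup>2 / (real (cell_count N d (fst (d i))) - 1) else 0)"

text \<open>The regression function \<open>m\<close> is constant within a cell, so the standard
  error depends on the errors and the design alone. For the second claim, a row of the coefficient
  matrix that belongs to a cell of size n in the window has n - 1 entries w^2/(n - 1), whose squares
  sum to w^4/(n - 1); two observations per cell suffice for the bound.\<close>

lemma std_err_quadratic_form:
  assumes D: "finite (x_support D)" and det: "det (Q_hat N h d) \<noteq> 0"
    and supp: "\<And>i. i \<in> {1..N} \<Longrightarrow> fst (d i) \<in> x_support D"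
    and cells: "\<And>x. x \<in> window_points D h \<Longrightarrow> 2 \<le> cell_count N d x"
    and Y: "\<And>i. i \<in> {1..N} \<Longrightarrow> snd (d i) = m (fst (d i)) + e i"
  defines "w \<equiv> \<lambda>i. weight N h d (fst (d i))"
  defines "c \<equiv> nn_coef N h d"
  shows "std_err D N h d = sqrt ((\<Sum>i=1..N. (w i)\<^sup>2 * (e i)\<^sup>2) -
      (\<Sum>i=1..N. \<Sum>j=1..N. c i j * (e i * e j)))"
    and "(\<Sum>i=1..N. \<Sum>j=1..N. (c i j)\<^sup>2) \<le> (\<Sum>i=1..N. w i ^ 4)"
proof -
  have c_eq: "c i j = (if i \<noteq> j \<and> fst (d i) = fst (d j)
    then (w i)\<^sup>2 / (real (cell_count N d (fst (d i))) - 1) else 0)" for i j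
    by (simp add: c_def nn_coef_def w_def)
  define cell where "cell x = {i \<in> {1..N}. fst (d i) = x}" for x
  have card_cell: "cell_count N d x = card (cell x)" for x by (simp add: cell_count_def cell_def)
  have w0: "w i = 0" if "i \<in> {1..N}" "fst (d i) \<notin> window_points D h" for i
    using that supp[of i] by (auto simp: w_def weight_eq[OF det] window_points_def indicator_def)
  have finW: "finite (window_points D h)" using D by (simp add: window_points_def)
  have group: "(\<Sum>x\<in>window_points D h. \<Sum>i\<in>cell x. g i) = (\<Sum>i=1..N. g i)"
    if "\<And>i. i \<in> {1..N} \<Longrightarrow> fst (d i) \<notin> window_points D h \<Longrightarrow> g i = 0" for g :: "nat \<Rightarrow> real"
  proof -
    have "(\<Sum>i=1..N. g i) = (\<Sum>i\<in>{i\<in>{1..N}. fst (d i) \<in> window_points D h}. g i)"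
      using that by (intro sum.mono_neutral_right) auto
    also have "\<dots> = (\<Sum>x\<in>window_points D h.
        \<Sum>i\<in>{i\<in>{i\<in>{1..N}. fst (d i) \<in> window_points D h}. fst (d i) = x}. g i)"
      using finW by (intro sum.group[symmetric]) auto
    also have "\<dots> = (\<Sum>x\<in>window_points D h. \<Sum>i\<in>cell x. g i)"
      by (intro sum.cong) (auto simp: cell_def)
    finally show ?thesis by simp
  qed
  have cell_term: "real (cell_count N d x) * cell_var N d x * (weight N h d x)\<^sup>2 =
      (\<Sum>i\<in>cell x. (w i)\<^sup>2 * (e i)\<^sup>2 - (\<Sum>j=1..N. c i j * (e i * e j)))"
    if x: "x \<in> window_points D h" for x
  proof -
    let ?n = "real (cell_count N d x)"
    have n: "?n = real (card (cell x))" "2 \<le> ?n" using cells[OF x] by (simp_all add: card_cell)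
    have "?n * cell_var N d x =
        ?n * ((\<Sum>i\<in>cell x. (snd (d i) - (\<Sum>i\<in>cell x. snd (d i)) / ?n)\<^sup>2) / (?n - 1))"
      using n(2) unfolding cell_var_def cell_mean_def cell_def by simp
    also have "\<dots> = (\<Sum>i\<in>cell x. (e i)\<^sup>2) -
        (\<Sum>i\<in>cell x. \<Sum>j\<in>cell x. if i \<noteq> j then e i * e j / (?n - 1) else 0)"
      by (rule cell_variance_identity[OF _ n, where m = "m x"]) (auto simp: cell_def Y)
    finally have "?n * cell_var N d x * (weight N h d x)\<^sup>2 = (weight N h d x)\<^sup>2 *
        ((\<Sum>i\<in>cell x. (e i)\<^sup>2) - (\<Sum>i\<in>cell x. \<Sum>j\<in>cell x. if i \<noteq> j then e i * e j / (?n - 1) else 0))"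
      by (simp only: mult.commute)
    also have "\<dots> = (\<Sum>i\<in>cell x. (weight N h d x)\<^sup>2 * (e i)\<^sup>2 -
        (\<Sum>j\<in>cell x. (weight N h d x)\<^sup>2 * (if i \<noteq> j then e i * e j / (?n - 1) else 0)))"
      by (simp only: right_diff_distrib sum_distrib_left sum_subtractf)
    also have "\<dots> = (\<Sum>i\<in>cell x. (w i)\<^sup>2 * (e i)\<^sup>2 - (\<Sum>j=1..N. c i j * (e i * e j)))"
    proof (rule sum.cong[OF refl], rule arg_cong2[where f = "(-)"])
      fix i assume i: "i \<in> cell x"
      then show "(weight N h d x)\<^sup>2 * (e i)\<^sup>2 = (w i)\<^sup>2 * (e i)\<^sup>2" by (simp add: w_def cell_def)
      show "(\<Sum>j\<in>cell x. (weight N h d x)\<^sup>2 * (if i \<noteq> j then e i * e j / (?n - 1) else 0)) =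
          (\<Sum>j=1..N. c i j * (e i * e j))"
        using i by (intro sum.mono_neutral_cong_left) (auto simp: cell_def c_eq w_def)
    qed
    finally show ?thesis .
  qed
  have "(\<Sum>x\<in>window_points D h. real (cell_count N d x) * cell_var N d x * (weight N h d x)\<^sup>2) =
      (\<Sum>x\<in>window_points D h. \<Sum>i\<in>cell x. (w i)\<^sup>2 * (e i)\<^sup>2 - (\<Sum>j=1..N. c i j * (e i * e j)))"
    by (rule sum.cong[OF refl cell_term])
  also have "\<dots> = (\<Sum>i=1..N. (w i)\<^sup>2 * (e i)\<^sup>2 - (\<Sum>j=1..N. c i j * (e i * e j)))"
  proof (rule group)
    fix i assume "i \<in> {1..N}" "fst (d i) \<notin> window_points D h"
    then have wi: "w i = 0" by (rule w0)
    then have "(\<Sum>j=1..N. c i j * (e i * e j)) = 0"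
      by (intro sum.neutral) (simp add: c_eq)
    then show "(w i)\<^sup>2 * (e i)\<^sup>2 - (\<Sum>j=1..N. c i j * (e i * e j)) = 0" by (simp add: wi)
  qed
  finally show "std_err D N h d = sqrt ((\<Sum>i=1..N. (w i)\<^sup>2 * (e i)\<^sup>2) -
      (\<Sum>i=1..N. \<Sum>j=1..N. c i j * (e i * e j)))"
    unfolding std_err_eq[OF det] by (simp add: sum_subtractf)
  show "(\<Sum>i=1..N. \<Sum>j=1..N. (c i j)\<^sup>2) \<le> (\<Sum>i=1..N. w i ^ 4)"
  proof (rule sum_mono)
    fix i assume i: "i \<in> {1..N}"
    show "(\<Sum>j=1..N. (c i j)\<^sup>2) \<le> w i ^ 4"
    proof (cases "fst (d i) \<in> window_points D h")
      case False
      then have wi: "w i = 0" by (rule w0[OF i])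
      then have "(\<Sum>j=1..N. (c i j)\<^sup>2) = 0"
        by (intro sum.neutral) (simp add: c_eq)
      then show ?thesis using wi by simp
    next
      case True
      let ?n = "real (cell_count N d (fst (d i)))"
      have n: "2 \<le> ?n" using cells[OF True] by simp
      have "(\<Sum>j=1..N. (c i j)\<^sup>2) = (\<Sum>j\<in>cell (fst (d i)) - {i}. w i ^ 4 / (?n - 1)\<^sup>2)"
        by (rule sum.mono_neutral_cong_right)
           (auto simp: c_eq cell_def power_divide simp flip: power_mult)
      also have "\<dots> = (?n - 1) * (w i ^ 4 / (?n - 1)\<^sup>2)"
      proof -
        have "i \<in> cell (fst (d i))" using i by (simp add: cell_def)
        then have "real (card (cell (fst (d i)) - {i})) = ?n - 1"
          using n by (simp add: card_cell of_nat_diff)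
        then show ?thesis by simp
      qed
      also have "\<dots> = w i ^ 4 / (?n - 1)" using n by (simp add: power2_eq_square)
      also have "\<dots> \<le> w i ^ 4 / 1" using n by (intro divide_left_mono) auto
      finally show ?thesis by simp
    qed
  qed
qed

section \<open>Measurability of the coverage event\<close>

lemma regr_measurable [measurable]: "(\<lambda>x. regr x $ k) \<in> borel_measurable borel"
  using exhaust_4[of k] by (elim disjE) (simp_all, measurable)

lemma Phi_measurable [measurable]: "Phi \<in> borel_measurable borel"
  by (intro borel_measurable_continuous_onI continuous_at_imp_continuous_on ballI Phi_isCont)

text \<open>Sums over sample-dependent index sets become sums over a fixed set with conditional
  terms, whose measurability can be checked term by term.\<close>

lemma sum_window_filter:
  "(\<Sum>i | i \<in> {1..N::nat} \<and> P i. f i) = (\<Sum>i=1..N. if P i then f i else (0::real))"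
  by (rule sum.mono_neutral_cong_left) auto

lemma card_filter_eq_sum:
  "real (card {i \<in> {1..N::nat}. P i}) = (\<Sum>i=1..N. if P i then 1 else 0)"
  by (subst sum.inter_filter[symmetric]) simp_all

lemma cell_var_eq:
  "cell_var N d x =
    (if real (cell_count N d x) \<le> 1 then 0
     else (\<Sum>i=1..N. if fst (d i) = x then
         (snd (d i) - (\<Sum>i=1..N. if fst (d i) = x then snd (d i) else 0) / real (cell_count N d x))\<^sup>2 else 0) /
       (real (cell_count N d x) - 1))"
  unfolding cell_var_def cell_mean_def sum_window_filter[symmetric] by simp

lemma weight_components:
  "weight N h d x = 1 / real (N_window N h d) *
    (\<Sum>k\<in>UNIV. matrix_inv (Q_hat N h d) $ 1 $ k * (indicator {- h..h} x * regr x $ k))"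
  by (simp add: weight_def e1_def inner_axis' matrix_vector_mult_def window_regr_def)

lemma sigma_NN_components:
  "sigma_NN D N h d = sqrt (\<Sum>b\<in>UNIV. (\<Sum>a\<in>UNIV. matrix_inv (Q_hat N h d) $ 1 $ a * Omega_NN D N h d $ a $ b) *
     matrix_inv (Q_hat N h d) $ b $ 1)"
proof -
  have "(X *v e1) $ 1 = X $ 1 $ 1" for X :: "real^4^4"
    by (simp add: e1_def matrix_vector_mult_basis column_def)
  then show ?thesis
    by (simp add: sigma_NN_def e1_def inner_axis' matrix_matrix_mult_def)
qed

text \<open>The interval is open, hence empty unless the standard error is positive. In that case
  the critical value, an infimum, is replaced by an inequality in \<open>Phi\<close>, which is
  visibly Borel in the data.\<close>

lemma ci_BSD_iff:
  assumes "0 < \<alpha>" "\<alpha> < 1"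
  shows "t \<in> ci_BSD D N h K \<alpha> d \<longleftrightarrow>
    0 < std_err D N h d \<and>
    folded_cdf (r_sup D N h K d) (\<bar>tau_hat N h d - t\<bar> / std_err D N h d) < 1 - \<alpha>"
proof -
  let ?s = "std_err D N h d" and ?c = "cv (1 - \<alpha>) (r_sup D N h K d)"
  have p: "0 < 1 - \<alpha>" "1 - \<alpha> < 1" using assms by auto
  have "t \<in> ci_BSD D N h K \<alpha> d \<longleftrightarrow> \<bar>tau_hat N h d - t\<bar> < ?c * ?s"
    by (auto simp: ci_BSD_def Let_def abs_less_iff)
  also have "\<dots> \<longleftrightarrow> 0 < ?s \<and> \<bar>tau_hat N h d - t\<bar> / ?s < ?c"
  proof (cases "0 < ?s")
    case True then show ?thesis by (simp add: pos_divide_less_eq)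
  next
    case False
    then have "?c * ?s \<le> 0" using cv_nonneg[OF p] by (intro mult_nonneg_nonpos) auto
    then show ?thesis using False by (smt (verit) abs_ge_zero)
  qed
  also have "\<dots> \<longleftrightarrow> 0 < ?s \<and> folded_cdf (r_sup D N h K d) (\<bar>tau_hat N h d - t\<bar> / ?s) < 1 - \<alpha>"
    using less_cv_iff[OF p, of "\<bar>tau_hat N h d - t\<bar> / ?s" "r_sup D N h K d"] by auto
  finally show ?thesis .
qed

context
  fixes L :: "(real \<times> real) measure" and N :: nat and M
  assumes L [measurable_cong]: "sets L = sets borel"
  defines "M \<equiv> sample_law N L"
begin

lemma sample_fst [measurable]: "i \<in> {1..N} \<Longrightarrow> (\<lambda>d. fst (d i)) \<in> borel_measurable M"
  and sample_snd [measurable]: "i \<in> {1..N} \<Longrightarrow> (\<lambda>d. snd (d i)) \<in> borel_measurable M"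
proof -
  assume i: "i \<in> {1..N}"
  have 1: "(\<lambda>d. d i) \<in> M \<rightarrow>\<^sub>M L" unfolding M_def sample_law_def by (rule measurable_component_singleton[OF i])
  have 2: "fst \<in> L \<rightarrow>\<^sub>M borel" "snd \<in> L \<rightarrow>\<^sub>M borel"
    using L by (auto simp: measurable_cong_sets[OF L refl] borel_measurable_continuous_onI continuous_on_fst continuous_on_snd)
  show "(\<lambda>d. fst (d i)) \<in> borel_measurable M" "(\<lambda>d. snd (d i)) \<in> borel_measurable M"
    using measurable_compose[OF 1 2(1)] measurable_compose[OF 1 2(2)] by simp_all
qed

lemma N_window_measurable [measurable]: "(\<lambda>d. real (N_window N h d)) \<in> borel_measurable M"
  unfolding N_window_def card_filter_eq_sum by measurable

lemma cell_count_measurable [measurable]: "(\<lambda>d. real (cell_count N d x)) \<in> borel_measurable M"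
  unfolding cell_count_def card_filter_eq_sum by measurable

lemma cell_var_measurable [measurable]: "(\<lambda>d. cell_var N d x) \<in> borel_measurable M"
  unfolding cell_var_eq by measurable

lemma Q_hat_measurable: "(\<lambda>d. Q_hat N h d $ k $ j) \<in> borel_measurable M"
  unfolding Q_hat_nth by measurable

lemma Q_hat_inv_measurable [measurable]: "(\<lambda>d. matrix_inv (Q_hat N h d) $ k $ j) \<in> borel_measurable M"
  by (rule measurable_matrix_inv[OF Q_hat_measurable])

lemma weight_measurable [measurable]:
  "i \<in> {1..N} \<Longrightarrow> (\<lambda>d. weight N h d (fst (d i))) \<in> borel_measurable M"
  unfolding weight_components by measurable

lemma tau_hat_measurable [measurable]: "(\<lambda>d. tau_hat N h d) \<in> borel_measurable M"
  unfolding tau_hat_eq by measurable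

lemma std_err_measurable [measurable]: "(\<lambda>d. std_err D N h d) \<in> borel_measurable M"
proof -
  have [measurable]: "(\<lambda>d. Omega_NN D N h d $ a $ b) \<in> borel_measurable M" for a b
    unfolding Omega_NN_def by (simp add: outer_def) measurable
  show ?thesis unfolding std_err_def sigma_NN_components by measurable
qed

lemma r_sup_measurable [measurable]: "(\<lambda>d. r_sup D N h K d) \<in> borel_measurable M"
  unfolding r_sup_def sum_window_filter sgn_if by measurable

lemma ci_BSD_measurable:
  assumes "0 < \<alpha>" "\<alpha> < 1"
  shows "{d \<in> space M. t \<in> ci_BSD D N h K \<alpha> d} \<in> sets M"
  unfolding ci_BSD_iff[OF assms] folded_cdf_def by measurable

end

section \<open>Conditioning on the design\<close>

lemma error_designD:
  assumes "error_design D"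
  shows "prob_space D" "sets D = sets borel" "space D = UNIV" "finite (x_support D)"
    "measure D {z. fst z \<in> x_support D} = 1"
  using assms sets_eq_imp_space_eq[of D borel] by (auto simp: error_design_def)

lemma sets_fst_vimage [measurable]:
  assumes "A \<in> sets borel"
  shows "{z :: real \<times> real. fst z \<in> A} \<in> sets borel"
proof -
  have "fst -` A \<inter> space borel \<in> sets (borel :: (real \<times> real) measure)"
    by (intro measurable_sets[OF _ assms] borel_measurable_continuous_onI continuous_on_fst continuous_on_id)
  then show ?thesis by (simp add: vimage_def)
qed

lemma sets_fst_eq: "{z :: real \<times> real. fst z = x} \<in> sets borel"
  using sets_fst_vimage[of "{x}"] by simp

lemma error_design_fst_measurable:
  assumes "error_design D"
  shows "fst \<in> borel_measurable D"
  by (simp add: measurable_cong_sets[OF error_designD(2)[OF assms] refl]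
      borel_measurable_continuous_onI continuous_on_fst)

lemma window_mass_eq_integral:
  assumes "error_design D"
  shows "(\<integral>z. indicator {- h..h} (fst z) \<partial>D) = window_mass D h"
proof -
  have "(\<integral>z. indicator {- h..h} (fst z) \<partial>D) = (\<integral>z. indicator {z. \<bar>fst z\<bar> \<le> h} z \<partial>D :: real)"
    by (intro Bochner_Integration.integral_cong) (auto simp: indicator_def)
  then show ?thesis by (simp add: window_mass_def error_designD(3)[OF assms])
qed

lemma given_x_space:
  assumes D: "error_design D" and x: "x \<in> x_support D"
  shows "prob_space (given_x D x)" "sets (given_x D x) = sets borel" "AE z in given_x D x. fst z = x"
    "snd \<in> borel_measurable (given_x D x)"
proof -
  interpret D: prob_space D by (rule error_designD[OF D])
  have "emeasure D {z. fst z = x} \<noteq> 0" using x by (auto simp: x_support_def measure_def)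
  then show "prob_space (given_x D x)"
    unfolding given_x_def by (intro prob_space_uniform_measure) (simp_all add: D.emeasure_finite)
  show S: "sets (given_x D x) = sets borel" using D by (simp add: given_x_def error_designD)
  show "snd \<in> borel_measurable (given_x D x)"
    by (subst measurable_cong_sets[OF S refl]) (simp add: borel_measurable_continuous_onI continuous_on_snd)
  show "AE z in given_x D x. fst z = x"
    unfolding given_x_def using sets_fst_eq error_designD(2)[OF D] by (intro AE_uniform_measureI) auto
qed

text \<open>The observed sample is the coordinatewise image of a sample of (X, \<epsilon>), so
  coverage for every \<mu> becomes the probability of an event under one measure that is free of
  \<mu>. The use of \<open>compose\<close> keeps the image extensional, as points of a product space
  are.\<close>

lemma coverage_eq:
  assumes D: "error_design D" and \<mu>: "\<mu> \<in> borel_measurable borel" and \<alpha>: "0 < \<alpha>" "\<alpha> < 1"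
  defines "T \<equiv> \<lambda>z. (fst z, \<mu> (fst z) + snd z)"
  shows "coverage D N h K \<alpha> \<mu> =
      measure (sample_law N D) {d \<in> space (sample_law N D). jump \<mu> \<in> ci_BSD D N h K \<alpha> (compose {1..N} T d)}"
    and "{d \<in> space (sample_law N D). jump \<mu> \<in> ci_BSD D N h K \<alpha> (compose {1..N} T d)} \<in> sets (sample_law N D)"
proof -
  interpret D: prob_space D by (rule error_designD[OF D])
  have fm: "fst \<in> borel_measurable (borel :: (real \<times> real) measure)"
    and sm: "snd \<in> borel_measurable (borel :: (real \<times> real) measure)"
    by (simp_all add: borel_measurable_continuous_onI continuous_on_fst continuous_on_snd)
  have T0: "T \<in> borel \<rightarrow>\<^sub>M borel"
    unfolding T_def borel_prod[symmetric] using fm sm \<mu>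
    by (intro measurable_Pair measurable_compose[OF _ \<mu>] borel_measurable_add) (simp_all add: borel_prod)
  have TD: "T \<in> D \<rightarrow>\<^sub>M borel" using T0 error_designD(2)[OF D] measurable_cong_sets by blast
  define L where "L = obs_law D \<mu>"
  have L: "L = distr D borel T" by (simp add: L_def obs_law_def T_def)
  have sL: "sets L = sets borel" by (simp add: L)
  have pL: "prob_space L" unfolding L by (rule D.prob_space_distr[OF TD])
  have TL: "T \<in> D \<rightarrow>\<^sub>M L" using TD sL measurable_cong_sets by blast
  have "distr D L T = L" unfolding L by (rule distr_cong) auto
  then have law: "sample_law N L = distr (sample_law N D) (sample_law N L) (compose {1..N} T)"
    unfolding sample_law_def
    using distr_PiM_finite_prob_space'[of "{1..N}" "\<lambda>_. D" "\<lambda>_. L" T] D.prob_space_axioms pL TL by simp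
  have cm: "compose {1..N} T \<in> sample_law N D \<rightarrow>\<^sub>M sample_law N L"
    unfolding sample_law_def compose_def
  proof (rule measurable_restrict)
    fix i assume i: "i \<in> {1..N}"
    show "(\<lambda>d. T (d i)) \<in> PiM {1..N} (\<lambda>_. D) \<rightarrow>\<^sub>M L"
      by (rule measurable_compose[OF measurable_component_singleton[OF i] TL])
  qed
  let ?E = "{d \<in> space (sample_law N L). jump \<mu> \<in> ci_BSD D N h K \<alpha> d}"
  have E: "?E \<in> sets (sample_law N L)" by (rule ci_BSD_measurable[OF sL \<alpha>])
  have pre: "compose {1..N} T -` ?E \<inter> space (sample_law N D) =
      {d \<in> space (sample_law N D). jump \<mu> \<in> ci_BSD D N h K \<alpha> (compose {1..N} T d)}"
    using measurable_space[OF cm] by auto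
  have "coverage D N h K \<alpha> \<mu> = measure (sample_law N L) ?E" by (simp add: coverage_def L_def)
  also have "\<dots> = measure (distr (sample_law N D) (sample_law N L) (compose {1..N} T)) ?E"
    using law by simp
  also have "\<dots> = measure (sample_law N D)
      {d \<in> space (sample_law N D). jump \<mu> \<in> ci_BSD D N h K \<alpha> (compose {1..N} T d)}"
    by (subst measure_distr[OF cm E]) (simp only: pre)
  finally show "coverage D N h K \<alpha> \<mu> = measure (sample_law N D)
      {d \<in> space (sample_law N D). jump \<mu> \<in> ci_BSD D N h K \<alpha> (compose {1..N} T d)}" .
  show "{d \<in> space (sample_law N D). jump \<mu> \<in> ci_BSD D N h K \<alpha> (compose {1..N} T d)} \<in> sets (sample_law N D)"
    using measurable_sets[OF cm E] unfolding pre .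
qed

definition design_law :: "(real \<times> real) measure \<Rightarrow> nat \<Rightarrow> (nat \<Rightarrow> real) \<Rightarrow> (nat \<Rightarrow> real \<times> real) measure" where
  "design_law D N x = PiM {1..N} (\<lambda>i. given_x D (x i))"

text \<open>The support is finite, so conditioning on the design means conditioning on one of finitely many
  rectangles of positive probability.\<close>

lemma design_law_eq_uniform:
  assumes D: "error_design D" and x: "\<And>i. i \<in> {1..N} \<Longrightarrow> x i \<in> x_support D"
  defines "A \<equiv> \<Pi>\<^sub>E i\<in>{1..N}. {z. fst z = x i}"
  shows "A \<in> sets (sample_law N D)" and "design_law D N x = uniform_measure (sample_law N D) A"
proof -
  interpret D: prob_space D by (rule error_designD[OF D])
  interpret P: product_prob_space "\<lambda>_. D" "{1..N}" by unfold_locales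
  have sD: "sets D = sets borel" "space D = UNIV" using D by (auto simp: error_designD)
  have cellD: "{z. fst z = a} \<in> sets D" for a using sets_fst_eq sD by simp
  show A: "A \<in> sets (sample_law N D)"
    unfolding A_def sample_law_def by (intro sets_PiM_I_finite) (auto simp: cellD)
  define q where "q i = emeasure D {z. fst z = x i}" for i
  have q0: "q i \<noteq> 0" "q i \<noteq> \<infinity>" if "i \<in> {1..N}" for i
    using x[OF that] by (auto simp: q_def x_support_def measure_def D.emeasure_finite)
  \<comment> \<open>The product locale requires a probability space at every index, while
    \<open>given_x\<close> is one only at support points; \<open>D\<close> is a filler outside the
    sample.\<close>
  define G where "G i = (if i \<in> {1..N} then given_x D (x i) else D)" for i
  have Gp: "prob_space (G i)" for i
    using given_x_space(1)[OF D x] D.prob_space_axioms by (simp add: G_def)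
  interpret G: product_prob_space G "{1..N}" by (simp add: product_prob_spaceI Gp)
  have sG: "sets (G i) = sets D" for i
    by (simp add: G_def given_x_def)
  have eA: "emeasure (sample_law N D) A = (\<Prod>i\<in>{1..N}. q i)"
    unfolding A_def sample_law_def q_def using cellD by (subst P.emeasure_PiM) auto
  have "uniform_measure (sample_law N D) A = PiM {1..N} G"
  proof (rule G.PiM_eqI)
    show "finite {1..N}" by simp
    show "sets (uniform_measure (sample_law N D) A) = sets (PiM {1..N} G)"
      unfolding sets_uniform_measure sample_law_def by (rule sets_PiM_cong) (auto simp: sG)
    fix B assume B: "\<And>i. i \<in> {1..N} \<Longrightarrow> B i \<in> sets (G i)"
    then have BD: "B i \<in> sets D" if "i \<in> {1..N}" for i using that by (simp add: sG)
    have "A \<inter> PiE {1..N} B = (\<Pi>\<^sub>E i\<in>{1..N}. {z. fst z = x i} \<inter> B i)"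
      unfolding A_def by (rule PiE_Int)
    moreover have "PiE {1..N} B \<in> sets (sample_law N D)"
      unfolding sample_law_def using BD by (intro sets_PiM_I_finite) auto
    ultimately have "emeasure (uniform_measure (sample_law N D) A) (PiE {1..N} B) =
        emeasure (sample_law N D) (\<Pi>\<^sub>E i\<in>{1..N}. {z. fst z = x i} \<inter> B i) / emeasure (sample_law N D) A"
      using A by simp
    also have "emeasure (sample_law N D) (\<Pi>\<^sub>E i\<in>{1..N}. {z. fst z = x i} \<inter> B i) =
        (\<Prod>i\<in>{1..N}. emeasure D ({z. fst z = x i} \<inter> B i))"
      unfolding sample_law_def using cellD BD by (subst P.emeasure_PiM) auto
    also have "\<dots> / emeasure (sample_law N D) A = (\<Prod>i\<in>{1..N}. emeasure D ({z. fst z = x i} \<inter> B i) / q i)"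
    proof -
      define r where "r i = D.prob {z. fst z = x i}" for i
      have r: "q i = ennreal (r i)" "0 < r i" if "i \<in> {1..N}" for i
        using x[OF that] by (auto simp: q_def r_def D.emeasure_eq_measure x_support_def)
      have "(\<Prod>i\<in>{1..N}. q i) = ennreal (\<Prod>i\<in>{1..N}. r i)"
        using r less_imp_le by (subst prod_ennreal[symmetric]) auto
      moreover have "(\<Prod>i\<in>{1..N}. emeasure D ({z. fst z = x i} \<inter> B i)) =
          ennreal (\<Prod>i\<in>{1..N}. D.prob ({z. fst z = x i} \<inter> B i))"
        unfolding D.emeasure_eq_measure by (rule prod_ennreal) simp
      moreover have "(\<Prod>i\<in>{1..N}. emeasure D ({z. fst z = x i} \<inter> B i) / q i) =
          ennreal (\<Prod>i\<in>{1..N}. D.prob ({z. fst z = x i} \<inter> B i) / r i)"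
        using r less_imp_le unfolding D.emeasure_eq_measure
        by (subst prod_ennreal[symmetric]) (auto simp: divide_ennreal intro!: prod.cong divide_nonneg_pos)
      moreover have "0 < (\<Prod>i\<in>{1..N}. r i)" using r by (intro prod_pos) auto
      moreover have "0 \<le> (\<Prod>i\<in>{1..N}. D.prob ({z. fst z = x i} \<inter> B i))" by (intro prod_nonneg) simp
      ultimately show ?thesis unfolding eA by (simp only: divide_ennreal prod_dividef)
    qed
    also have "\<dots> = (\<Prod>i\<in>{1..N}. emeasure (G i) (B i))"
      using cellD BD by (intro prod.cong refl) (simp add: G_def given_x_def q_def)
    finally show "emeasure (uniform_measure (sample_law N D) A) (PiE {1..N} B) =
      (\<Prod>i\<in>{1..N}. emeasure (G i) (B i))" .
  qed
  also have "\<dots> = design_law D N x"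
    unfolding design_law_def by (rule PiM_cong) (auto simp: G_def)
  finally show "design_law D N x = uniform_measure (sample_law N D) A" by simp
qed

lemma prob_space_sample_law: "prob_space L \<Longrightarrow> prob_space (sample_law N L)"
  unfolding sample_law_def by (rule prob_space_PiM)

text \<open>The rectangles of constant design partition the sample space up to a null set. If
  \<open>G\<close> meets a rectangle, the whole rectangle has conditional coverage at least
  \<open>c\<close>, which dominates \<open>c\<close> times the part of \<open>G\<close> inside it;
  summation over the finitely many designs gives the claim.\<close>

lemma coverage_by_conditioning:
  assumes D: "error_design D" and E: "E \<in> sets (sample_law N D)" and G: "G \<in> sets (sample_law N D)"
    and c: "0 \<le> c"
    and cond: "\<And>x d. (\<And>i. i \<in> {1..N} \<Longrightarrow> x i \<in> x_support D) \<Longrightarrow> d \<in> G \<Longrightarrow>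
      (\<And>i. i \<in> {1..N} \<Longrightarrow> fst (d i) = x i) \<Longrightarrow> c \<le> measure (design_law D N x) E"
  shows "c * measure (sample_law N D) G \<le> measure (sample_law N D) E"
proof -
  interpret D: prob_space D by (rule error_designD[OF D])
  interpret M: prob_space "sample_law N D" by (rule prob_space_sample_law) unfold_locales
  have sD: "sets D = sets borel" "space D = UNIV" using D by (auto simp: error_designD)
  define S where "S = (\<Pi>\<^sub>E i\<in>{1..N}. x_support D)"
  have finS: "finite S" unfolding S_def using D by (intro finite_PiE) (auto simp: error_designD)
  define A where "A x = (\<Pi>\<^sub>E i\<in>{1..N}. {z :: real \<times> real. fst z = x i})" for x
  have xS: "x i \<in> x_support D" if "x \<in> S" "i \<in> {1..N}" for x i using that by (auto simp: S_def)
  have A: "A x \<in> sets (sample_law N D)" if "x \<in> S" for x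
    unfolding A_def by (rule design_law_eq_uniform(1)[OF D]) (use xS that in auto)
  have disj: "disjoint_family_on A S"
    unfolding disjoint_family_on_def
  proof (intro ballI impI)
    fix x y assume xy: "x \<in> S" "y \<in> S" "x \<noteq> y"
    then obtain i where i: "i \<in> {1..N}" "x i \<noteq> y i"
      unfolding S_def by (metis PiE_ext)
    then show "A x \<inter> A y = {}" unfolding A_def by (auto simp: PiE_iff)
  qed
  have split: "M.prob (B \<inter> (\<Union>x\<in>S. A x)) = (\<Sum>x\<in>S. M.prob (B \<inter> A x))" if "B \<in> sets (sample_law N D)" for B
  proof -
    have "B \<inter> (\<Union>x\<in>S. A x) = (\<Union>x\<in>S. B \<inter> A x)" by auto
    then show ?thesis
      using that A disj finS
      by (simp only:) (intro M.finite_measure_finite_Union, auto simp: disjoint_family_on_def)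
  qed
  have "AE z in D. fst z \<in> x_support D"
  proof (rule D.AE_I_eq_1)
    show "emeasure D {x \<in> space D. fst x \<in> x_support D} = 1"
      using error_designD(5)[OF D] by (simp add: sD D.emeasure_eq_measure)
    have "x_support D \<in> sets borel" using error_designD(4)[OF D] by (intro borel_closed finite_imp_closed)
    then show "{x \<in> space D. fst x \<in> x_support D} \<in> D.events"
      using sets_fst_vimage sD by simp
  qed
  then have "AE d in sample_law N D. \<forall>i\<in>{1..N}. fst (d i) \<in> x_support D"
    unfolding sample_law_def using D.prob_space_axioms
    by (intro eventually_ball_finite ballI AE_PiM_component) auto
  then have AE: "AE d in sample_law N D. d \<in> (\<Union>x\<in>S. A x)"
    using AE_space
  proof eventually_elim
    case (elim d)
    have ext: "d \<in> extensional {1..N}" using elim(2) by (auto simp: sample_law_def space_PiM PiE_def)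
    have "(\<lambda>i\<in>{1..N}. fst (d i)) \<in> S" using elim(1) by (auto simp: S_def)
    moreover have "d \<in> A (\<lambda>i\<in>{1..N}. fst (d i))" using ext by (auto simp: A_def PiE_def)
    ultimately show ?case by blast
  qed
  have "M.prob G = M.prob (G \<inter> (\<Union>x\<in>S. A x))"
    using AE G A finS by (intro M.finite_measure_eq_AE) (auto intro!: sets.Int sets.finite_UN)
  also have "\<dots> = (\<Sum>x\<in>S. M.prob (G \<inter> A x))" by (rule split[OF G])
  finally have "c * M.prob G = (\<Sum>x\<in>S. c * M.prob (G \<inter> A x))" by (simp add: sum_distrib_left)
  also have "\<dots> \<le> (\<Sum>x\<in>S. M.prob (E \<inter> A x))"
  proof (rule sum_mono)
    fix x assume x: "x \<in> S"
    show "c * M.prob (G \<inter> A x) \<le> M.prob (E \<inter> A x)"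
    proof (cases "G \<inter> A x = {}")
      case True then show ?thesis by (simp only: True) simp
    next
      case False
      then obtain d where d: "d \<in> G" "d \<in> A x" by auto
      show ?thesis
      proof (cases "M.prob (A x) = 0")
        case True
        have "M.prob (G \<inter> A x) \<le> M.prob (A x)" using A[OF x] by (intro M.finite_measure_mono) auto
        then have "M.prob (G \<inter> A x) = 0" using True measure_nonneg[of "sample_law N D" "G \<inter> A x"] by linarith
        then show ?thesis by simp
      next
        case False
        then have pos: "0 < M.prob (A x)" using measure_nonneg[of "sample_law N D" "A x"] by linarith
        have "c \<le> measure (design_law D N x) E"
          by (rule cond[OF xS[OF x] d(1)]) (use d(2) in \<open>auto simp: A_def PiE_iff\<close>)
        also have "\<dots> = M.prob (A x \<inter> E) / M.prob (A x)"
        proof -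
          have eq: "design_law D N x = uniform_measure (sample_law N D) (A x)"
            unfolding A_def by (rule design_law_eq_uniform(2)[OF D xS[OF x]])
          show ?thesis
            unfolding eq using pos E by (intro measure_uniform_measure) (auto simp: M.emeasure_eq_measure)
        qed
        finally have cE: "c \<le> M.prob (A x \<inter> E) / M.prob (A x)" .
        have "c * M.prob (G \<inter> A x) \<le> c * M.prob (A x)"
          using c A[OF x] by (intro mult_left_mono M.finite_measure_mono) auto
        also have "\<dots> \<le> M.prob (A x \<inter> E)" using cE pos by (simp add: pos_le_divide_eq)
        finally show ?thesis by (simp add: Int_commute)
      qed
    qed
  qed
  also have "\<dots> = M.prob (E \<inter> (\<Union>x\<in>S. A x))" using split[OF E] by simp
  also have "\<dots> \<le> M.prob E" using E by (intro M.finite_measure_mono) auto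
  finally show ?thesis .
qed

text \<open>Under the product measure the joint law of the coordinates is the product of their
  marginals, because the joint map is the identity.\<close>

lemma indep_vars_component:
  assumes "I \<noteq> {}" and M: "\<And>i. i \<in> I \<Longrightarrow> prob_space (M i)"
  shows "prob_space.indep_vars (PiM I M) M (\<lambda>i d. d i) I"
proof -
  interpret prob_space "PiM I M" by (rule prob_space_PiM[OF M])
  have "distr (PiM I M) (PiM I M) (\<lambda>d. \<lambda>i\<in>I. d i) = distr (PiM I M) (PiM I M) (\<lambda>d. d)"
    by (rule distr_cong) (auto simp: space_PiM PiE_restrict)
  also have "\<dots> = PiM I M" by (rule distr_id2) simp
  also have "\<dots> = PiM I (\<lambda>i. distr (PiM I M) (M i) (\<lambda>d. d i))"
    by (rule PiM_cong[OF refl]) (rule distr_PiM_component[OF M, symmetric])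
  finally show ?thesis
    using assms by (subst indep_vars_iff_distr_eq_PiM') auto
qed

section \<open>Coverage for a given design\<close>

definition sampling_var :: "(real \<times> real) measure \<Rightarrow> nat \<Rightarrow> real \<Rightarrow> (nat \<Rightarrow> real \<times> real) \<Rightarrow> real" where
  "sampling_var D N h d = (\<Sum>i=1..N. (weight N h d (fst (d i)))\<^sup>2 * cond_var D (fst (d i)))"

text \<open>All four conditions depend on the sample only through the running variables, which makes
  them properties of the design on which one conditions. The last one bounds the Lyapunov ratio of
  the weighted error sum.\<close>

definition good_design :: "real \<Rightarrow> (real \<times> real) measure \<Rightarrow> nat \<Rightarrow> real \<Rightarrow> (nat \<Rightarrow> real \<times> real) \<Rightarrow> bool" where
  "good_design \<rho> D N h d \<longleftrightarrow>
    det (Q_hat N h d) \<noteq> 0 \<and> (\<forall>x\<in>window_points D h. 2 \<le> cell_count N d x) \<and>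
    0 < sampling_var D N h d \<and>
    (\<Sum>i=1..N. weight N h d (fst (d i)) ^ 4) \<le> \<rho> * (sampling_var D N h d)\<^sup>2"

lemma design_cong:
  assumes "\<And>i. i \<in> {1..N} \<Longrightarrow> fst (d i) = fst (d' i)"
  shows "Q_hat N h d = Q_hat N h d'" "N_window N h d = N_window N h d'"
    "cell_count N d y = cell_count N d' y" "weight N h d y = weight N h d' y"
proof -
  show 1: "N_window N h d = N_window N h d'"
    unfolding N_window_def using assms by (intro arg_cong[where f = card]) auto
  show 2: "Q_hat N h d = Q_hat N h d'"
    unfolding Q_hat_def 1 using assms by simp
  show "cell_count N d y = cell_count N d' y"
    unfolding cell_count_def using assms by (intro arg_cong[where f = card]) auto
  show "weight N h d y = weight N h d' y"
    unfolding weight_def 1 2 ..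
qed

lemma weight_outside: "h < \<bar>x\<bar> \<Longrightarrow> weight N h d x = 0"
  by (auto simp: weight_def window_regr_def indicator_def)

lemma weight_nonzero: "weight N h d x \<noteq> 0 \<Longrightarrow> \<bar>x\<bar> \<le> h"
  using weight_outside[of h x N d] by (meson not_le)

text \<open>The weights vanish outside the window, so all sums reduce to \<open>J\<close>. There the
  window indicator is 1, and the weights have the piecewise affine form and the moments that the
  bias bound requires.\<close>

lemma estimator_bias:
  assumes det: "det (Q_hat N h d) \<noteq> 0" and \<mu>: "\<mu> \<in> holder_class K"
  defines "w \<equiv> \<lambda>i. weight N h d (fst (d i))"
  shows "\<bar>(\<Sum>i=1..N. w i * \<mu> (fst (d i))) - jump \<mu>\<bar> \<le>
    - (K / 2) * (\<Sum>i=1..N. w i * (fst (d i))\<^sup>2 * sgn (fst (d i)))"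
proof -
  define J where "J = {i \<in> {1..N}. \<bar>fst (d i)\<bar> \<le> h}"
  have restrict: "(\<Sum>i=1..N. w i * g i) = (\<Sum>i\<in>J. w i * g i)" for g
    by (rule sum.mono_neutral_right) (auto simp: J_def w_def dest: weight_nonzero)
  have mom: "(\<Sum>i\<in>J. w i * regr (fst (d i)) $ k) = e1 $ k" for k
    using weight_moments[OF det, of k] restrict[of "\<lambda>i. regr (fst (d i)) $ k"] by (simp add: w_def)
  define v where "v k = ols_coef N h d $ k / real (N_window N h d)" for k
  have "\<bar>(\<Sum>i\<in>J. w i * \<mu> (fst (d i))) - jump \<mu>\<bar> \<le>
      - (K / 2) * (\<Sum>i\<in>J. w i * (fst (d i))\<^sup>2 * sgn (fst (d i)))"
  proof (rule local_linear_bias[OF _ \<mu>, where ?v1.0 = "v 1" and ?v2.0 = "v 2" and ?v3.0 = "v 3" and ?v4.0 = "v 4"])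
    show "finite J" by (simp add: J_def)
    fix j assume "j \<in> J"
    then have "fst (d j) \<in> {- h..h}" by (auto simp: J_def)
    then show "w j = v 1 * indicator {0..} (fst (d j)) + v 2 + v 3 * fst (d j) +
        v 4 * (indicator {0..} (fst (d j)) * fst (d j))"
      by (simp add: w_def weight_eq[OF det] inner_vec_def sum_4 v_def add_divide_distrib)
  qed (use mom[of 1] mom[of 2] mom[of 3] mom[of 4] in \<open>auto simp: e1_def axis_def\<close>)
  then show ?thesis
    using restrict[of "\<lambda>i. \<mu> (fst (d i))"] restrict[of "\<lambda>i. (fst (d i))\<^sup>2 * sgn (fst (d i))"]
    by (simp add: mult.assoc)
qed

lemma design_law_moments:
  fixes f :: "real \<Rightarrow> real"
  assumes D: "error_design D" and x: "\<And>i. i \<in> {1..N} \<Longrightarrow> x i \<in> x_support D" and i: "i \<in> {1..N}"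
    and f: "f \<in> borel_measurable borel"
  shows "(\<integral>d. f (snd (d i)) \<partial>design_law D N x) = (\<integral>z. f (snd z) \<partial>given_x D (x i))"
    and "integrable (given_x D (x i)) (\<lambda>z. f (snd z)) \<Longrightarrow>
      integrable (design_law D N x) (\<lambda>d. f (snd (d i)))"
proof -
  have P: "distr (design_law D N x) (given_x D (x i)) (\<lambda>d. d i) = given_x D (x i)"
    unfolding design_law_def using given_x_space(1)[OF D x] i by (intro distr_PiM_component) auto
  have c: "(\<lambda>d. d i) \<in> design_law D N x \<rightarrow>\<^sub>M given_x D (x i)"
    unfolding design_law_def by (rule measurable_component_singleton[OF i])
  note snd_m = given_x_space(4)[OF D x[OF i]]
  have fs: "(\<lambda>z. f (snd z)) \<in> borel_measurable (given_x D (x i))"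
    by (rule measurable_compose[OF snd_m f])
  show "(\<integral>d. f (snd (d i)) \<partial>design_law D N x) = (\<integral>z. f (snd z) \<partial>given_x D (x i))"
    using integral_distr[OF c fs] P by simp
  show "integrable (design_law D N x) (\<lambda>d. f (snd (d i)))" if "integrable (given_x D (x i)) (\<lambda>z. f (snd z))"
    using integrable_distr_eq[OF c fs] P that by simp
qed

lemma cond_var_eq:
  assumes "error_design D" "x \<in> x_support D"
  shows "cond_var D x = (\<integral>z. (snd z)\<^sup>2 \<partial>given_x D x)"
  using assms by (simp add: cond_var_def error_design_def)

text \<open>Here \<open>d\<close> only represents the design. Almost every sample drawn given the
  design shares the running variables of \<open>d\<close>, so the weights, the bias and the
  numerator \<open>R\<close> of \<open>r_sup\<close> are constants; the errors make only the
  standard error and the weighted sum random.\<close>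

lemma conditional_coverage:
  assumes \<alpha>: "0 < \<alpha>" "\<alpha> < 1" and tol: "lyapunov_tolerance (1 - \<alpha>) \<delta> V \<rho>"
    and D: "error_design D" and N: "1 \<le> N" and \<mu>: "\<mu> \<in> holder_class K"
    and m4: "\<And>y. y \<in> x_support D \<Longrightarrow>
      integrable (given_x D y) (\<lambda>z. snd z ^ 4) \<and> (\<integral>z. snd z ^ 4 \<partial>given_x D y) \<le> V"
    and x: "\<And>i. i \<in> {1..N} \<Longrightarrow> x i \<in> x_support D"
    and dx: "\<And>i. i \<in> {1..N} \<Longrightarrow> fst (d i) = x i" and good: "good_design \<rho> D N h d"
  defines "T \<equiv> \<lambda>z :: real \<times> real. (fst z, \<mu> (fst z) + snd z)"
  shows "1 - \<alpha> - \<delta> \<le> measure (design_law D N x)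
    {d \<in> space (sample_law N D). jump \<mu> \<in> ci_BSD D N h K \<alpha> (compose {1..N} T d)}"
proof -
  have p: "0 < 1 - \<alpha>" "1 - \<alpha> < 1" using \<alpha> by auto
  define w where "w i = weight N h d (fst (d i))" for i
  define c where "c = nn_coef N h d"
  define M where "M = design_law D N x"
  define S where "S d' = std_err D N h (compose {1..N} T d')" for d'
  define b where "b = (\<Sum>i=1..N. w i * \<mu> (fst (d i))) - jump \<mu>"
  define R where "R = - (K / 2) * (\<Sum>i=1..N. w i * (fst (d i))\<^sup>2 * sgn (fst (d i)))"
  let ?E = "{d \<in> space (sample_law N D). jump \<mu> \<in> ci_BSD D N h K \<alpha> (compose {1..N} T d)}"
  have det: "det (Q_hat N h d) \<noteq> 0" and cells: "\<And>y. y \<in> window_points D h \<Longrightarrow> 2 \<le> cell_count N d y"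
    and sv: "0 < sampling_var D N h d" "(\<Sum>i=1..N. w i ^ 4) \<le> \<rho> * (sampling_var D N h d)\<^sup>2"
    using good by (auto simp: good_design_def w_def)
  have pM: "prob_space M" unfolding M_def design_law_def by (rule prob_space_PiM[OF given_x_space(1)[OF D x]])
  have sp: "sets M = sets (sample_law N D)"
    unfolding M_def design_law_def sample_law_def by (intro sets_PiM_cong) (simp_all add: given_x_def)
  then have spc: "space M = space (sample_law N D)" by (rule sets_eq_imp_space_eq)
  have var: "(\<integral>d. (snd (d i))\<^sup>2 \<partial>M) = cond_var D (fst (d i))" if "i \<in> {1..N}" for i
    unfolding M_def dx[OF that] cond_var_eq[OF D x[OF that]]
    using design_law_moments(1)[where x = x and f = "\<lambda>y. y\<^sup>2", OF D x that] by simp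
  have sv_eq: "(\<Sum>i=1..N. (w i)\<^sup>2 * (\<integral>d. (snd (d i))\<^sup>2 \<partial>M)) = sampling_var D N h d"
    unfolding sampling_var_def w_def by (intro sum.cong refl) (simp add: var)
  have "1 - \<alpha> - \<delta> \<le> measure M ?E"
  proof (rule prob_space.studentized_sum_coverage[OF pM p tol, where X = "\<lambda>i d. snd (d i)" and I = "{1..N}"
        and w = w and c = c and S = S and R = R and b = b])
    have "prob_space.indep_vars M (\<lambda>i. given_x D (x i)) (\<lambda>i d. d i) {1..N}"
      unfolding M_def design_law_def using N by (intro indep_vars_component given_x_space(1)[OF D x]) auto
    from prob_space.indep_vars_compose2[OF pM this, of "\<lambda>_. snd" "\<lambda>_. borel"] given_x_space(4)[OF D x]
    show "prob_space.indep_vars M (\<lambda>_. borel) (\<lambda>i d. snd (d i)) {1..N}" by simp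
    fix i assume i: "i \<in> {1..N}"
    have "(\<integral>z. snd z \<partial>given_x D (x i)) = 0" using D x[OF i] by (simp add: error_design_def)
    then show "integrable M (\<lambda>d. snd (d i) ^ 4)" "(\<integral>d. snd (d i) \<partial>M) = 0" "(\<integral>d. snd (d i) ^ 4 \<partial>M) \<le> V"
      using m4[OF x[OF i]] design_law_moments(1)[where x = x and f = "\<lambda>y. y", OF D x i]
        design_law_moments[where x = x and f = "\<lambda>y. y ^ 4", OF D x i]
      unfolding M_def by simp_all
    show "c i i = 0" by (simp add: c_def nn_coef_def)
    show "c i j = c j i" for j by (auto simp: c_def nn_coef_def)
  next
    \<comment> \<open>This bound concerns the design alone, so \<open>d\<close> itself may serve as
      a sample with regression function 0 and its second components as errors.\<close>
    show "(\<Sum>i=1..N. \<Sum>j=1..N. (c i j)\<^sup>2) \<le> (\<Sum>i=1..N. w i ^ 4)"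
      unfolding c_def w_def
      by (rule std_err_quadratic_form(2)[where m = "\<lambda>_. 0" and e = "\<lambda>i. snd (d i)", OF error_designD(4)[OF D] det _ cells])
         (auto simp: dx x)
    show "0 < (\<Sum>i=1..N. (w i)\<^sup>2 * (\<integral>d. (snd (d i))\<^sup>2 \<partial>M))" unfolding sv_eq by (rule sv)
    show "(\<Sum>i=1..N. w i ^ 4) \<le> \<rho> * (\<Sum>i=1..N. (w i)\<^sup>2 * (\<integral>d. (snd (d i))\<^sup>2 \<partial>M))\<^sup>2"
      unfolding sv_eq by (rule sv)
    show "\<bar>b\<bar> \<le> R" unfolding b_def R_def w_def by (rule estimator_bias[OF det \<mu>])
    show "?E \<in> sets M" unfolding sp T_def by (rule coverage_eq(2)[OF D holder_class_measurable[OF \<mu>] \<alpha>])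
    have "AE d' in M. \<forall>i\<in>{1..N}. fst (d' i) = x i"
      unfolding M_def design_law_def using given_x_space(1,3)[OF D x]
      by (intro eventually_ball_finite ballI AE_PiM_component) auto
    then show "AE d' in M. S d' = sqrt ((\<Sum>i=1..N. (w i)\<^sup>2 * (snd (d' i))\<^sup>2) -
        (\<Sum>i=1..N. \<Sum>j=1..N. c i j * (snd (d' i) * snd (d' j)))) \<and>
        (\<bar>b + (\<Sum>i=1..N. w i * snd (d' i))\<bar> < cv (1 - \<alpha>) (R / S d') * S d' \<longrightarrow> d' \<in> ?E)"
      using AE_space
    proof eventually_elim
      case (elim d')
      \<comment> \<open>The sample of (X, Y) that belongs to the sample \<open>d'\<close> of (X,
        \<epsilon>).\<close>
      define d2 where "d2 = compose {1..N} T d'"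
      have d2: "fst (d2 i) = fst (d i)" "snd (d2 i) = \<mu> (fst (d2 i)) + snd (d' i)" if "i \<in> {1..N}" for i
        using elim(1) dx that by (simp_all add: d2_def compose_def T_def)
      have cong: "Q_hat N h d2 = Q_hat N h d" "cell_count N d2 y = cell_count N d y"
          "weight N h d2 y = weight N h d y" for y
        by (rule design_cong, erule d2(1))+
      have "S d' = sqrt ((\<Sum>i=1..N. (weight N h d2 (fst (d2 i)))\<^sup>2 * (snd (d' i))\<^sup>2) -
          (\<Sum>i=1..N. \<Sum>j=1..N. nn_coef N h d2 i j * (snd (d' i) * snd (d' j))))"
        unfolding S_def d2_def[symmetric]
        by (rule std_err_quadratic_form(1)[where d = d2 and m = \<mu> and e = "\<lambda>i. snd (d' i)", OF error_designD(4)[OF D] _ _ _ d2(2)])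
           (use det cells in \<open>auto simp: cong d2(1) dx x\<close>)
      moreover have "weight N h d2 (fst (d2 i)) = w i" if "i \<in> {1..N}" for i
        using cong(3) d2(1)[OF that] by (simp add: w_def)
      moreover have "nn_coef N h d2 i j = c i j" if "i \<in> {1..N}" "j \<in> {1..N}" for i j
        by (simp only: nn_coef_def c_def cong(2,3) d2(1) that)
      ultimately have SS: "S d' = sqrt ((\<Sum>i=1..N. (w i)\<^sup>2 * (snd (d' i))\<^sup>2) -
          (\<Sum>i=1..N. \<Sum>j=1..N. c i j * (snd (d' i) * snd (d' j))))" by simp
      have "tau_hat N h d2 = (\<Sum>i=1..N. w i * \<mu> (fst (d i)) + w i * snd (d' i))"
        unfolding tau_hat_eq by (intro sum.cong refl) (simp only: cong(3) d2 distrib_left w_def)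
      then have tau: "tau_hat N h d2 - jump \<mu> = b + (\<Sum>i=1..N. w i * snd (d' i))"
        by (simp add: b_def sum.distrib)
      have "(\<Sum>i | i \<in> {1..N} \<and> \<bar>fst (d2 i)\<bar> \<le> h. weight N h d2 (fst (d2 i)) * (fst (d2 i))\<^sup>2 * sgn (fst (d2 i))) =
          (\<Sum>i=1..N. w i * (fst (d i))\<^sup>2 * sgn (fst (d i)))"
        by (rule sum.mono_neutral_cong_left) (auto simp: cong(3) d2(1) w_def dest: weight_nonzero)
      then have r: "r_sup D N h K d2 = R / S d'"
        by (simp add: r_sup_def R_def S_def d2_def)
      have "d' \<in> ?E" if "\<bar>b + (\<Sum>i=1..N. w i * snd (d' i))\<bar> < cv (1 - \<alpha>) (R / S d') * S d'"
      proof -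
        have "\<bar>tau_hat N h d2 - jump \<mu>\<bar> < cv (1 - \<alpha>) (r_sup D N h K d2) * std_err D N h d2"
          using that unfolding tau r by (simp add: S_def d2_def)
        then have "jump \<mu> \<in> ci_BSD D N h K \<alpha> d2" by (auto simp: ci_BSD_def Let_def abs_less_iff)
        then show ?thesis using elim(2) spc by (simp add: d2_def)
      qed
      then show ?case using SS by blast
    qed
  qed simp
  then show ?thesis unfolding M_def .
qed

section \<open>Good designs are likely\<close>

text \<open>Since \<open>f\<close> lives on the window, one term has variance at most B^2 times the
  window mass, and Chebyshev's inequality gives a rate in the expected number of observations in the
  window instead of N.\<close>

lemma window_sum_concentrates:
  fixes f :: "real \<Rightarrow> real"
  assumes D: "error_design D" and N: "1 \<le> N" and f [measurable]: "f \<in> borel_measurable borel"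
    and B: "\<And>x. \<bar>f x\<bar> \<le> B * indicator {- h..h} x" and mass: "0 < window_mass D h" and e: "0 < e"
  defines "A \<equiv> {d \<in> space (sample_law N D). e \<le>
      \<bar>(\<Sum>i=1..N. f (fst (d i))) / (real N * window_mass D h) - (\<integral>z. f (fst z) \<partial>D) / window_mass D h\<bar>}"
  shows "A \<in> sets (sample_law N D)"
    and "measure (sample_law N D) A \<le> B\<^sup>2 / e\<^sup>2 / (real N * window_mass D h)"
proof -
  interpret D: prob_space D by (rule error_designD[OF D])
  interpret M: prob_space "sample_law N D" by (rule prob_space_sample_law) unfold_locales
  note fst_D [measurable] = error_design_fst_measurable[OF D]
  have comp: "distr (sample_law N D) D (\<lambda>d. d i) = D" "(\<lambda>d. d i) \<in> sample_law N D \<rightarrow>\<^sub>M D" if "i \<in> {1..N}" for i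
    unfolding sample_law_def using that D.prob_space_axioms
    by (auto intro!: distr_PiM_component measurable_component_singleton)
  note [measurable] = sample_fst[OF error_designD(2)[OF D]]
  let ?\<pi> = "window_mass D h"
  have B0: "0 \<le> B * indicator {- h..h} x" for x using B[of x] abs_ge_zero order_trans by blast
  have bnd: "\<bar>f x\<bar> \<le> \<bar>B\<bar>" for x
    using B[of x] by (cases "x \<in> {- h..h}") auto
  have fint: "integrable D (\<lambda>z. f (fst z))" and f2int: "integrable D (\<lambda>z. (f (fst z))\<^sup>2)"
    by (rule D.integrable_const_bound[where B = "\<bar>B\<bar>"]; use bnd in simp)
       (rule D.integrable_const_bound[where B = "B\<^sup>2"]; use bnd in \<open>simp add: abs_le_square_iff\<close>)
  define m where "m = (\<integral>z. f (fst z) \<partial>D)"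
  note win = window_mass_eq_integral[OF D, of h]
  have f2: "(\<integral>z. (f (fst z))\<^sup>2 \<partial>D) \<le> B\<^sup>2 * ?\<pi>"
  proof -
    have "(\<integral>z. (f (fst z))\<^sup>2 \<partial>D) \<le> (\<integral>z. B\<^sup>2 * indicator {- h..h} (fst z) \<partial>D)"
    proof (rule integral_mono[OF f2int])
      show "integrable D (\<lambda>z. B\<^sup>2 * indicator {- h..h} (fst z) :: real)"
        by (rule D.integrable_const_bound[where B = "B\<^sup>2"]) (auto simp: indicator_def)
      show "(f (fst z))\<^sup>2 \<le> B\<^sup>2 * indicator {- h..h} (fst z)" for z
        using B[of "fst z"] bnd[of "fst z"] abs_le_square_iff[of "f (fst z)" B]
        by (cases "fst z \<in> {- h..h}") auto
    qed
    then show ?thesis by (simp add: win)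
  qed
  define Z where "Z i d = f (fst (d i)) - m" for i and d :: "nat \<Rightarrow> real \<times> real"
  have indZ: "M.indep_vars (\<lambda>_. borel) Z {1..N}"
  proof -
    have "M.indep_vars (\<lambda>_. D) (\<lambda>i d. d i) {1..N}"
      unfolding sample_law_def using N D.prob_space_axioms by (intro indep_vars_component) auto
    then show ?thesis unfolding Z_def by (rule M.indep_vars_compose2) simp
  qed
  have Zint: "integrable (sample_law N D) (\<lambda>d. (Z i d)\<^sup>2)" and Zmean: "M.expectation (Z i) = 0"
    and Zvar: "M.expectation (\<lambda>d. (Z i d)\<^sup>2) \<le> B\<^sup>2 * ?\<pi>" if i: "i \<in> {1..N}" for i
  proof -
    have gm: "(\<lambda>z. f (fst z) - m) \<in> borel_measurable D" by measurable
    have g2m: "(\<lambda>z. (f (fst z) - m)\<^sup>2) \<in> borel_measurable D" by measurable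
    have g2: "(\<lambda>z. (f (fst z) - m)\<^sup>2) = (\<lambda>z. (f (fst z))\<^sup>2 - 2 * m * f (fst z) + m\<^sup>2)"
      by (auto simp: power2_diff)
    have g2i: "integrable D (\<lambda>z. (f (fst z) - m)\<^sup>2)" unfolding g2 using fint f2int by simp
    show "integrable (sample_law N D) (\<lambda>d. (Z i d)\<^sup>2)"
      using integrable_distr_eq[OF comp(2)[OF i] g2m] g2i comp(1)[OF i] by (simp add: Z_def)
    show "M.expectation (Z i) = 0"
      using integral_distr[OF comp(2)[OF i] gm] comp(1)[OF i] fint by (simp add: Z_def[abs_def] m_def D.prob_space)
    have "M.expectation (\<lambda>d. (Z i d)\<^sup>2) = (\<integral>z. (f (fst z) - m)\<^sup>2 \<partial>D)"
      using integral_distr[OF comp(2)[OF i] g2m] comp(1)[OF i] by (simp add: Z_def)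
    also have "\<dots> = (\<integral>z. (f (fst z))\<^sup>2 \<partial>D) - m\<^sup>2"
      unfolding g2 using fint f2int by (simp add: D.prob_space power2_eq_square flip: m_def)
    also have "\<dots> \<le> B\<^sup>2 * ?\<pi>" using f2 zero_le_power2[of m] by linarith
    finally show "M.expectation (\<lambda>d. (Z i d)\<^sup>2) \<le> B\<^sup>2 * ?\<pi>" .
  qed
  note mom = M.second_moment_indep_sum[OF indZ _ Zint Zmean]
  have Np: "0 < real N * ?\<pi>" using N mass by simp
  define t where "t = e * (real N * ?\<pi>)"
  have t: "0 < t" using e Np by (simp add: t_def)
  have A_eq: "A = {d \<in> space (sample_law N D). t\<^sup>2 \<le> (\<Sum>i=1..N. Z i d)\<^sup>2}"
  proof -
    have "(e \<le> \<bar>(\<Sum>i=1..N. f (fst (d i))) / (real N * ?\<pi>) - m / ?\<pi>\<bar>) = (t\<^sup>2 \<le> (\<Sum>i=1..N. Z i d)\<^sup>2)" for d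
    proof -
      have "(\<Sum>i=1..N. Z i d) = (\<Sum>i=1..N. f (fst (d i))) - real N * m"
        by (simp add: Z_def sum_subtractf)
      then have "(\<Sum>i=1..N. f (fst (d i))) / (real N * ?\<pi>) - m / ?\<pi> = (\<Sum>i=1..N. Z i d) / (real N * ?\<pi>)"
        using Np N by (simp add: diff_divide_distrib)
      then have "(e \<le> \<bar>(\<Sum>i=1..N. f (fst (d i))) / (real N * ?\<pi>) - m / ?\<pi>\<bar>) =
          (t \<le> \<bar>\<Sum>i=1..N. Z i d\<bar>)"
        using Np by (simp add: t_def pos_le_divide_eq)
      also have "\<dots> = (t\<^sup>2 \<le> (\<Sum>i=1..N. Z i d)\<^sup>2)"
        using abs_le_square_iff[of t "\<Sum>i=1..N. Z i d"] t by simp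
      finally show ?thesis .
    qed
    then show ?thesis by (simp add: A_def m_def)
  qed
  show "A \<in> sets (sample_law N D)" unfolding A_def by measurable
  have "M.prob A \<le> M.expectation (\<lambda>d. (\<Sum>i=1..N. Z i d)\<^sup>2) / t\<^sup>2"
    unfolding A_eq using t mom(1) by (intro integral_Markov_inequality_measure[of _ _ "{}"]) auto
  also have "\<dots> = (\<Sum>i=1..N. M.expectation (\<lambda>d. (Z i d)\<^sup>2)) / t\<^sup>2"
    by (subst mom(2)) auto
  also have "\<dots> \<le> (\<Sum>i=1..N. B\<^sup>2 * ?\<pi>) / t\<^sup>2"
    by (intro divide_right_mono sum_mono Zvar) auto
  also have "\<dots> = B\<^sup>2 / e\<^sup>2 / (real N * ?\<pi>)"
    using Np e by (simp add: t_def power2_eq_square field_simps)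
  finally show "M.prob A \<le> B\<^sup>2 / e\<^sup>2 / (real N * ?\<pi>)" .
qed

section \<open>Scaled matrices and the asymptotic variance as integrals\<close>

lemma integrable_matrix:
  fixes F :: "'a \<Rightarrow> real^4^4"
  assumes "\<And>j k. integrable M (\<lambda>z. F z $ j $ k)"
  shows "integrable M F"
proof -
  have "F z = (\<Sum>j\<in>UNIV. \<Sum>k\<in>UNIV. F z $ j $ k *\<^sub>R axis j (axis k 1))" for z
  proof -
    have "(\<Sum>j\<in>UNIV. \<Sum>k\<in>UNIV. F z $ j $ k *\<^sub>R axis j (axis k 1)) $ a $ b = F z $ a $ b" for a b
    proof -
      have "(\<Sum>j\<in>UNIV. \<Sum>k\<in>UNIV. F z $ j $ k *\<^sub>R axis j (axis k 1)) $ a $ b =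
          (\<Sum>j\<in>UNIV. \<Sum>k\<in>UNIV. if j = a then if k = b then F z $ a $ b else 0 else 0)"
        unfolding sum_component by (intro sum.cong refl) (auto simp: axis_def)
      also have "\<dots> = (\<Sum>j\<in>UNIV. if j = a then F z $ a $ b else 0)"
        by (intro sum.cong refl) auto
      finally show ?thesis by simp
    qed
    then show ?thesis by (simp add: vec_eq_iff)
  qed
  moreover have "integrable M (\<lambda>z. \<Sum>j\<in>UNIV. \<Sum>k\<in>UNIV. F z $ j $ k *\<^sub>R (axis j (axis k 1) :: real^4^4))"
    using assms by (intro Bochner_Integration.integrable_sum integrable_scaleR_left)
  ultimately show ?thesis by simp
qed

lemma lambda_mat_nth:
  "lambda_mat h x $ j $ k = indicator {- h..h} x * (regr (x / h) $ j * regr (x / h) $ k)"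
  by (simp add: lambda_mat_def outer_def)

lemma lambda_mat_bound:
  assumes "0 < h"
  shows "\<bar>lambda_mat h x $ j $ k\<bar> \<le> 1 * indicator {- h..h} x"
proof (cases "\<bar>x\<bar> \<le> h")
  case True
  have "\<bar>regr (x / h) $ j\<bar> * \<bar>regr (x / h) $ k\<bar> \<le> 1 * 1"
    using regr_scale_bound[OF assms True] by (intro mult_mono) auto
  then show ?thesis using True by (auto simp: lambda_mat_nth abs_mult indicator_def)
next
  case False
  then show ?thesis by (auto simp: lambda_mat_nth indicator_def)
qed

lemma lambda_mat_le_1: "0 < h \<Longrightarrow> \<bar>lambda_mat h x $ j $ k\<bar> \<le> 1"
  by (rule order_trans[OF lambda_mat_bound]) (auto simp: indicator_def)

lemma diag_scale_window:
  assumes h: "0 < h"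
  shows "outer (window_regr h x) $ j $ k / (regr h $ j * regr h $ k) = lambda_mat h x $ j $ k"
  by (simp add: outer_def window_regr_def lambda_mat_nth regr_scale[OF h] indicator_def)

lemma diag_scale_Q_hat:
  assumes h: "0 < h"
  shows "diag_scale h (Q_hat N h d) $ j $ k =
    (\<Sum>i=1..N. lambda_mat h (fst (d i)) $ j $ k) / real (N_window N h d)"
  by (simp add: diag_scale_def Q_hat_def sum_divide_distrib mult.commute flip: diag_scale_window[OF h])

lemma lambda_mat_measurable: "(\<lambda>x. lambda_mat h x $ j $ k) \<in> borel_measurable borel"
  unfolding lambda_mat_nth by measurable

lemma Q_pop_scaled_nth:
  assumes D: "error_design D" and h: "0 < h"
  shows "Q_pop_scaled D h $ j $ k = (\<integral>z. lambda_mat h (fst z) $ j $ k \<partial>D) / window_mass D h"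
proof -
  interpret D: prob_space D by (rule error_designD[OF D])
  note fst_D [measurable] = error_design_fst_measurable[OF D]
  have int: "integrable D (\<lambda>z. outer (window_regr h (fst z)) $ j $ k)" for j k
  proof -
    have "integrable D (\<lambda>z. lambda_mat h (fst z) $ j $ k)"
      using lambda_mat_le_1[OF h] measurable_compose[OF fst_D lambda_mat_measurable]
      by (intro D.integrable_const_bound[where B = 1]) auto
    then have "integrable D (\<lambda>z. regr h $ j * regr h $ k * (lambda_mat h (fst z) $ j $ k))" by simp
    moreover have "regr h $ j * regr h $ k * (lambda_mat h x $ j $ k) = outer (window_regr h x) $ j $ k" for x
      using diag_scale_window[OF h, of x j k] regr_pos[OF h, of j] regr_pos[OF h, of k] by (simp add: field_simps)
    ultimately show ?thesis by simp
  qed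
  have bl: "bounded_linear (\<lambda>A :: real^4^4. A $ j $ k)"
    by (rule bounded_linear_compose[OF bounded_linear_vec_nth bounded_linear_vec_nth])
  have "Q_pop_scaled D h $ j $ k = (1 / window_mass D h) * (\<integral>z. outer (window_regr h (fst z)) \<partial>D) $ j $ k /
      (regr h $ j * regr h $ k)"
    unfolding Q_pop_scaled_def diag_scale_eq[OF h] by (simp add: diag_scale_def Q_pop_def)
  also have "(\<integral>z. outer (window_regr h (fst z)) \<partial>D) $ j $ k = (\<integral>z. outer (window_regr h (fst z)) $ j $ k \<partial>D)"
    using integral_bounded_linear[OF bl integrable_matrix[OF int]] by simp
  finally show ?thesis
    by (simp add: diag_scale_window[OF h, symmetric])
qed

text \<open>Off the support the conditioning event is null, so \<open>given_x\<close> is the zero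
  measure and every integral against it is 0. As a consequence \<open>cond_var\<close> is nonzero at
  finitely many points only, hence Borel.\<close>

lemma cond_var_off_support:
  assumes D: "error_design D" and x: "x \<notin> x_support D"
  shows "cond_var D x = 0"
proof -
  interpret D: prob_space D by (rule error_designD[OF D])
  let ?A = "{z :: real \<times> real. fst z = x}"
  have A: "?A \<in> sets D" using sets_fst_eq error_designD(2)[OF D] by simp
  have "measure D ?A = 0" using x by (simp add: x_support_def zero_less_measure_iff)
  then have 0: "emeasure D ?A = 0" by (simp add: D.emeasure_eq_measure)
  then have "AE z in D. z \<notin> ?A" using A by (intro AE_not_in) (simp add: null_sets_def)
  moreover have "(\<lambda>z. indicator ?A z / emeasure D ?A) \<in> borel_measurable D"
    using borel_measurable_indicator[OF A] by (intro borel_measurable_divide_ennreal) auto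
  ultimately have "AE z in given_x D x. False"
    unfolding given_x_def uniform_measure_def
    by (subst AE_density) (auto elim: eventually_mono simp: indicator_def)
  then show "cond_var D x = 0"
    unfolding cond_var_def by (intro integral_eq_zero_AE) (auto elim: eventually_mono)
qed

lemma cond_var_measurable:
  assumes D: "error_design D"
  shows "cond_var D \<in> borel_measurable borel"
proof -
  have "cond_var D = (\<lambda>x. \<Sum>y\<in>x_support D. indicator {y} x * cond_var D y)"
  proof
    fix x
    have "(\<Sum>y\<in>x_support D. indicator {y} x * cond_var D y) = (\<Sum>y\<in>x_support D. if y = x then cond_var D x else 0)"
      by (intro sum.cong) (auto simp: indicator_def)
    then show "cond_var D x = (\<Sum>y\<in>x_support D. indicator {y} x * cond_var D y)"
      using cond_var_off_support[OF D] error_designD(4)[OF D] by simp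
  qed
  also have "\<dots> \<in> borel_measurable borel" by measurable
  finally show ?thesis .
qed

lemma det_scale_mat: "0 < h \<Longrightarrow> det (scale_mat h) \<noteq> 0"
  by (subst det_diagonal) (auto simp: scale_mat_def prod_zero_iff dest: regr_pos[THEN less_imp_neq])

text \<open>With H the scaling, H times the inverse of \<open>Q_pop\<close> times H is the inverse
  of \<open>Q_pop_scaled\<close>. It is symmetric, so the variance is a quadratic form in
  \<open>Omega_pop\<close>, and a bounded linear functional may be moved inside the
  integral.\<close>

lemma sigma2_tau_eq:
  assumes D: "error_design D" and h: "0 < h" and det: "det (Q_pop_scaled D h) \<noteq> 0"
    and V: "\<And>x. \<bar>cond_var D x\<bar> \<le> V"
  shows "sigma2_tau D h = (\<integral>z. cond_var D (fst z) * (indicator {- h..h} (fst z) *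
      ((matrix_inv (Q_pop_scaled D h) *v e1) \<bullet> regr (fst z / h))\<^sup>2) \<partial>D) / window_mass D h"
proof -
  interpret D: prob_space D by (rule error_designD[OF D])
  note fst_D [measurable] = error_design_fst_measurable[OF D]
  define H where "H = scale_mat h"
  define Hi where "Hi = matrix_inv H"
  define A where "A = Q_pop D h"
  define P where "P = H ** matrix_inv A ** H"
  have HH: "Hi ** H = mat 1" "H ** Hi = mat 1"
    using matrix_inv_mult[OF det_scale_mat[OF h]] by (simp_all add: Hi_def H_def)
  have Qs: "Q_pop_scaled D h = Hi ** A ** Hi" by (simp add: Q_pop_scaled_def Hi_def H_def A_def)
  have detA: "det A \<noteq> 0" using det unfolding Qs by (simp add: det_mul)
  have "(Hi ** A ** Hi) ** P = Hi ** (A ** ((Hi ** H) ** matrix_inv A)) ** H"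
    by (simp add: P_def matrix_mul_assoc)
  also have "\<dots> = mat 1" by (simp add: HH matrix_inv_mult[OF detA])
  finally have P: "matrix_inv (Q_pop_scaled D h) = P" unfolding Qs by (rule matrix_inv_eqI)
  have "transpose (Q_pop_scaled D h) = Q_pop_scaled D h"
    by (simp add: vec_eq_iff transpose_def Q_pop_scaled_nth[OF D h] lambda_mat_nth mult.commute mult.left_commute)
  then have PT: "transpose P = P"
    using transpose_matrix_inv_symmetric[OF det] by (simp add: P)
  define u where "u = P *v e1"
  have "sigma2_tau D h = e1 \<bullet> ((P ** Omega_pop D h ** P) *v e1)"
    by (simp add: sigma2_tau_def Let_def P_def H_def A_def matrix_mul_assoc)
  also have "\<dots> = u \<bullet> (Omega_pop D h *v u)" unfolding u_def by (rule sandwich_form[OF PT])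
  also have "\<dots> = (1 / window_mass D h) * (u \<bullet> ((\<integral>z. cond_var D (fst z) *\<^sub>R lambda_mat h (fst z) \<partial>D) *v u))"
    unfolding Omega_pop_def by (simp add: linear_scale[OF linear_quadratic_form])
  also have "u \<bullet> ((\<integral>z. cond_var D (fst z) *\<^sub>R lambda_mat h (fst z) \<partial>D) *v u) =
      (\<integral>z. u \<bullet> ((cond_var D (fst z) *\<^sub>R lambda_mat h (fst z)) *v u) \<partial>D)"
  proof (rule integral_bounded_linear[symmetric])
    show "bounded_linear (\<lambda>A :: real^4^4. u \<bullet> (A *v u))"
      using linear_quadratic_form by (simp add: linear_conv_bounded_linear)
    show "integrable D (\<lambda>z. cond_var D (fst z) *\<^sub>R lambda_mat h (fst z))"
    proof (rule integrable_matrix)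
      fix j k
      have V0: "0 \<le> V" using V[of 0] by linarith
      have "\<bar>cond_var D x\<bar> * \<bar>lambda_mat h x $ j $ k\<bar> \<le> V * 1" for x
        using V V0 lambda_mat_le_1[OF h] by (intro mult_mono) auto
      then show "integrable D (\<lambda>z. (cond_var D (fst z) *\<^sub>R lambda_mat h (fst z)) $ j $ k)"
        using measurable_compose[OF fst_D cond_var_measurable[OF D]] measurable_compose[OF fst_D lambda_mat_measurable]
        by (intro D.integrable_const_bound[where B = V]) (auto simp: abs_mult)
    qed
  qed
  also have "\<dots> = (\<integral>z. cond_var D (fst z) * (indicator {- h..h} (fst z) * (u \<bullet> regr (fst z / h))\<^sup>2) \<partial>D)"
    by (simp add: linear_scale[OF linear_quadratic_form] lambda_mat_def quadratic_form_outer mult.assoc)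
  finally show ?thesis by (simp add: u_def P)
qed

text \<open>The common integrand of two variances: with the population coefficients its integral
  over the window mass is \<open>sigma2_tau\<close>, and with the sample coefficients its sum over
  the squared window count is \<open>sampling_var\<close>.\<close>

definition local_var :: "(real \<times> real) measure \<Rightarrow> real \<Rightarrow> real ^ 4 \<Rightarrow> real \<Rightarrow> real" where
  "local_var D h u x = cond_var D x * (indicator {- h..h} x * (u \<bullet> regr (x / h))\<^sup>2)"

lemma inner_regr_bound:
  assumes h: "0 < h" and x: "\<bar>x\<bar> \<le> h"
  shows "\<bar>u \<bullet> regr (x / h)\<bar> \<le> (\<Sum>k\<in>UNIV. \<bar>u $ k\<bar>)"
proof -
  have "\<bar>u \<bullet> regr (x / h)\<bar> \<le> (\<Sum>k\<in>UNIV. \<bar>u $ k * regr (x / h) $ k\<bar>)"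
    unfolding inner_vec_def by (simp add: sum_abs)
  also have "\<dots> \<le> (\<Sum>k\<in>UNIV. \<bar>u $ k\<bar> * 1)"
    unfolding abs_mult using regr_scale_bound[OF h x] by (intro sum_mono mult_left_mono) auto
  finally show ?thesis by simp
qed

lemma local_var_bound:
  assumes h: "0 < h" and V: "0 \<le> cond_var D x" "cond_var D x \<le> V"
  shows "\<bar>local_var D h u x\<bar> \<le> (V * (\<Sum>k\<in>UNIV. \<bar>u $ k\<bar>)\<^sup>2) * indicator {- h..h} x"
proof (cases "\<bar>x\<bar> \<le> h")
  case True
  have "(u \<bullet> regr (x / h))\<^sup>2 \<le> (\<Sum>k\<in>UNIV. \<bar>u $ k\<bar>)\<^sup>2"
    using inner_regr_bound[OF h True, of u] abs_le_square_iff[of "u \<bullet> regr (x / h)" "\<Sum>k\<in>UNIV. \<bar>u $ k\<bar>"]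
    by (simp add: sum_nonneg)
  then have "cond_var D x * (u \<bullet> regr (x / h))\<^sup>2 \<le> V * (\<Sum>k\<in>UNIV. \<bar>u $ k\<bar>)\<^sup>2"
    using V by (intro mult_mono) auto
  then show ?thesis using True V by (auto simp: local_var_def indicator_def abs_mult)
next
  case False
  then have "x \<notin> {- h..h}" by auto
  then show ?thesis by (simp add: local_var_def)
qed

lemma local_var_measurable:
  assumes "error_design D"
  shows "local_var D h u \<in> borel_measurable borel"
proof -
  note [measurable] = cond_var_measurable[OF assms]
  have "(\<lambda>x. u \<bullet> regr (x / h)) = (\<lambda>x. \<Sum>k\<in>UNIV. u $ k * regr (x / h) $ k)"
    by (simp add: inner_vec_def)
  also have "\<dots> \<in> borel_measurable borel" by measurable
  finally have [measurable]: "(\<lambda>x. u \<bullet> regr (x / h)) \<in> borel_measurable borel" .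
  show ?thesis unfolding local_var_def[abs_def] by measurable
qed

lemma local_var_integrable:
  assumes D: "error_design D" and h: "0 < h" and V: "\<And>x. 0 \<le> cond_var D x" "\<And>x. cond_var D x \<le> V"
  shows "integrable D (\<lambda>z. local_var D h u (fst z))"
proof -
  interpret D: prob_space D by (rule error_designD[OF D])
  note fst_D = error_design_fst_measurable[OF D]
  let ?B = "V * (\<Sum>k\<in>UNIV. \<bar>u $ k\<bar>)\<^sup>2"
  have "0 \<le> V" using V order_trans by blast
  then have "\<bar>local_var D h u x\<bar> \<le> ?B" for x
    by (intro order_trans[OF local_var_bound[OF h V]]) (auto simp: indicator_def)
  then show ?thesis
    using measurable_compose[OF fst_D local_var_measurable[OF D]]
    by (intro D.integrable_const_bound[where B = ?B]) auto
qed

lemma square_diff_bound: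
  fixes a b C e :: real
  assumes "\<bar>a\<bar> \<le> C" "\<bar>b\<bar> \<le> C" "\<bar>a - b\<bar> \<le> e"
  shows "\<bar>a\<^sup>2 - b\<^sup>2\<bar> \<le> 2 * C * e"
proof -
  have "\<bar>a\<^sup>2 - b\<^sup>2\<bar> = \<bar>a + b\<bar> * \<bar>a - b\<bar>"
    by (simp add: power2_eq_square algebra_simps flip: abs_mult)
  also have "\<dots> \<le> (2 * C) * e" using assms by (intro mult_mono) auto
  finally show ?thesis .
qed

lemma N_window_eq_sum: "real (N_window N h d) = (\<Sum>i=1..N. indicator {- h..h} (fst (d i)))"
  unfolding N_window_def card_filter_eq_sum by (intro sum.cong refl) (auto simp: indicator_def)

text \<open>With sample coefficients, \<open>local_var\<close> is not a sum of independent terms.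
  The law of large numbers is therefore used only at the fixed vector \<open>u0\<close> of the limit
  matrix, and the population and sample coefficients are both compared with \<open>u0\<close>. The
  constant \<open>C\<close> bounds the scaled weights of every vector within 1 of \<open>u0\<close>
  in each of the four coordinates.\<close>

lemma good_design_of_close:
  fixes A0 :: "real^4^4"
  defines "u0 \<equiv> matrix_inv A0 *v e1"
  defines "C \<equiv> (\<Sum>k\<in>UNIV. \<bar>u0 $ k\<bar>) + 4"
  assumes D: "error_design D" and h: "0 < h" and N: "1 \<le> N" and mass: "0 < window_mass D h"
    and e: "0 < e" "e \<le> 1" and \<gamma>: "0 \<le> \<gamma>" "\<gamma> \<le> 1 / 2"
    and cont: "\<And>A. (\<And>i j. \<bar>A $ i $ j - A0 $ i $ j\<bar> \<le> 3 * \<gamma>) \<Longrightarrow>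
      det A \<noteq> 0 \<and> (\<forall>k. \<bar>(matrix_inv A *v e1) $ k - u0 $ k\<bar> \<le> e)"
    and pop: "\<And>j k. \<bar>Q_pop_scaled D h $ j $ k - A0 $ j $ k\<bar> \<le> \<gamma>"
    and samp_n: "\<bar>(\<Sum>i=1..N. indicator {- h..h} (fst (d i))) / (real N * window_mass D h) - 1\<bar> \<le> \<gamma>"
    and samp_q: "\<And>j k. \<bar>(\<Sum>i=1..N. lambda_mat h (fst (d i)) $ j $ k) / (real N * window_mass D h) -
      Q_pop_scaled D h $ j $ k\<bar> \<le> \<gamma>"
    and samp_v: "\<bar>(\<Sum>i=1..N. local_var D h u0 (fst (d i))) / (real N * window_mass D h) -
      (\<integral>z. local_var D h u0 (fst z) \<partial>D) / window_mass D h\<bar> \<le> c / 8"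
    and cells: "\<And>x. x \<in> window_points D h \<Longrightarrow> 2 \<le> cell_count N d x"
    and c: "0 < c" "c \<le> sigma2_tau D h"
    and V: "\<And>x. 0 \<le> cond_var D x" "\<And>x. cond_var D x \<le> V"
    and small: "V * (8 * C * e) \<le> c / 8"
    and \<rho>: "0 < \<rho>" and big: "16 * C ^ 4 / (c\<^sup>2 * \<rho>) \<le> real N * window_mass D h"
  shows "good_design \<rho> D N h d"
proof -
  interpret D: prob_space D by (rule error_designD[OF D])
  note fst_D [measurable] = error_design_fst_measurable[OF D]
  let ?\<pi> = "window_mass D h"
  let ?I = "indicator {- h..h} :: real \<Rightarrow> real"
  define m where "m = real N * ?\<pi>"
  define n where "n = real (N_window N h d)"
  have m: "0 < m" using N mass by (simp add: m_def)
  have C4: "4 \<le> C" by (simp add: C_def sum_nonneg)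
  have V0: "0 \<le> V" using V order_trans by blast
  have nm: "\<bar>n / m - 1\<bar> \<le> \<gamma>" using samp_n by (simp add: n_def m_def N_window_eq_sum)
  have nm_lo: "m / 2 \<le> n" and nm_hi: "n \<le> 3 / 2 * m"
  proof -
    have "1 / 2 \<le> n / m" "n / m \<le> 3 / 2" using nm \<gamma> by linarith+
    then show "m / 2 \<le> n" "n \<le> 3 / 2 * m" using m by (simp_all add: field_simps)
  qed
  have n: "0 < n" using nm_lo m by linarith
  define A where "A = diag_scale h (Q_hat N h d)"
  \<comment> \<open>Three errors of at most \<gamma> each: the normalization by the actual instead
    of the expected window count, the sampling error, and the distance of the population matrix from
    its limit.\<close>
  have A_close: "\<bar>A $ j $ k - A0 $ j $ k\<bar> \<le> 3 * \<gamma>" for j k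
  proof -
    define s where "s = (\<Sum>i=1..N. lambda_mat h (fst (d i)) $ j $ k)"
    have A: "A $ j $ k = s / n" by (simp add: A_def diag_scale_Q_hat[OF h] s_def n_def)
    have "\<bar>s\<bar> \<le> (\<Sum>i=1..N. \<bar>lambda_mat h (fst (d i)) $ j $ k\<bar>)" unfolding s_def by (rule sum_abs)
    also have "\<dots> \<le> n" unfolding n_def N_window_eq_sum using lambda_mat_bound[OF h] by (intro sum_mono) simp
    finally have s: "\<bar>s\<bar> \<le> n" .
    have "s / n - s / m = - (s / n) * (n / m - 1)" using n m by (simp add: field_simps)
    then have "\<bar>s / n - s / m\<bar> = \<bar>s / n\<bar> * \<bar>n / m - 1\<bar>" by (simp add: abs_mult)
    also have "\<dots> \<le> 1 * \<gamma>" using s n nm by (intro mult_mono) (auto simp: abs_div)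
    finally have "\<bar>s / n - s / m\<bar> \<le> \<gamma>" by simp
    then show ?thesis using samp_q[of j k] pop[of j k] unfolding A s_def[symmetric] m_def[symmetric] by linarith
  qed
  define u where "u = matrix_inv A *v e1"
  have detA: "det A \<noteq> 0" and u: "\<And>k. \<bar>u $ k - u0 $ k\<bar> \<le> e"
    using cont[OF A_close] by (auto simp: u_def)
  have det: "det (Q_hat N h d) \<noteq> 0" using det_diag_scale_nonzero[OF h] detA by (simp add: A_def)
  define up where "up = matrix_inv (Q_pop_scaled D h) *v e1"
  have pop3: "\<bar>Q_pop_scaled D h $ i $ j - A0 $ i $ j\<bar> \<le> 3 * \<gamma>" for i j using pop[of i j] \<gamma>(1) by linarith
  have detP: "det (Q_pop_scaled D h) \<noteq> 0" and up: "\<And>k. \<bar>up $ k - u0 $ k\<bar> \<le> e"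
    using cont[OF pop3] by (auto simp: up_def)
  have near: "\<bar>v \<bullet> regr (x / h)\<bar> \<le> C" "\<bar>(v \<bullet> regr (x / h))\<^sup>2 - (u0 \<bullet> regr (x / h))\<^sup>2\<bar> \<le> 8 * C * e"
    if v: "\<And>k. \<bar>v $ k - u0 $ k\<bar> \<le> e" and x: "\<bar>x\<bar> \<le> h" for v x
  proof -
    have "(\<Sum>k\<in>UNIV. \<bar>v $ k\<bar>) \<le> (\<Sum>k\<in>UNIV. \<bar>u0 $ k\<bar> + e)"
      using v by (intro sum_mono) (smt (verit))
    then have "(\<Sum>k\<in>UNIV. \<bar>v $ k\<bar>) \<le> C" using e by (simp add: sum.distrib C_def)
    then show 1: "\<bar>v \<bullet> regr (x / h)\<bar> \<le> C" using inner_regr_bound[OF h x, of v] by linarith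
    have 2: "\<bar>u0 \<bullet> regr (x / h)\<bar> \<le> C" using inner_regr_bound[OF h x, of u0] by (simp add: C_def)
    have "\<bar>(v - u0) \<bullet> regr (x / h)\<bar> \<le> (\<Sum>k\<in>UNIV. \<bar>(v - u0) $ k\<bar>)" by (rule inner_regr_bound[OF h x])
    also have "\<dots> \<le> (\<Sum>(k::4)\<in>UNIV. e)" using v by (intro sum_mono) simp
    finally have "\<bar>v \<bullet> regr (x / h) - u0 \<bullet> regr (x / h)\<bar> \<le> 4 * e" by (simp add: inner_diff_left)
    from square_diff_bound[OF 1 2 this]
    show "\<bar>(v \<bullet> regr (x / h))\<^sup>2 - (u0 \<bullet> regr (x / h))\<^sup>2\<bar> \<le> 8 * C * e" by simp
  qed
  have lv_near: "\<bar>local_var D h v x - local_var D h u0 x\<bar> \<le> c / 8 * ?I x"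
    if v: "\<And>k. \<bar>v $ k - u0 $ k\<bar> \<le> e" for v x
  proof (cases "\<bar>x\<bar> \<le> h")
    case True
    then have "?I x = 1" by (auto simp: indicator_def)
    then have "\<bar>local_var D h v x - local_var D h u0 x\<bar> =
        cond_var D x * \<bar>(v \<bullet> regr (x / h))\<^sup>2 - (u0 \<bullet> regr (x / h))\<^sup>2\<bar>"
      using V(1)[of x] by (simp add: local_var_def abs_mult flip: right_diff_distrib)
    also have "\<dots> \<le> V * (8 * C * e)" using near(2)[OF v True] V V0 by (intro mult_mono) auto
    finally show ?thesis using small \<open>?I x = 1\<close> by simp
  next
    case False
    then have "x \<notin> {- h..h}" by auto
    then show ?thesis by (simp add: local_var_def)
  qed
  note win = window_mass_eq_integral[OF D, of h]
  have Iint: "integrable D (\<lambda>z. c / 8 * ?I (fst z))"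
    by (rule D.integrable_const_bound[where B = "c / 8"]) (use c in \<open>auto simp: indicator_def\<close>)
  note lvint = local_var_integrable[OF D h V]
  have "\<bar>cond_var D x\<bar> \<le> V" for x using V by simp
  then have "sigma2_tau D h = (\<integral>z. local_var D h up (fst z) \<partial>D) / ?\<pi>"
    unfolding local_var_def up_def by (rule sigma2_tau_eq[OF D h detP])
  also have "\<dots> \<le> (\<integral>z. local_var D h u0 (fst z) + c / 8 * ?I (fst z) \<partial>D) / ?\<pi>"
  proof (intro divide_right_mono integral_mono lvint Bochner_Integration.integrable_add Iint)
    show "local_var D h up (fst z) \<le> local_var D h u0 (fst z) + c / 8 * ?I (fst z)" for z
      using lv_near[OF up, of "fst z"] by linarith
  qed (use mass in simp)
  also have "\<dots> = (\<integral>z. local_var D h u0 (fst z) \<partial>D) / ?\<pi> + c / 8"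
    using mass
    by (subst Bochner_Integration.integral_add[OF lvint Iint]) (simp add: win add_divide_distrib)
  \<comment> \<open>One c/8 is lost in passing from the population coefficients to
    \<open>u0\<close>, another to sampling.\<close>
  finally have "3 / 4 * c \<le> (\<Sum>i=1..N. local_var D h u0 (fst (d i))) / m"
    using c samp_v unfolding m_def by linarith
  then have "3 / 4 * c * m \<le> (\<Sum>i=1..N. local_var D h u0 (fst (d i)))"
    using m by (simp add: pos_le_divide_eq)
  also have "\<dots> \<le> (\<Sum>i=1..N. local_var D h u (fst (d i)) + c / 8 * ?I (fst (d i)))"
    using lv_near[OF u] by (intro sum_mono) (smt (verit))
  also have "\<dots> = (\<Sum>i=1..N. local_var D h u (fst (d i))) + c / 8 * n"
    by (simp add: sum.distrib n_def N_window_eq_sum sum_distrib_left)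
  \<comment> \<open>The window count is at most 3/2 of its expectation, and passing to the sample
    coefficients loses c/8 per observation in the window: 3/4 * 2/3 - 1/8 = 3/8.\<close>
  finally have lv: "3 / 8 * c * n \<le> (\<Sum>i=1..N. local_var D h u (fst (d i)))"
  proof -
    assume *: "3 / 4 * c * m \<le> (\<Sum>i=1..N. local_var D h u (fst (d i))) + c / 8 * n"
    have "c * n \<le> c * (3 / 2 * m)" using nm_hi c by (intro mult_left_mono) auto
    then show ?thesis using * by (simp add: field_simps)
  qed
  have w: "weight N h d x = 1 / n * (?I x * (u \<bullet> regr (x / h)))" for x
    unfolding weight_eq[OF det] ols_coef_def n_def u_def A_def
    by (subst scaled_inner[OF h]) (use detA in \<open>simp_all add: A_def\<close>)
  have sv: "sampling_var D N h d = (\<Sum>i=1..N. local_var D h u (fst (d i))) / n\<^sup>2"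
    unfolding sampling_var_def sum_divide_distrib w local_var_def
    by (intro sum.cong refl) (simp add: power_mult_distrib power_divide indicator_def)
  have sv_lo: "3 / 8 * c / n \<le> sampling_var D N h d"
    using lv n unfolding sv by (simp add: power2_eq_square field_simps)
  have w4: "(\<Sum>i=1..N. weight N h d (fst (d i)) ^ 4) \<le> C ^ 4 / n ^ 3"
  proof -
    have "weight N h d x ^ 4 \<le> C ^ 4 / n ^ 4 * ?I x" for x
    proof (cases "\<bar>x\<bar> \<le> h")
      case True
      have "(u \<bullet> regr (x / h)) ^ 4 = \<bar>u \<bullet> regr (x / h)\<bar> ^ 4" by simp
      also have "\<dots> \<le> C ^ 4" using near(1)[OF u True] by (intro power_mono) auto
      finally have "(u \<bullet> regr (x / h)) ^ 4 / n ^ 4 \<le> C ^ 4 / n ^ 4" by (intro divide_right_mono) auto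
      moreover have "?I x = 1" using True by (auto simp: indicator_def)
      ultimately show ?thesis by (simp add: w power_divide)
    next
      case False
      then have "x \<notin> {- h..h}" by auto
      then show ?thesis by (simp add: w)
    qed
    then have "(\<Sum>i=1..N. weight N h d (fst (d i)) ^ 4) \<le> (\<Sum>i=1..N. C ^ 4 / n ^ 4 * ?I (fst (d i)))"
      by (intro sum_mono)
    also have "\<dots> = C ^ 4 / n ^ 4 * n" by (simp add: n_def N_window_eq_sum sum_distrib_left)
    also have "\<dots> = C ^ 4 / n ^ 3" using n by (simp add: power4_eq_xxxx power3_eq_cube)
    finally show ?thesis .
  qed
  \<comment> \<open>The ratio to be bounded is at most 64 C^4/(9 c^2 n), so 8 C^4 <= n c^2 \<rho> is
    enough. The constant 16 in the hypothesis allows for n being only half of its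
    expectation.\<close>
  have "C ^ 4 / n ^ 3 \<le> \<rho> * (3 / 8 * c / n)\<^sup>2"
  proof -
    have "16 * C ^ 4 / (c\<^sup>2 * \<rho>) \<le> m" using big by (simp add: m_def)
    then have "16 * C ^ 4 \<le> m * (c\<^sup>2 * \<rho>)" using c \<rho> by (simp add: pos_divide_le_eq)
    also have "\<dots> \<le> (2 * n) * (c\<^sup>2 * \<rho>)" using nm_lo c \<rho> by (intro mult_right_mono) auto
    finally have "8 * C ^ 4 \<le> n * (c\<^sup>2 * \<rho>)" by (simp add: mult_ac)
    moreover have "0 \<le> C ^ 4" using C4 by simp
    ultimately have "C ^ 4 \<le> 9 / 64 * (n * (c\<^sup>2 * \<rho>))" by linarith
    then have "C ^ 4 / n ^ 3 \<le> 9 / 64 * (n * (c\<^sup>2 * \<rho>)) / n ^ 3" using n by (intro divide_right_mono) auto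
    also have "\<dots> = \<rho> * (3 / 8 * c / n)\<^sup>2" using n by (simp add: power2_eq_square power3_eq_cube)
    finally show ?thesis .
  qed
  also have "\<dots> \<le> \<rho> * (sampling_var D N h d)\<^sup>2"
    using sv_lo c n \<rho> by (intro mult_left_mono power_mono) auto
  finally have "(\<Sum>i=1..N. weight N h d (fst (d i)) ^ 4) \<le> \<rho> * (sampling_var D N h d)\<^sup>2"
    using w4 by linarith
  moreover have "0 < sampling_var D N h d"
    using sv_lo c n by (smt (verit) divide_pos_pos mult_pos_pos)
  ultimately show ?thesis using det cells by (simp add: good_design_def)
qed

text \<open>A finite nonnegative integral yields integrability together with the bound, which a
  bound on the Bochner integral alone would not. The variance bound comes from y^2 <= 1 +
  y^4.\<close>

lemma moments_of_fourth:
  assumes D: "error_design D" and x: "x \<in> x_support D" and V: "0 \<le> V"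
    and m4: "(\<integral>\<^sup>+z. ennreal (snd z ^ 4) \<partial>given_x D x) \<le> ennreal V"
  shows "integrable (given_x D x) (\<lambda>z. snd z ^ 4)" "(\<integral>z. snd z ^ 4 \<partial>given_x D x) \<le> V"
    "0 \<le> cond_var D x" "cond_var D x \<le> 1 + V"
proof -
  interpret G: prob_space "given_x D x" by (rule given_x_space[OF D x])
  note snd_m [measurable] = given_x_space(4)[OF D x]
  show int: "integrable (given_x D x) (\<lambda>z. snd z ^ 4)"
    using m4 by (intro integrableI_bounded) (auto intro: le_less_trans)
  have "ennreal (\<integral>z. snd z ^ 4 \<partial>given_x D x) \<le> ennreal V"
    using m4 nn_integral_eq_integral[OF int] by simp
  then show le: "(\<integral>z. snd z ^ 4 \<partial>given_x D x) \<le> V" using V by simp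
  show "0 \<le> cond_var D x" by (simp add: cond_var_eq[OF D x])
  have int2: "integrable (given_x D x) (\<lambda>z. (snd z)\<^sup>2)"
    by (rule integrable_power_le[OF G.finite_measure_axioms snd_m int]) auto
  have "(snd z)\<^sup>2 \<le> 1 + snd z ^ 4" for z :: "real \<times> real"
  proof -
    have "0 \<le> ((snd z)\<^sup>2 - 1)\<^sup>2 + (snd z)\<^sup>2" by simp
    then show ?thesis by (simp add: power2_diff flip: power_mult)
  qed
  then have "(\<integral>z. (snd z)\<^sup>2 \<partial>given_x D x) \<le> (\<integral>z. 1 + snd z ^ 4 \<partial>given_x D x)"
    using int int2 by (intro integral_mono) auto
  also have "\<dots> \<le> 1 + V" using int le by (simp add: G.prob_space)
  finally show "cond_var D x \<le> 1 + V" by (simp add: cond_var_eq[OF D x])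
qed

text \<open>The bad event is a union of the small-cell event and finitely many concentration
  failures, each of probability of order one over the expected window count. The tolerances depend
  on the limit matrix and the uniform bounds only, so they are fixed before N.\<close>

lemma good_design_likely:
  fixes D :: "nat \<Rightarrow> (real \<times> real) measure" and h :: "nat \<Rightarrow> real"
  assumes design: "\<And>N. 1 \<le> N \<Longrightarrow> error_design (D N)"
    and bandwidth: "\<And>N. 1 \<le> N \<Longrightarrow> 0 < h N"
    and V: "\<And>N x. 1 \<le> N \<Longrightarrow> 0 \<le> cond_var (D N) x" "\<And>N x. 1 \<le> N \<Longrightarrow> cond_var (D N) x \<le> V"
    and det_bound: "0 < a" "\<And>N. 1 \<le> N \<Longrightarrow> a < det (Q_pop_scaled (D N) (h N))"
    and window_size: "filterlim (\<lambda>N. real N * window_mass (D N) (h N)) at_top sequentially"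
    and Q_limit: "(\<lambda>N. Q_pop_scaled (D N) (h N)) \<longlonglongrightarrow> A0"
    and sigma: "0 < c" "\<And>N. 1 \<le> N \<Longrightarrow> c \<le> sigma2_tau (D N) (h N)"
    and cells:
      "(\<lambda>N. measure (sample_law N (D N))
          {d \<in> space (sample_law N (D N)).
             0 < (\<Sum>x\<in>window_points (D N) (h N). if cell_count N d x \<le> 1 then 1 else 0 :: nat)})
         \<longlonglongrightarrow> 0"
    and \<rho>: "0 < \<rho>" and \<delta>: "0 < \<delta>"
  shows "eventually (\<lambda>N. \<exists>G\<in>sets (sample_law N (D N)). 1 - \<delta> \<le> measure (sample_law N (D N)) G \<and>
    (\<forall>d\<in>G. good_design \<rho> (D N) N (h N) d)) sequentially"
proof -
  let ?M = "\<lambda>N. sample_law N (D N)"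
  define u0 where "u0 = matrix_inv A0 *v e1"
  define s where "s = (\<Sum>k\<in>UNIV. \<bar>u0 $ k\<bar>)"
  define C where "C = s + 4"
  have C: "4 \<le> C" by (simp add: C_def s_def sum_nonneg)
  have V0: "0 \<le> V" using V[of 1 0] by simp
  have detA0: "det A0 \<noteq> 0"
  proof -
    have "(\<lambda>N. det (Q_pop_scaled (D N) (h N))) \<longlonglongrightarrow> det A0"
      unfolding det_def by (intro tendsto_intros Q_limit)
    then have "a \<le> det A0"
      using det_bound(2) by (intro tendsto_lowerbound[of _ "det A0" sequentially a])
        (auto intro!: eventually_sequentiallyI[of 1] less_imp_le)
    then show ?thesis using det_bound(1) by simp
  qed
  \<comment> \<open>Chosen so that replacing one coefficient vector by another within
    \<open>e\<close> of it in each coordinate changes \<open>local_var\<close> by at most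
    c/8.\<close>
  define e where "e = min 1 (c / (64 * C * (V + 1)))"
  have e: "0 < e" "e \<le> 1" and small: "V * (8 * C * e) \<le> c / 8"
  proof -
    show "0 < e" "e \<le> 1" using sigma C V0 by (simp_all add: e_def)
    have "e \<le> c / (64 * C * (V + 1))" by (simp add: e_def)
    moreover have "0 < 64 * C * (V + 1)" using C V0 by simp
    ultimately have "e * (64 * C * (V + 1)) \<le> c" by (simp only: pos_le_divide_eq)
    moreover have "V * (64 * C * e) \<le> (V + 1) * (64 * C * e)" using C \<open>0 < e\<close> by (intro mult_right_mono) auto
    ultimately show "V * (8 * C * e) \<le> c / 8" by (simp add: algebra_simps)
  qed
  obtain g where g: "0 < g" and cont0: "\<And>A. (\<And>i j. \<bar>A $ i $ j - A0 $ i $ j\<bar> \<le> g) \<Longrightarrow>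
      det A \<noteq> 0 \<and> (\<forall>k. \<bar>(matrix_inv A *v e1) $ k - u0 $ k\<bar> \<le> e)"
    using matrix_inv_vector_continuous[OF detA0 e(1), of e1] unfolding u0_def by blast
  define \<gamma> where "\<gamma> = min (1 / 2) (g / 3)"
  have \<gamma>: "0 < \<gamma>" "\<gamma> \<le> 1 / 2" "3 * \<gamma> \<le> g" using g by (auto simp: \<gamma>_def)
  have cont: "det A \<noteq> 0 \<and> (\<forall>k. \<bar>(matrix_inv A *v e1) $ k - u0 $ k\<bar> \<le> e)"
    if "\<And>i j. \<bar>A $ i $ j - A0 $ i $ j\<bar> \<le> 3 * \<gamma>" for A
    by (rule cont0) (rule order_trans[OF that \<gamma>(3)])
  let ?m = "\<lambda>N. real N * window_mass (D N) (h N)"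
  let ?p = "\<lambda>N. measure (?M N)
          {d \<in> space (?M N).
             0 < (\<Sum>x\<in>window_points (D N) (h N). if cell_count N d x \<le> 1 then 1 else 0 :: nat)}"
  \<comment> \<open>17 counts the window count and the 16 matrix entries, all with tolerance
    \<gamma> and bound 1; the other term belongs to \<open>local_var\<close>, bounded by
    \<open>V * s^2\<close> with tolerance c/8.\<close>
  define K where "K = 17 / \<gamma>\<^sup>2 + (V * s\<^sup>2)\<^sup>2 / (c / 8)\<^sup>2"
  have "eventually (\<lambda>N. \<forall>j k. dist (Q_pop_scaled (D N) (h N) $ j $ k) (A0 $ j $ k) < \<gamma>) sequentially"
    by (intro eventually_all_finite tendstoD tendsto_vec_nth Q_limit \<gamma>(1))
  \<comment> \<open>The lower bound 1 ensures that the window mass is positive.\<close>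
  moreover have "eventually (\<lambda>N. max 1 (16 * C ^ 4 / (c\<^sup>2 * \<rho>)) \<le> ?m N) sequentially"
    using window_size unfolding filterlim_at_top by blast
  moreover have "eventually (\<lambda>N. ?p N + K / ?m N < \<delta>) sequentially"
  proof (rule order_tendstoD(2)[OF _ \<delta>])
    have "(\<lambda>N. K / ?m N) \<longlonglongrightarrow> 0"
      by (rule tendsto_divide_0[OF tendsto_const filterlim_at_top_imp_at_infinity[OF window_size]])
    from tendsto_add[OF cells this]
    show "(\<lambda>N. ?p N + K / ?m N) \<longlonglongrightarrow> 0"
      by simp
  qed
  ultimately show ?thesis using eventually_ge_at_top[of 1]
  proof eventually_elim
    case (elim N)
    note D = design[OF elim(4)] and h = bandwidth[OF elim(4)]
    interpret D: prob_space "D N" by (rule error_designD[OF D])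
    interpret M: prob_space "?M N" by (rule prob_space_sample_law) unfold_locales
    have sD: "sets (D N) = sets borel" using D by (simp add: error_designD)
    have mass: "0 < window_mass (D N) (h N)"
      using elim(2,4) by (smt (verit) mult_nonneg_nonpos of_nat_0_le_iff)
    define B0 where "B0 = {d \<in> space (?M N).
       0 < (\<Sum>x\<in>window_points (D N) (h N). if cell_count N d x \<le> 1 then 1 else 0 :: nat)}"
    define B where "B f r = {d \<in> space (?M N). r \<le>
      \<bar>(\<Sum>i=1..N. f (fst (d i))) / ?m N - (\<integral>z. f (fst z) \<partial>D N) / window_mass (D N) (h N)\<bar>}"
      for f and r :: real
    have finW: "finite (window_points (D N) (h N))" using D by (simp add: window_points_def error_designD)
    have B0_eq: "B0 = {d \<in> space (?M N). \<exists>x\<in>window_points (D N) (h N). real (cell_count N d x) \<le> 1}"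
    proof -
      have "(0 < (\<Sum>x\<in>window_points (D N) (h N). if cell_count N d x \<le> 1 then 1 else 0 :: nat)) =
          (\<exists>x\<in>window_points (D N) (h N). real (cell_count N d x) \<le> 1)" for d
        using finW by (subst neq0_conv[symmetric], subst sum_eq_0_iff) (auto split: if_splits)
      then show ?thesis by (simp add: B0_def)
    qed
    have B0: "B0 \<in> sets (?M N)"
      unfolding B0_eq
    proof (rule sets.sets_Collect_finite_Ex[OF _ finW])
      fix x
      note [measurable] = cell_count_measurable[OF sD]
      show "{d \<in> space (?M N). real (cell_count N d x) \<le> 1} \<in> sets (?M N)"
        by measurable
    qed
    have Bs: "B f r \<in> sets (?M N)" "M.prob (B f r) \<le> b\<^sup>2 / r\<^sup>2 / ?m N"
      if "f \<in> borel_measurable borel" "\<And>x. \<bar>f x\<bar> \<le> b * indicator {- h N..h N} x" "0 < r" for f b r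
      unfolding B_def using window_sum_concentrates[OF D elim(4) that(1,2) mass that(3)] by auto
    define fl where "fl jk x = lambda_mat (h N) x $ fst jk $ snd jk" for jk :: "4 \<times> 4" and x
    define fn :: "real \<Rightarrow> real" where "fn = indicator {- h N..h N}"
    define fv where "fv = local_var (D N) (h N) u0"
    have fn: "fn \<in> borel_measurable borel" "\<bar>fn x\<bar> \<le> 1 * indicator {- h N..h N} x" for x
      by (simp_all add: fn_def)
    have fl: "fl jk \<in> borel_measurable borel" "\<bar>fl jk x\<bar> \<le> 1 * indicator {- h N..h N} x" for jk x
      using lambda_mat_measurable lambda_mat_bound[OF h] by (simp_all add: fl_def[abs_def])
    note Bn = Bs[OF fn \<gamma>(1)]
    note Bl = Bs[OF fl \<gamma>(1)]
    have c8: "0 < c / 8" using sigma by simp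
    have Bv: "B fv (c / 8) \<in> sets (?M N)"
      "M.prob (B fv (c / 8)) \<le> (V * s\<^sup>2)\<^sup>2 / (c / 8)\<^sup>2 / ?m N"
      unfolding fv_def s_def
      by (rule Bs[OF local_var_measurable[OF D] local_var_bound[OF h V[OF elim(4)]] c8])+
    define bad where "bad = B0 \<union> (B fn \<gamma> \<union> (B fv (c / 8) \<union> (\<Union>jk\<in>UNIV. B (fl jk) \<gamma>)))"
    have Ul: "(\<Union>jk\<in>UNIV. B (fl jk) \<gamma>) \<in> sets (?M N)" using Bl(1) by (intro sets.finite_UN) auto
    have bad: "bad \<in> sets (?M N)" unfolding bad_def using B0 Bn(1) Bv(1) Ul by auto
    have "M.prob (\<Union>jk\<in>UNIV. B (fl jk) \<gamma>) \<le> (\<Sum>jk\<in>UNIV. M.prob (B (fl jk) \<gamma>))"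
      using Bl(1) by (intro M.finite_measure_subadditive_finite) auto
    also have "\<dots> \<le> (\<Sum>(jk::4\<times>4)\<in>UNIV. 1\<^sup>2 / \<gamma>\<^sup>2 / ?m N)" by (intro sum_mono Bl(2))
    also have "\<dots> = 16 / \<gamma>\<^sup>2 / ?m N" by simp
    finally have "M.prob bad \<le> M.prob B0 + (1\<^sup>2 / \<gamma>\<^sup>2 / ?m N + ((V * s\<^sup>2)\<^sup>2 / (c / 8)\<^sup>2 / ?m N + 16 / \<gamma>\<^sup>2 / ?m N))"
      unfolding bad_def using B0 Bn Bv Ul
      by (intro order_trans[OF measure_Un_le] add_mono order_refl) auto
    also have "\<dots> = M.prob B0 + K / ?m N"
      by (simp add: K_def add_divide_distrib)
    also have "\<dots> < \<delta>" using elim(3) by (simp add: B0_def)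
    finally have "M.prob bad < \<delta>" .
    then have pG: "1 - \<delta> \<le> M.prob (space (?M N) - bad)"
      using M.prob_compl[OF bad] by simp
    have "good_design \<rho> (D N) N (h N) d" if d: "d \<in> space (?M N) - bad" for d
    proof (rule good_design_of_close[where ?A0.0 = A0 and e = e and \<gamma> = \<gamma> and c = c and V = V,
          folded u0_def, folded s_def, folded C_def])
      have dB: "d \<notin> B0" "d \<notin> B fn \<gamma>" "d \<notin> B fv (c / 8)" "\<And>jk. d \<notin> B (fl jk) \<gamma>"
        and dsp: "d \<in> space (?M N)"
        using d by (auto simp: bad_def)
      show "error_design (D N)" "0 < h N" "1 \<le> N" "0 < window_mass (D N) (h N)" "0 < e" "e \<le> 1"
        "0 \<le> \<gamma>" "\<gamma> \<le> 1 / 2" "0 < c" "0 < \<rho>" "V * (8 * C * e) \<le> c / 8"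
        using D h elim(4) mass e \<gamma> sigma \<rho> small by auto
      show "det A \<noteq> 0 \<and> (\<forall>k. \<bar>(matrix_inv A *v e1) $ k - u0 $ k\<bar> \<le> e)"
        if "\<And>i j. \<bar>A $ i $ j - A0 $ i $ j\<bar> \<le> 3 * \<gamma>" for A by (rule cont[OF that])
      show "\<bar>Q_pop_scaled (D N) (h N) $ j $ k - A0 $ j $ k\<bar> \<le> \<gamma>" for j k
        using elim(1) by (simp add: dist_real_def less_imp_le)
      have win: "(\<integral>z. fn (fst z) \<partial>D N) / window_mass (D N) (h N) = 1"
        using mass window_mass_eq_integral[OF D, of "h N"] by (simp add: fn_def)
      show "\<bar>(\<Sum>i=1..N. indicator {- h N..h N} (fst (d i))) / ?m N - 1\<bar> \<le> \<gamma>"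
        using dB(2) dsp win by (simp add: B_def) (simp add: fn_def)
      show "\<bar>(\<Sum>i=1..N. lambda_mat (h N) (fst (d i)) $ j $ k) / ?m N - Q_pop_scaled (D N) (h N) $ j $ k\<bar> \<le> \<gamma>" for j k
        using dB(4)[of "(j, k)"] dsp by (simp add: B_def fl_def Q_pop_scaled_nth[OF D h])
      show "\<bar>(\<Sum>i=1..N. local_var (D N) (h N) u0 (fst (d i))) / ?m N -
          (\<integral>z. local_var (D N) (h N) u0 (fst z) \<partial>D N) / window_mass (D N) (h N)\<bar> \<le> c / 8"
        using dB(3) dsp by (simp add: B_def fv_def)
      show "2 \<le> cell_count N d x" if "x \<in> window_points (D N) (h N)" for x
        using dB(1) dsp that unfolding B0_eq by force
      show "c \<le> sigma2_tau (D N) (h N)" by (rule sigma(2)[OF elim(4)])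
      show "0 \<le> cond_var (D N) x" "cond_var (D N) x \<le> V" for x using V[OF elim(4)] by auto
      show "16 * C ^ 4 / (c\<^sup>2 * \<rho>) \<le> ?m N" using elim(2) by simp
    qed
    then show ?case using pG bad by blast
  qed
qed

section \<open>Honest coverage over the function class\<close>

theorem proposition1:
  fixes D :: "nat \<Rightarrow> (real \<times> real) measure"
    and h :: "nat \<Rightarrow> real"
    and K \<alpha> :: real
  assumes alpha: "0 < \<alpha>" "\<alpha> < 1"
    and K: "0 < K"
    and design: "\<And>N. 1 \<le> N \<Longrightarrow> error_design (D N)"
    and bandwidth: "\<And>N. 1 \<le> N \<Longrightarrow> 0 < h N"
    and fourth_moment:
      "(SUP N\<in>{1..}. SUP x\<in>x_support (D N). \<integral>\<^sup>+z. ennreal (snd z ^ 4) \<partial>given_x (D N) x) < \<infinity>"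
    and det_bound: "\<exists>C>0. \<forall>N\<ge>1. C < det (Q_pop_scaled (D N) (h N))"
    and window_size: "filterlim (\<lambda>N. real N * window_mass (D N) (h N)) at_top sequentially"
    and Q_limit: "convergent (\<lambda>N. Q_pop_scaled (D N) (h N))"
    and sigma_bounds:
      "\<exists>c B. 0 < c \<and> (\<forall>N\<ge>1. c \<le> sigma2_tau (D N) (h N) \<and> sigma2_tau (D N) (h N) \<le> B)"
    and cells:
      "(\<lambda>N. measure (sample_law N (D N))
          {d \<in> space (sample_law N (D N)).
             0 < (\<Sum>x\<in>window_points (D N) (h N). if cell_count N d x \<le> 1 then 1 else 0 :: nat)})
         \<longlonglongrightarrow> 0"
    and bandwidth_limit: "h \<longlonglongrightarrow> 0"
  shows "ereal (1 - \<alpha>) \<le>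
    liminf (\<lambda>N. INF \<mu>\<in>holder_class K. ereal (coverage (D N) N (h N) K \<alpha> \<mu>))"
proof -
  define V where "V = enn2real (SUP N\<in>{1..}. SUP x\<in>x_support (D N). \<integral>\<^sup>+z. ennreal (snd z ^ 4) \<partial>given_x (D N) x)"
  have V0: "0 \<le> V" by (simp add: V_def)
  have m4: "(\<integral>\<^sup>+z. ennreal (snd z ^ 4) \<partial>given_x (D N) x) \<le> ennreal V"
    if "1 \<le> N" "x \<in> x_support (D N)" for N x
  proof -
    have "(\<integral>\<^sup>+z. ennreal (snd z ^ 4) \<partial>given_x (D N) x) \<le>
        (SUP N\<in>{1..}. SUP x\<in>x_support (D N). \<integral>\<^sup>+z. ennreal (snd z ^ 4) \<partial>given_x (D N) x)"
      using that by (intro SUP_upper2[of N] SUP_upper) auto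
    also have "\<dots> = ennreal V" using fourth_moment by (simp add: V_def)
    finally show ?thesis .
  qed
  note mom = moments_of_fourth[OF design _ V0 m4]
  have cv0: "0 \<le> cond_var (D N) x" and cvV: "cond_var (D N) x \<le> 1 + V" if N: "1 \<le> N" for N x
    using mom(3,4)[OF N _ N, of x] cond_var_off_support[OF design[OF N], of x] V0
    by (cases "x \<in> x_support (D N)"; simp)+
  obtain a where a: "0 < a" "\<And>N. 1 \<le> N \<Longrightarrow> a < det (Q_pop_scaled (D N) (h N))" using det_bound by blast
  obtain A0 where A0: "(\<lambda>N. Q_pop_scaled (D N) (h N)) \<longlonglongrightarrow> A0" using Q_limit by (auto simp: convergent_def)
  obtain c where c: "0 < c" "\<And>N. 1 \<le> N \<Longrightarrow> c \<le> sigma2_tau (D N) (h N)" using sigma_bounds by blast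
  let ?L = "liminf (\<lambda>N. INF \<mu>\<in>holder_class K. ereal (coverage (D N) N (h N) K \<alpha> \<mu>))"
  show ?thesis
  proof (rule ereal_le_epsilon2)
    fix r :: real assume r: "0 < r"
    \<comment> \<open>\<delta> is spent twice, on the conditional coverage and on the designs that
      are not good, hence r/2. The cap keeps the conditional bound 1 - \<alpha> - \<delta>
      nonnegative, as multiplication by probabilities requires.\<close>
    define \<delta> where "\<delta> = min (r / 2) (1 - \<alpha>)"
    have "\<delta> \<le> r / 2" unfolding \<delta>_def by (rule min.cobounded1)
    then have \<delta>3: "2 * \<delta> \<le> r" by linarith
    have "0 < \<delta>" "\<delta> \<le> 1 - \<alpha>" using r alpha by (simp_all add: \<delta>_def)
    note \<delta> = this \<delta>3
    \<comment> \<open>The tolerance needs a strictly positive moment bound, and \<open>V\<close> may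
      be 0.\<close>
    have V1: "0 < V + 1" using V0 by simp
    obtain \<rho> where tol: "lyapunov_tolerance (1 - \<alpha>) \<delta> (V + 1) \<rho>"
      using lyapunov_tolerance_exists[of "1 - \<alpha>" \<delta> "V + 1"] alpha \<delta>(1) V1 by auto
    then have \<rho>: "0 < \<rho>" by (simp add: lyapunov_tolerance_def)
    have "eventually (\<lambda>N. \<exists>G\<in>sets (sample_law N (D N)). 1 - \<delta> \<le> measure (sample_law N (D N)) G \<and>
        (\<forall>d\<in>G. good_design \<rho> (D N) N (h N) d)) sequentially"
      by (rule good_design_likely[OF design bandwidth cv0 cvV a window_size A0 c cells \<rho> \<delta>(1)])
    then have "eventually (\<lambda>N. ereal (1 - \<alpha> - r) \<le>
        (INF \<mu>\<in>holder_class K. ereal (coverage (D N) N (h N) K \<alpha> \<mu>))) sequentially"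
      using eventually_ge_at_top[of 1]
    proof eventually_elim
      case (elim N)
      then obtain G where G: "G \<in> sets (sample_law N (D N))" "1 - \<delta> \<le> measure (sample_law N (D N)) G"
        "\<And>d. d \<in> G \<Longrightarrow> good_design \<rho> (D N) N (h N) d" by blast
      note D = design[OF elim(2)]
      have m: "integrable (given_x (D N) y) (\<lambda>z. snd z ^ 4) \<and> (\<integral>z. snd z ^ 4 \<partial>given_x (D N) y) \<le> V + 1"
        if "y \<in> x_support (D N)" for y
        using that mom(1,2)[OF elim(2) _ elim(2)] by force
      show ?case
      proof (rule INF_greatest)
        fix \<mu> assume \<mu>: "\<mu> \<in> holder_class K"
        note ce = coverage_eq[OF D holder_class_measurable[OF \<mu>] alpha, of N "h N" K]
        \<comment> \<open>\<rho> and \<open>G\<close> were fixed before \<mu>, so the lower bound on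
          the coverage is the same for the whole class.\<close>
        have "(1 - \<alpha> - \<delta>) * measure (sample_law N (D N)) G \<le> coverage (D N) N (h N) K \<alpha> \<mu>"
          unfolding ce(1)
          by (rule coverage_by_conditioning[OF D ce(2) G(1) _
                conditional_coverage[OF alpha tol D elim(2) \<mu> m _ _ G(3)]])
             (use \<delta>(2) in auto)
        moreover have "(1 - \<alpha> - \<delta>) * (1 - \<delta>) \<le> (1 - \<alpha> - \<delta>) * measure (sample_law N (D N)) G"
          using G(2) \<delta>(2) by (intro mult_left_mono) auto
        moreover have "1 - \<alpha> - r \<le> (1 - \<alpha> - \<delta>) * (1 - \<delta>)"
        proof -
          have "(1 - \<alpha> - \<delta>) * \<delta> \<le> 1 * \<delta>" using \<delta>(1) alpha by (intro mult_right_mono) auto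
          then show ?thesis using \<delta>(3) by (simp add: algebra_simps)
        qed
        ultimately show "ereal (1 - \<alpha> - r) \<le> ereal (coverage (D N) N (h N) K \<alpha> \<mu>)" by simp
      qed
    qed
    then have "ereal (1 - \<alpha> - r) \<le> ?L" by (rule Liminf_bounded)
    then have "ereal (1 - \<alpha> - r) + ereal r \<le> ?L + ereal r" by (rule add_right_mono)
    then show "ereal (1 - \<alpha>) \<le> ?L + ereal r" by simp
  qed
qed

end
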